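(* Let $F$ be a complete vector field on a connected finite-dimensional Riemannian manifold $(M,g)$ with flow $\varphi_t$, and let $u(t)=\varphi_t(u^0)$ be the exact solution of $\dot u=F(u)$, $u(0)=u^0\in M$. Let $\psi_h$ represent a numerical method $u^{k+1}=\psi_h(u^k)$ with step size $h>0$, started at $u^0$, whose local error can be bounded for some $p\in\mathbb{N}$ as $$d(\psi_h(u),\varphi_h(u))\le C\,h^{p+1}\qquad\text{for all } u\in M.$$ Suppose there is a constant $L>0$ such that $$\|\nabla F\|_g\le L,$$ where $\nabla$ is the Levi-Civita connection and $\|\cdot\|_g$ is the operator norm with respect to the metric $g$. Then the global error is bounded as $$d\bigl(u(kh),u^k\bigr)\le\frac{C}{L}\bigl(e^{khL}-1\bigr)h^p\qquad\text{for all } k>0.$$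
   Context: $d$ is the Riemannian distance function of $(M,g)$, and vector fields are smooth. The bound $\|\nabla F\|_g\le L$ is meant uniformly on $M$: at every $u\in M$ the linear map $T_uM\to T_uM$, $X\mapsto\nabla_XF$, has operator norm at most $L$ with respect to $g_u$. $C$ is a constant, and $k$ ranges over positive integers. *)

theory Defs
  imports "HOL-Analysis.Analysis"
begin

section \<open>Smooth maps between Euclidean spaces\<close>

primrec Ck_on :: "nat \<Rightarrow> 'a::real_normed_vector set \<Rightarrow> ('a \<Rightarrow> 'b::real_normed_vector) \<Rightarrow> bool"
  where
    "Ck_on 0 S f \<longleftrightarrow> continuous_on S f"
  | "Ck_on (Suc k) S f \<longleftrightarrow>
       (\<forall>x\<in>S. f differentiable (at x)) \<and>
       (\<forall>v. Ck_on k S (\<lambda>x. frechet_derivative f (at x) v))"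

text \<open>Only used for open \<open>S\<close> in a finite-dimensional space, where continuity of all directional
  derivatives is continuity of the derivative.\<close>

definition smooth_on :: "'a::real_normed_vector set \<Rightarrow> ('a \<Rightarrow> 'b::real_normed_vector) \<Rightarrow> bool"
  where "smooth_on S f \<longleftrightarrow> (\<forall>k. Ck_on k S f)"


section \<open>Smooth manifolds\<close>

text \<open>The manifold is the whole type \<open>'m\<close>, modelled on the Euclidean space \<open>'e\<close>. A chart is a pair
  of its domain and its coordinate map; the coordinate map is arbitrary outside the domain. An atlas
  need not be maximal.\<close>

type_synonym ('m, 'e) chart = "'m set \<times> ('m \<Rightarrow> 'e)"

abbreviation chart_dom :: "('m, 'e) chart \<Rightarrow> 'm set"
  where "chart_dom \<equiv> fst"

abbreviation chart_map :: "('m, 'e) chart \<Rightarrow> 'm \<Rightarrow> 'e"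
  where "chart_map \<equiv> snd"

definition chart_img :: "('m, 'e) chart \<Rightarrow> 'e set"
  where "chart_img c = chart_map c ` chart_dom c"

definition chart_inv :: "('m, 'e) chart \<Rightarrow> 'e \<Rightarrow> 'm"
  where "chart_inv c = inv_into (chart_dom c) (chart_map c)"

definition transition :: "('m, 'e) chart \<Rightarrow> ('m, 'e) chart \<Rightarrow> 'e \<Rightarrow> 'e"
  where "transition c c' = chart_map c' \<circ> chart_inv c"

definition is_chart :: "('m::topological_space, 'e::euclidean_space) chart \<Rightarrow> bool"
  where "is_chart c \<longleftrightarrow> open (chart_dom c) \<and> open (chart_img c) \<and>
    homeomorphism (chart_dom c) (chart_img c) (chart_map c) (chart_inv c)"

definition smooth_atlas :: "('m::topological_space, 'e::euclidean_space) chart set \<Rightarrow> bool"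
  where "smooth_atlas A \<longleftrightarrow>
    (\<forall>c\<in>A. is_chart c) \<and> (\<Union>c\<in>A. chart_dom c) = UNIV \<and>
    (\<forall>c\<in>A. \<forall>c'\<in>A.
       smooth_on (chart_map c ` (chart_dom c \<inter> chart_dom c')) (transition c c'))"

text \<open>A tangent vector at \<open>p\<close> is the family of its components in all charts around \<open>p\<close>, related by
  the derivatives of the transition maps. Components in other charts are set to \<open>0\<close>, so that
  equal tangent vectors are equal as functions.\<close>

type_synonym ('m, 'e) tvec = "('m, 'e) chart \<Rightarrow> 'e"

definition charts_at :: "('m, 'e) chart set \<Rightarrow> 'm \<Rightarrow> ('m, 'e) chart set"
  where "charts_at A p = {c \<in> A. p \<in> chart_dom c}"

definition tangent_space ::
    "('m, 'e::euclidean_space) chart set \<Rightarrow> 'm \<Rightarrow> ('m, 'e) tvec set"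
  where "tangent_space A p = {v.
    (\<forall>c\<in>charts_at A p. \<forall>c'\<in>charts_at A p.
       v c' = frechet_derivative (transition c c') (at (chart_map c p)) (v c)) \<and>
    (\<forall>c. c \<notin> charts_at A p \<longrightarrow> v c = 0)}"

text \<open>The tangent vector at \<open>p\<close> whose component in the chart \<open>c\<close> is \<open>a\<close>.\<close>

definition tangent_of ::
    "('m, 'e::euclidean_space) chart set \<Rightarrow> ('m, 'e) chart \<Rightarrow> 'm \<Rightarrow> 'e \<Rightarrow> ('m, 'e) tvec"
  where "tangent_of A c p a = (\<lambda>c'. if c' \<in> charts_at A p
    then frechet_derivative (transition c c') (at (chart_map c p)) a else 0)"


section \<open>Vector fields and flows\<close>

text \<open>The representation of \<open>F\<close> in the chart \<open>c\<close>.\<close>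

definition field_in_chart ::
    "('m, 'e) chart \<Rightarrow> ('m \<Rightarrow> ('m, 'e) tvec) \<Rightarrow> 'e \<Rightarrow> 'e"
  where "field_in_chart c F = (\<lambda>x. F (chart_inv c x) c)"

definition smooth_vector_field ::
    "('m, 'e::euclidean_space) chart set \<Rightarrow> ('m \<Rightarrow> ('m, 'e) tvec) \<Rightarrow> bool"
  where "smooth_vector_field A F \<longleftrightarrow>
    (\<forall>p. F p \<in> tangent_space A p) \<and> (\<forall>c\<in>A. smooth_on (chart_img c) (field_in_chart c F))"

text \<open>Continuity of \<open>\<gamma>\<close> is needed separately, because \<open>chart_map c\<close> is unconstrained outside
  the chart domain.\<close>

definition integral_curve ::
    "('m::topological_space, 'e::euclidean_space) chart set \<Rightarrow> ('m \<Rightarrow> ('m, 'e) tvec)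
      \<Rightarrow> (real \<Rightarrow> 'm) \<Rightarrow> bool"
  where "integral_curve A F \<gamma> \<longleftrightarrow> continuous_on UNIV \<gamma> \<and>
    (\<forall>t. \<forall>c\<in>charts_at A (\<gamma> t).
       ((chart_map c \<circ> \<gamma>) has_vector_derivative F (\<gamma> t) c) (at t))"

definition complete_vector_field ::
    "('m::topological_space, 'e::euclidean_space) chart set \<Rightarrow> ('m \<Rightarrow> ('m, 'e) tvec) \<Rightarrow> bool"
  where "complete_vector_field A F \<longleftrightarrow> (\<forall>p. \<exists>\<gamma>. integral_curve A F \<gamma> \<and> \<gamma> 0 = p)"

definition is_flow ::
    "('m::topological_space, 'e::euclidean_space) chart set \<Rightarrow> ('m \<Rightarrow> ('m, 'e) tvec)
      \<Rightarrow> (real \<Rightarrow> 'm \<Rightarrow> 'm) \<Rightarrow> bool"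
  where "is_flow A F \<phi> \<longleftrightarrow> (\<forall>p. \<phi> 0 p = p \<and> integral_curve A F (\<lambda>t. \<phi> t p))"


section \<open>Riemannian metrics and the Riemannian distance\<close>

definition metric_in_chart ::
    "('m, 'e::euclidean_space) chart set \<Rightarrow> ('m \<Rightarrow> ('m, 'e) tvec \<Rightarrow> ('m, 'e) tvec \<Rightarrow> real)
      \<Rightarrow> ('m, 'e) chart \<Rightarrow> 'e \<Rightarrow> 'e \<Rightarrow> 'e \<Rightarrow> real"
  where "metric_in_chart A g c x a b =
    g (chart_inv c x) (tangent_of A c (chart_inv c x) a) (tangent_of A c (chart_inv c x) b)"

definition riemannian_metric ::
    "('m, 'e::euclidean_space) chart set \<Rightarrow> ('m \<Rightarrow> ('m, 'e) tvec \<Rightarrow> ('m, 'e) tvec \<Rightarrow> real)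
      \<Rightarrow> bool"
  where "riemannian_metric A g \<longleftrightarrow>
    (\<forall>p. \<forall>u\<in>tangent_space A p. \<forall>v\<in>tangent_space A p.
       g p u v = g p v u \<and>
       (\<forall>w\<in>tangent_space A p. g p (\<lambda>c. u c + v c) w = g p u w + g p v w) \<and>
       (\<forall>r. g p (\<lambda>c. r *\<^sub>R u c) v = r * g p u v) \<and>
       (u \<noteq> (\<lambda>c. 0) \<longrightarrow> g p u u > 0)) \<and>
    (\<forall>c\<in>A. \<forall>a b. smooth_on (chart_img c) (\<lambda>x. metric_in_chart A g c x a b))"

definition tangent_norm ::
    "('m \<Rightarrow> ('m, 'e) tvec \<Rightarrow> ('m, 'e) tvec \<Rightarrow> real) \<Rightarrow> 'm \<Rightarrow> ('m, 'e) tvec \<Rightarrow> real"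
  where "tangent_norm g p v = sqrt (g p v v)"

definition velocity ::
    "('m, 'e::euclidean_space) chart set \<Rightarrow> (real \<Rightarrow> 'm) \<Rightarrow> real set \<Rightarrow> real
      \<Rightarrow> ('m, 'e) tvec"
  where "velocity A \<gamma> I t = (\<lambda>c. if c \<in> charts_at A (\<gamma> t)
    then vector_derivative (chart_map c \<circ> \<gamma>) (at t within I) else 0)"

text \<open>Curves of class \<open>C\<^sup>1\<close> on \<open>{a..b}\<close>, with one-sided derivatives at the end points.\<close>

definition C1_curve_on ::
    "('m::topological_space, 'e::euclidean_space) chart set \<Rightarrow> (real \<Rightarrow> 'm)
      \<Rightarrow> real \<Rightarrow> real \<Rightarrow> bool"
  where "C1_curve_on A \<gamma> a b \<longleftrightarrow> continuous_on {a..b} \<gamma> \<and>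
    (\<forall>c\<in>A. (\<forall>t\<in>{a..b} \<inter> \<gamma> -` chart_dom c.
               (chart_map c \<circ> \<gamma>) differentiable (at t within {a..b})) \<and>
            continuous_on ({a..b} \<inter> \<gamma> -` chart_dom c) (\<lambda>t. velocity A \<gamma> {a..b} t c))"

definition piecewise_C1_path ::
    "('m::topological_space, 'e::euclidean_space) chart set \<Rightarrow> (real \<Rightarrow> 'm) \<Rightarrow> bool"
  where "piecewise_C1_path A \<gamma> \<longleftrightarrow> path \<gamma> \<and>
    (\<exists>n (\<tau> :: nat \<Rightarrow> real). \<tau> 0 = 0 \<and> \<tau> n = 1 \<and>
       (\<forall>i<n. \<tau> i < \<tau> (Suc i) \<and> C1_curve_on A \<gamma> (\<tau> i) (\<tau> (Suc i))))"

text \<open>At the finitely many break points of a piecewise \<open>C\<^sup>1\<close> path the value of the integrand is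
  irrelevant.\<close>

definition riemannian_length ::
    "('m, 'e::euclidean_space) chart set \<Rightarrow> ('m \<Rightarrow> ('m, 'e) tvec \<Rightarrow> ('m, 'e) tvec \<Rightarrow> real)
      \<Rightarrow> (real \<Rightarrow> 'm) \<Rightarrow> real"
  where "riemannian_length A g \<gamma> =
    integral {0..1} (\<lambda>t. tangent_norm g (\<gamma> t) (velocity A \<gamma> {0..1} t))"

definition riemannian_dist ::
    "('m::topological_space, 'e::euclidean_space) chart set
      \<Rightarrow> ('m \<Rightarrow> ('m, 'e) tvec \<Rightarrow> ('m, 'e) tvec \<Rightarrow> real) \<Rightarrow> 'm \<Rightarrow> 'm \<Rightarrow> real"
  where "riemannian_dist A g p q = Inf {riemannian_length A g \<gamma> |\<gamma>.
    piecewise_C1_path A \<gamma> \<and> pathstart \<gamma> = p \<and> pathfinish \<gamma> = q}"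


section \<open>The Levi-Civita connection\<close>

text \<open>In a chart with Christoffel map \<open>\<Gamma>\<close>, the connection sends \<open>X, Y\<close> to \<open>DY(X) + \<Gamma>(X, Y)\<close>.
  Torsion-freeness is the symmetry of \<open>\<Gamma>\<close>, and compatibility with the metric, evaluated on
  constant coordinate fields, is the last condition. The lemma \<open>christoffel_ex1\<close> below shows that at
  every point there is exactly one such \<open>\<Gamma>\<close>.\<close>

definition is_christoffel ::
    "('m, 'e::euclidean_space) chart set \<Rightarrow> ('m \<Rightarrow> ('m, 'e) tvec \<Rightarrow> ('m, 'e) tvec \<Rightarrow> real)
      \<Rightarrow> ('m, 'e) chart \<Rightarrow> 'e \<Rightarrow> ('e \<Rightarrow> 'e \<Rightarrow> 'e) \<Rightarrow> bool"
  where "is_christoffel A g c x \<Gamma> \<longleftrightarrow> bilinear \<Gamma> \<and> (\<forall>a b. \<Gamma> a b = \<Gamma> b a) \<and>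
    (\<forall>w a b. frechet_derivative (\<lambda>y. metric_in_chart A g c y a b) (at x) w =
       metric_in_chart A g c x (\<Gamma> w a) b + metric_in_chart A g c x a (\<Gamma> w b))"

lemma smooth_on_differentiable:
  assumes "smooth_on S f" "x \<in> S"
  shows "f differentiable (at x)"
proof -
  have "Ck_on (Suc 0) S f" using assms(1) unfolding smooth_on_def by blast
  then show ?thesis using assms(2) by simp
qed

lemma chart_simps:
  assumes "smooth_atlas A" "c \<in> A"
  shows "open (chart_dom c)" "open (chart_img c)"
    "homeomorphism (chart_dom c) (chart_img c) (chart_map c) (chart_inv c)"
    "\<And>p. p \<in> chart_dom c \<Longrightarrow> chart_inv c (chart_map c p) = p"
    "\<And>x. x \<in> chart_img c \<Longrightarrow> chart_map c (chart_inv c x) = x"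
    "\<And>x. x \<in> chart_img c \<Longrightarrow> chart_inv c x \<in> chart_dom c"
    "\<And>p. p \<in> chart_dom c \<Longrightarrow> chart_map c p \<in> chart_img c"
proof -
  have c: "is_chart c" using assms unfolding smooth_atlas_def by blast
  then show "open (chart_dom c)" "open (chart_img c)"
    "homeomorphism (chart_dom c) (chart_img c) (chart_map c) (chart_inv c)"
    unfolding is_chart_def by blast+
  then show "\<And>p. p \<in> chart_dom c \<Longrightarrow> chart_inv c (chart_map c p) = p"
    "\<And>x. x \<in> chart_img c \<Longrightarrow> chart_map c (chart_inv c x) = x"
    "\<And>x. x \<in> chart_img c \<Longrightarrow> chart_inv c x \<in> chart_dom c"
    "\<And>p. p \<in> chart_dom c \<Longrightarrow> chart_map c p \<in> chart_img c"
    unfolding homeomorphism_def by blast+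
qed

lemma open_overlap:
  assumes "smooth_atlas A" "c \<in> A" "c' \<in> A"
  shows "open (chart_map c ` (chart_dom c \<inter> chart_dom c'))"
proof -
  have "openin (top_of_set (chart_img c)) (chart_map c ` (chart_dom c \<inter> chart_dom c'))"
    by (rule homeomorphism_imp_open_map[OF chart_simps(3)[OF assms(1,2)]])
       (rule openin_open_Int[OF chart_simps(1)[OF assms(1,3)]])
  then show ?thesis using chart_simps(2)[OF assms(1,2)] by (rule openin_open_trans)
qed

lemma transition_differentiable:
  assumes "smooth_atlas A" "c \<in> charts_at A p" "c' \<in> charts_at A p"
  shows "transition c c' differentiable (at (chart_map c p))"
proof (rule smooth_on_differentiable)
  show "smooth_on (chart_map c ` (chart_dom c \<inter> chart_dom c')) (transition c c')"
    using assms unfolding smooth_atlas_def charts_at_def by blast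
  show "chart_map c p \<in> chart_map c ` (chart_dom c \<inter> chart_dom c')"
    using assms(2,3) unfolding charts_at_def by blast
qed

lemma transition_cocycle:
  assumes A: "smooth_atlas A" and c: "c \<in> charts_at A p" "c1 \<in> charts_at A p" "c2 \<in> charts_at A p"
  shows "frechet_derivative (transition c c2) (at (chart_map c p)) a =
    frechet_derivative (transition c1 c2) (at (chart_map c1 p))
      (frechet_derivative (transition c c1) (at (chart_map c p)) a)"
proof -
  define S where "S = chart_map c ` (chart_dom c \<inter> chart_dom c1)"
  have cA: "c \<in> A" "c1 \<in> A" "c2 \<in> A" and p: "p \<in> chart_dom c" "p \<in> chart_dom c1"
    using c by (auto simp: charts_at_def)
  have S: "open S" "chart_map c p \<in> S"
    unfolding S_def using open_overlap[OF A cA(1,2)] p by auto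
  have tp: "transition c c1 (chart_map c p) = chart_map c1 p"
    using chart_simps(4)[OF A cA(1) p(1)] by (simp add: transition_def)
  have "(transition c1 c2 \<circ> transition c c1 has_derivative
     frechet_derivative (transition c1 c2) (at (chart_map c1 p)) \<circ>
      frechet_derivative (transition c c1) (at (chart_map c p))) (at (chart_map c p))"
    by (rule diff_chain_at)
       (use transition_differentiable[OF A] c tp in \<open>auto simp: frechet_derivative_works[symmetric]\<close>)
  then have "(transition c c2 has_derivative
     frechet_derivative (transition c1 c2) (at (chart_map c1 p)) \<circ>
      frechet_derivative (transition c c1) (at (chart_map c p))) (at (chart_map c p))"
    by (rule has_derivative_transform_within_open[OF _ S])
       (use chart_simps(4)[OF A cA(1)] chart_simps(4)[OF A cA(2)] in \<open>auto simp: S_def transition_def\<close>)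
  from frechet_derivative_at[OF this] show ?thesis by (metis comp_apply)
qed

lemma transition_self:
  assumes A: "smooth_atlas A" and c: "c \<in> charts_at A p"
  shows "frechet_derivative (transition c c) (at (chart_map c p)) a = a"
proof -
  have cA: "c \<in> A" "p \<in> chart_dom c" using c by (auto simp: charts_at_def)
  have "(transition c c has_derivative (\<lambda>x. x)) (at (chart_map c p))"
    by (rule has_derivative_transform_within_open[OF has_derivative_ident, of "chart_img c"])
       (use chart_simps(2,5,7)[OF A cA(1)] cA(2) in \<open>auto simp: transition_def\<close>)
  from frechet_derivative_at[OF this] show ?thesis by metis
qed

lemma tangent_of_in_tangent_space:
  assumes A: "smooth_atlas A" and c: "c \<in> charts_at A p"
  shows "tangent_of A c p a \<in> tangent_space A p"
  unfolding tangent_space_def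
proof (intro CollectI conjI ballI allI impI)
  fix c1 c2 assume c12: "c1 \<in> charts_at A p" "c2 \<in> charts_at A p"
  show "tangent_of A c p a c2 =
      frechet_derivative (transition c1 c2) (at (chart_map c1 p)) (tangent_of A c p a c1)"
    unfolding tangent_of_def if_P[OF c12(1)] if_P[OF c12(2)]
    by (rule transition_cocycle[OF A c c12])
qed (simp add: tangent_of_def)

lemma tangent_of_linear:
  assumes A: "smooth_atlas A" and c: "c \<in> charts_at A p"
  shows "tangent_of A c p (a + b) = (\<lambda>c'. tangent_of A c p a c' + tangent_of A c p b c')"
    and "tangent_of A c p (r *\<^sub>R a) = (\<lambda>c'. r *\<^sub>R tangent_of A c p a c')"
proof -
  note lin = linear_frechet_derivative[OF transition_differentiable[OF A c]]
  show "tangent_of A c p (a + b) = (\<lambda>c'. tangent_of A c p a c' + tangent_of A c p b c')"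
    by (rule ext) (simp add: tangent_of_def linear_add[OF lin])
  show "tangent_of A c p (r *\<^sub>R a) = (\<lambda>c'. r *\<^sub>R tangent_of A c p a c')"
    by (rule ext) (simp add: tangent_of_def linear_scale[OF lin])
qed

lemma metric_in_chart_inner:
  assumes A: "smooth_atlas A" and g: "riemannian_metric A g" and c: "c \<in> A" and x: "x \<in> chart_img c"
  shows "bilinear (metric_in_chart A g c x)"
    and "metric_in_chart A g c x a b = metric_in_chart A g c x b a"
    and "a \<noteq> 0 \<Longrightarrow> metric_in_chart A g c x a a > 0"
proof -
  define p where "p = chart_inv c x"
  have cp: "c \<in> charts_at A p" using c x chart_simps(6)[OF A c] by (auto simp: charts_at_def p_def)
  note T = tangent_of_in_tangent_space[OF A cp]
  have G: "g p u v = g p v u" "g p (\<lambda>c. u c + v c) w = g p u w + g p v w"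
      "g p (\<lambda>c. r *\<^sub>R u c) v = r * g p u v" "u \<noteq> (\<lambda>c. 0) \<Longrightarrow> g p u u > 0"
    if "u \<in> tangent_space A p" "v \<in> tangent_space A p" "w \<in> tangent_space A p" for u v w r
    using g that unfolding riemannian_metric_def by blast+
  note G = G(1)[OF _ _ T] G(2) G(3)[OF _ _ T] G(4)[OF _ T T]
  show sym: "metric_in_chart A g c x a b = metric_in_chart A g c x b a" for a b
    using G(1) T by (auto simp: metric_in_chart_def p_def)
  have lin: "linear (\<lambda>a. metric_in_chart A g c x a b)" for b
    using G(2,3) T by (intro linearI) (auto simp: metric_in_chart_def p_def[symmetric] tangent_of_linear[OF A cp])
  have "metric_in_chart A g c x a = (\<lambda>b. metric_in_chart A g c x b a)" for a by (intro ext sym)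
  then show "bilinear (metric_in_chart A g c x)"
    using lin unfolding bilinear_def by metis
  assume "a \<noteq> 0"
  have "tangent_of A c p a c = a"
    using transition_self[OF A cp, of a] cp by (simp add: tangent_of_def)
  then have "tangent_of A c p a \<noteq> (\<lambda>c. 0)" using \<open>a \<noteq> 0\<close> by metis
  then show "metric_in_chart A g c x a a > 0" using G(4) T by (auto simp: metric_in_chart_def p_def)
qed

text \<open>The algebraic core of the fundamental theorem of Riemannian geometry (Koszul).\<close>

lemma koszul_ex1:
  fixes G :: "'e::euclidean_space \<Rightarrow> 'e \<Rightarrow> real" and D :: "'e \<Rightarrow> 'e \<Rightarrow> 'e \<Rightarrow> real"
  assumes G: "bilinear G" "\<And>a b. G a b = G b a" "\<And>a. a \<noteq> 0 \<Longrightarrow> G a a > 0"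
    and D: "\<And>a b. linear (\<lambda>w. D w a b)" "\<And>w b. linear (\<lambda>a. D w a b)" "\<And>w a b. D w a b = D w b a"
  shows "\<exists>!\<Gamma>. bilinear \<Gamma> \<and> (\<forall>a b. \<Gamma> a b = \<Gamma> b a) \<and>
    (\<forall>w a b. D w a b = G (\<Gamma> w a) b + G a (\<Gamma> w b))"
proof -
  have Gl: "linear (G a)" "linear (\<lambda>a. G a b)" for a b
    using G(1) by (auto simp: bilinear_def)
  have nondeg: "y = z" if "\<And>b. G y b = G z b" for y z
  proof (rule ccontr)
    assume "y \<noteq> z"
    then have "G (y - z) (y - z) > 0" by (intro G(3)) auto
    moreover have "G (y - z) (y - z) = 0"
      using that[of "y - z"] linear_diff[OF Gl(2), of y z "y - z"] by simp
    ultimately show False by simp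
  qed
  have riesz: "\<exists>z. \<forall>b. G z b = f b" if f: "linear f" for f :: "'e \<Rightarrow> real"
  proof -
    define T where "T z = (\<Sum>b\<in>Basis. G z b *\<^sub>R b)" for z
    have linT: "linear T"
      unfolding T_def by (intro linearI)
        (simp_all add: linear_add[OF Gl(2)] linear_scale[OF Gl(2)] scaleR_add_left sum.distrib scaleR_sum_right)
    have Tb: "T z \<bullet> b = G z b" if "b \<in> Basis" for z b
      using that unfolding T_def by (simp add: inner_sum_left inner_Basis if_distrib cong: if_cong)
    have "inj T"
    proof (rule injI)
      fix y z assume "T y = T z"
      then have *: "G y b = G z b" if "b \<in> Basis" for b using Tb[OF that] by metis
      show "y = z"
        by (rule nondeg) (rule linear_eq_on_span[OF Gl(1) Gl(1), of Basis], use * in auto)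
    qed
    then have "surj T" using linT linear_injective_imp_surjective by blast
    then obtain z where z: "T z = (\<Sum>b\<in>Basis. f b *\<^sub>R b)" by (metis surjD)
    have "G z b = f b" if "b \<in> Basis" for b
      using Tb[OF that, of z] z that by (simp add: inner_sum_left inner_Basis if_distrib cong: if_cong)
    then have "G z b = f b" for b
      by (rule linear_eq_on_span[OF Gl(1) f, of Basis]) auto
    then show ?thesis by blast
  qed
  have D2: "linear (\<lambda>b. D w a b)" for w a
    using D(2)[of w a] by (simp only: D(3)[of w a])
  define K where "K a b w = (D a b w + D b a w - D w a b) / 2" for a b w
  have linK: "linear (K a b)" for a b
    unfolding K_def
    by (intro linearI)
      (simp_all add: linear_add[OF D(1)] linear_scale[OF D(1)] linear_add[OF D2] linear_scale[OF D2] field_simps)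
  define H where "H a b = (SOME z. \<forall>w. G z w = K a b w)" for a b
  have H: "G (H a b) w = K a b w" for a b w
    using someI_ex[OF riesz[OF linK[of a b]]] unfolding H_def by blast
  have Hsym: "H a b = H b a" for a b
  proof (rule nondeg)
    fix w show "G (H a b) w = G (H b a) w"
      unfolding H K_def using D(3)[of w a b] by argo
  qed
  have linH: "linear (H a)" for a
  proof (rule linearI)
    fix x y show "H a (x + y) = H a x + H a y"
      by (rule nondeg) (simp add: H linear_add[OF Gl(2)] K_def linear_add[OF D(1)] linear_add[OF D(2)]
          linear_add[OF D2] field_simps)
  next
    fix r x show "H a (r *\<^sub>R x) = r *\<^sub>R H a x"
      by (rule nondeg) (simp add: H linear_scale[OF Gl(2)] K_def linear_scale[OF D(1)] linear_scale[OF D(2)]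
          linear_scale[OF D2] field_simps)
  qed
  show ?thesis
  proof (rule ex1I[of _ H], intro conjI allI)
    have "(\<lambda>a. H a b) = H b" for b by (intro ext Hsym)
    then show "bilinear H" unfolding bilinear_def using linH by simp
    show "H a b = H b a" for a b by (rule Hsym)
    show "D w a b = G (H w a) b + G a (H w b)" for w a b
      using H[of w a b] H[of w b a] G(2)[of a "H w b"] D(3)[of w a b] D(3)[of a w b] D(3)[of b w a]
      unfolding K_def by argo
  next
    fix \<Gamma> assume A: "bilinear \<Gamma> \<and> (\<forall>a b. \<Gamma> a b = \<Gamma> b a) \<and>
      (\<forall>w a b. D w a b = G (\<Gamma> w a) b + G a (\<Gamma> w b))"
    have "G (\<Gamma> a b) w = K a b w" for a b w
    proof -
      have "D a b w = G (\<Gamma> a b) w + G b (\<Gamma> a w)" "D b a w = G (\<Gamma> a b) w + G a (\<Gamma> b w)"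
        "D w a b = G b (\<Gamma> a w) + G a (\<Gamma> b w)"
        using A[THEN conjunct2, THEN conjunct2, rule_format] A[THEN conjunct2, THEN conjunct1, rule_format]
          G(2) by metis+
      then show ?thesis unfolding K_def by argo
    qed
    then show "\<Gamma> = H" by (intro ext nondeg) (simp add: H)
  qed
qed

lemma christoffel_ex1:
  assumes A: "smooth_atlas A" and g: "riemannian_metric A g" and c: "c \<in> A" and x: "x \<in> chart_img c"
  shows "\<exists>!\<Gamma>. is_christoffel A g c x \<Gamma>"
proof -
  let ?G = "metric_in_chart A g c"
  let ?D = "\<lambda>w a b. frechet_derivative (\<lambda>y. ?G y a b) (at x) w"
  have diff: "(\<lambda>y. ?G y a b) differentiable (at x)" for a b
    using g c x by (intro smooth_on_differentiable[of "chart_img c"]) (auto simp: riemannian_metric_def)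
  note hd = diff[unfolded frechet_derivative_works]
  note op = chart_simps(2)[OF A c]
  note inner = metric_in_chart_inner[OF A g c]
  have lin: "linear (\<lambda>a. ?G y a b)" if "y \<in> chart_img c" for y b
    using inner(1)[OF that] by (simp add: bilinear_def)
  have add: "?D w (a + a') b = ?D w a b + ?D w a' b" for w a a' b
  proof -
    have "((\<lambda>y. ?G y (a + a') b) has_derivative (\<lambda>w. ?D w a b + ?D w a' b)) (at x)"
      by (rule has_derivative_transform_within_open[OF has_derivative_add[OF hd hd] op x])
         (simp add: linear_add[OF lin])
    from frechet_derivative_at[OF this] show ?thesis by metis
  qed
  have scale: "?D w (r *\<^sub>R a) b = r * ?D w a b" for w r a b
  proof -
    have "((\<lambda>y. ?G y (r *\<^sub>R a) b) has_derivative (\<lambda>w. r * ?D w a b)) (at x)"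
      by (rule has_derivative_transform_within_open[OF has_derivative_mult_right[OF hd] op x])
         (simp add: linear_scale[OF lin])
    from frechet_derivative_at[OF this] show ?thesis by metis
  qed
  have sym: "?D w a b = ?D w b a" for w a b
  proof -
    have "((\<lambda>y. ?G y a b) has_derivative (\<lambda>w. ?D w b a)) (at x)"
      by (rule has_derivative_transform_within_open[OF hd op x]) (simp add: inner(2))
    from frechet_derivative_at[OF this] show ?thesis by metis
  qed
  show ?thesis unfolding is_christoffel_def
  proof (rule koszul_ex1)
    show "linear (\<lambda>w. ?D w a b)" for a b by (rule linear_frechet_derivative[OF diff])
    show "linear (\<lambda>a. ?D w a b)" for w b by (intro linearI) (simp_all add: add scale)
    show "bilinear (?G x)" by (rule inner(1)[OF x])
    show "?G x a b = ?G x b a" for a b by (rule inner(2)[OF x])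
    show "?G x a a > 0" if "a \<noteq> 0" for a by (rule inner(3)[OF x that])
    show "?D w a b = ?D w b a" for w a b by (rule sym)
  qed
qed

definition christoffel ::
    "('m, 'e::euclidean_space) chart set \<Rightarrow> ('m \<Rightarrow> ('m, 'e) tvec \<Rightarrow> ('m, 'e) tvec \<Rightarrow> real)
      \<Rightarrow> ('m, 'e) chart \<Rightarrow> 'e \<Rightarrow> 'e \<Rightarrow> 'e \<Rightarrow> 'e"
  where "christoffel A g c x = (THE \<Gamma>. is_christoffel A g c x \<Gamma>)"

text \<open>The covariant derivative of the vector field \<open>F\<close> at \<open>p\<close> in the direction \<open>X\<close>, where \<open>X\<close> is a
  tangent vector at \<open>p\<close>.\<close>

definition levi_civita ::
    "('m, 'e::euclidean_space) chart set \<Rightarrow> ('m \<Rightarrow> ('m, 'e) tvec \<Rightarrow> ('m, 'e) tvec \<Rightarrow> real)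
      \<Rightarrow> ('m \<Rightarrow> ('m, 'e) tvec) \<Rightarrow> 'm \<Rightarrow> ('m, 'e) tvec \<Rightarrow> ('m, 'e) tvec"
  where "levi_civita A g F p X = (\<lambda>c. if c \<in> charts_at A p
    then frechet_derivative (field_in_chart c F) (at (chart_map c p)) (X c)
         + christoffel A g c (chart_map c p) (X c) (F p c)
    else 0)"

text \<open>As for \<^const>\<open>onorm\<close>, the zero vector contributes \<open>0 / 0 = 0\<close> to the supremum.\<close>

definition tangent_onorm ::
    "('m, 'e::euclidean_space) chart set \<Rightarrow> ('m \<Rightarrow> ('m, 'e) tvec \<Rightarrow> ('m, 'e) tvec \<Rightarrow> real)
      \<Rightarrow> 'm \<Rightarrow> (('m, 'e) tvec \<Rightarrow> ('m, 'e) tvec) \<Rightarrow> real"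
  where "tangent_onorm A g p T =
    (SUP v\<in>tangent_space A p. tangent_norm g p (T v) / tangent_norm g p v)"

end

(* The bound on the covariant derivative controls the Lie derivative of the metric along F, so the flow
   expands lengths by at most the factor exp (L t), and d (phi_h x, phi_h y) <= exp (L h) d (x, y). The
   global error then satisfies e_(k+1) <= exp (L h) e_k + C h^(p+1) with e_0 = 0, which sums to the bound.

   Differentiability of the flow in its initial value is avoided. In a chart, the Euler step
   x + s F(x) is a smooth map which expands lengths by at most 1 + (L + eps) s and agrees with the flow
   up to o(s); composing many such steps gives the estimate for nearby points and short times, and
   bisection of the time interval and of a nearly shortest path makes it global. *)

theory Submission
  imports Defs
begin

text \<open>The hypothesis speaks of tangent vectors, the estimate of coordinates. Reading the
  former in a chart requires that the covariant derivative of F transforms as a tangent vector,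
  hence the transformation law of the Christoffel maps and, through it, the symmetry of second
  derivatives of the transition maps. A second obstacle is that minimizing geodesics need not exist,
  as the metric may be incomplete: distances are compared through curves of length slightly above
  the infimum, and a bound on the length must keep such a curve inside the chart. The constants m
  and M comparing metric and Euclidean norm on a closed coordinate ball serve this purpose and also
  show that d induces the topology. The size of these balls depends on the point, so the local
  estimates are glued by \<open>Bolzano\<close>: a property of intervals that survives joining
  adjacent intervals and holds for all short intervals around each point holds globally. Finally,
  \<open>is_flow\<close> only says that orbits are integral curves; the composition rule of the flow
  rests on their uniqueness, itself a by-product of the local expansion estimate.\<close>

section \<open>Calculus in Euclidean spaces\<close>

text \<open>Two mean value theorems: one in \<sigma> for the increment of f in direction b, one in
  \<tau> for \<open>\<lambda>y. f' y a\<close> in direction b. Every point involved lies in the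
  parallelogram of \<open>box\<close>.\<close>

lemma second_difference_mvt:
  fixes f :: "'a::real_normed_vector \<Rightarrow> real"
  assumes s: "s > 0"
    and box: "\<And>\<sigma> \<tau>. \<sigma> \<in> {0..s} \<Longrightarrow> \<tau> \<in> {0..s} \<Longrightarrow> x + \<sigma> *\<^sub>R a + \<tau> *\<^sub>R b \<in> S"
    and f: "\<And>y. y \<in> S \<Longrightarrow> (f has_derivative f' y) (at y)"
    and fa: "\<And>y. y \<in> S \<Longrightarrow> ((\<lambda>y. f' y a) has_derivative f'' y) (at y)"
  obtains \<sigma> \<tau> where "\<sigma> \<in> {0..s}" "\<tau> \<in> {0..s}"
    "f (x + s *\<^sub>R a + s *\<^sub>R b) - f (x + s *\<^sub>R a) - f (x + s *\<^sub>R b) + f x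
      = s * s * f'' (x + \<sigma> *\<^sub>R a + \<tau> *\<^sub>R b) b"
proof -
  define \<phi> where "\<phi> \<sigma> = f (x + \<sigma> *\<^sub>R a + s *\<^sub>R b) - f (x + \<sigma> *\<^sub>R a)" for \<sigma>
  have lin: "linear (f' y)" if "y \<in> S" for y
    using f[OF that] has_derivative_linear by blast
  have lin2: "linear (f'' y)" if "y \<in> S" for y
    using fa[OF that] has_derivative_linear by blast
  have D1: "(\<phi> has_derivative (\<lambda>r. r * (f' (x + \<sigma> *\<^sub>R a + s *\<^sub>R b) a - f' (x + \<sigma> *\<^sub>R a) a)))
      (at \<sigma> within {0..s})" if \<sigma>: "0 \<le> \<sigma>" "\<sigma> \<le> s" for \<sigma>
  proof -
    have m: "x + \<sigma> *\<^sub>R a + s *\<^sub>R b \<in> S" "x + \<sigma> *\<^sub>R a \<in> S"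
      using box[of \<sigma> s] box[of \<sigma> 0] \<sigma> s by auto
    have "((\<lambda>\<sigma>. f (x + \<sigma> *\<^sub>R a + s *\<^sub>R b)) has_derivative
        (\<lambda>r. f' (x + \<sigma> *\<^sub>R a + s *\<^sub>R b) (r *\<^sub>R a))) (at \<sigma> within {0..s})"
      by (rule has_derivative_compose[where f = "\<lambda>\<sigma>. x + \<sigma> *\<^sub>R a + s *\<^sub>R b" and g = f, OF _ f[OF m(1)]]) (auto intro!: derivative_eq_intros)
    moreover have "((\<lambda>\<sigma>. f (x + \<sigma> *\<^sub>R a)) has_derivative
        (\<lambda>r. f' (x + \<sigma> *\<^sub>R a) (r *\<^sub>R a))) (at \<sigma> within {0..s})"
      by (rule has_derivative_compose[where f = "\<lambda>\<sigma>. x + \<sigma> *\<^sub>R a" and g = f, OF _ f[OF m(2)]]) (auto intro!: derivative_eq_intros)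
    ultimately have "(\<phi> has_derivative (\<lambda>r. f' (x + \<sigma> *\<^sub>R a + s *\<^sub>R b) (r *\<^sub>R a)
        - f' (x + \<sigma> *\<^sub>R a) (r *\<^sub>R a))) (at \<sigma> within {0..s})"
      unfolding \<phi>_def by (rule has_derivative_diff)
    then show ?thesis
      using linear_scale[OF lin[OF m(1)]] linear_scale[OF lin[OF m(2)]]
      by (simp add: right_diff_distrib)
  qed
  obtain \<sigma> where \<sigma>: "\<sigma> \<in> {0<..<s}"
    "\<phi> s - \<phi> 0 = (s - 0) * (f' (x + \<sigma> *\<^sub>R a + s *\<^sub>R b) a - f' (x + \<sigma> *\<^sub>R a) a)"
    using mvt_simple[OF s D1] by auto
  have D2: "((\<lambda>\<tau>. f' (x + \<sigma> *\<^sub>R a + \<tau> *\<^sub>R b) a) has_derivative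
      (\<lambda>r. r * f'' (x + \<sigma> *\<^sub>R a + \<tau> *\<^sub>R b) b)) (at \<tau> within {0..s})"
    if \<tau>: "0 \<le> \<tau>" "\<tau> \<le> s" for \<tau>
  proof -
    have m: "x + \<sigma> *\<^sub>R a + \<tau> *\<^sub>R b \<in> S" using box[of \<sigma> \<tau>] \<sigma> \<tau> by auto
    have "((\<lambda>\<tau>. f' (x + \<sigma> *\<^sub>R a + \<tau> *\<^sub>R b) a) has_derivative
        (\<lambda>r. f'' (x + \<sigma> *\<^sub>R a + \<tau> *\<^sub>R b) (r *\<^sub>R b))) (at \<tau> within {0..s})"
      by (rule has_derivative_compose[where f = "\<lambda>\<tau>. x + \<sigma> *\<^sub>R a + \<tau> *\<^sub>R b" and g = "\<lambda>y. f' y a", OF _ fa[OF m]]) (auto intro!: derivative_eq_intros)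
    then show ?thesis using linear_scale[OF lin2[OF m]] by simp
  qed
  obtain \<tau> where \<tau>: "\<tau> \<in> {0<..<s}"
    "f' (x + \<sigma> *\<^sub>R a + s *\<^sub>R b) a - f' (x + \<sigma> *\<^sub>R a + 0 *\<^sub>R b) a
      = (s - 0) * f'' (x + \<sigma> *\<^sub>R a + \<tau> *\<^sub>R b) b"
    using mvt_simple[OF s D2] by auto
  show ?thesis
    by (rule that[of \<sigma> \<tau>]) (use \<sigma> \<tau> in \<open>auto simp: \<phi>_def algebra_simps\<close>)
qed

text \<open>The second difference does not change when a and b are exchanged. By the mean value
  form, the two mixed derivatives therefore agree at two points arbitrarily close to x, and
  continuity carries the equality to x.\<close>

lemma symmetric_second_derivative_real:
  fixes f :: "'a::real_normed_vector \<Rightarrow> real"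
  assumes S: "open S" "x \<in> S"
    and f: "\<And>y. y \<in> S \<Longrightarrow> (f has_derivative f' y) (at y)"
    and fa: "\<And>y. y \<in> S \<Longrightarrow> ((\<lambda>y. f' y a) has_derivative fa y) (at y)"
    and fb: "\<And>y. y \<in> S \<Longrightarrow> ((\<lambda>y. f' y b) has_derivative fb y) (at y)"
    and cont: "continuous_on S (\<lambda>y. fa y b)" "continuous_on S (\<lambda>y. fb y a)"
  shows "fa x b = fb x a"
proof (rule ccontr)
  assume neq: "fa x b \<noteq> fb x a"
  \<comment> \<open>Half the gap: two values within e of \<open>fa x b\<close> and of
    \<open>fb x a\<close> cannot coincide.\<close>
  define e where "e = \<bar>fa x b - fb x a\<bar> / 2"
  have e: "e > 0" using neq by (simp add: e_def)
  have "((\<lambda>y. fa y b) \<longlongrightarrow> fa x b) (nhds x)" "((\<lambda>y. fb y a) \<longlongrightarrow> fb x a) (nhds x)"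
    using cont S(2) unfolding continuous_on_eq_continuous_at[OF S(1)] isCont_def
      tendsto_at_iff_tendsto_nhds[of "\<lambda>y. fa y b"] tendsto_at_iff_tendsto_nhds[of "\<lambda>y. fb y a"]
    by blast+
  then have "\<forall>\<^sub>F y in nhds x. dist (fa y b) (fa x b) < e \<and> dist (fb y a) (fb x a) < e \<and> y \<in> S"
    using e S by (intro eventually_conj eventually_nhds_in_open tendstoD)
  then obtain d where d: "d > 0"
    "\<And>y. dist y x < d \<Longrightarrow> dist (fa y b) (fa x b) < e \<and> dist (fb y a) (fb x a) < e \<and> y \<in> S"
    unfolding eventually_nhds_metric by blast
  \<comment> \<open>The summand 1 keeps K positive when a = b = 0; the factor 2 in s puts the whole
    parallelogram strictly within d of x.\<close>
  define K where "K = norm a + norm b + 1"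
  define s where "s = d / (2 * K)"
  have K: "K > 0" by (simp add: K_def add_nonneg_pos)
  then have s: "s > 0" using d(1) by (simp add: s_def)
  have near: "dist (x + \<sigma> *\<^sub>R a + \<tau> *\<^sub>R b) x < d" if "\<sigma> \<in> {0..s}" "\<tau> \<in> {0..s}" for \<sigma> \<tau>
  proof -
    have "dist (x + \<sigma> *\<^sub>R a + \<tau> *\<^sub>R b) x \<le> norm (\<sigma> *\<^sub>R a) + norm (\<tau> *\<^sub>R b)"
      by (simp add: dist_norm) (metis norm_scaleR norm_triangle_ineq)
    also have "\<dots> \<le> s * norm a + s * norm b"
      using that by (auto intro!: add_mono mult_right_mono)
    also have "\<dots> = s * (K - 1)" by (simp add: K_def distrib_left)
    also have "\<dots> < s * (2 * K)" using s K by (intro mult_strict_left_mono) auto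
    also have "\<dots> = d" using K by (simp add: s_def)
    finally show ?thesis .
  qed
  obtain \<sigma> \<tau> where 1: "\<sigma> \<in> {0..s}" "\<tau> \<in> {0..s}"
    "f (x + s *\<^sub>R a + s *\<^sub>R b) - f (x + s *\<^sub>R a) - f (x + s *\<^sub>R b) + f x
      = s * s * fa (x + \<sigma> *\<^sub>R a + \<tau> *\<^sub>R b) b"
    using second_difference_mvt[OF s _ f fa, of x b] near d(2) by blast
  obtain \<tau>' \<sigma>' where 2: "\<tau>' \<in> {0..s}" "\<sigma>' \<in> {0..s}"
    "f (x + s *\<^sub>R b + s *\<^sub>R a) - f (x + s *\<^sub>R b) - f (x + s *\<^sub>R a) + f x
      = s * s * fb (x + \<tau>' *\<^sub>R b + \<sigma>' *\<^sub>R a) a"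
  proof (rule second_difference_mvt[of s x b a S f f' fb, OF s _ f fb])
    fix \<sigma> \<tau> assume "\<sigma> \<in> {0..s}" "\<tau> \<in> {0..s}"
    then show "x + \<sigma> *\<^sub>R b + \<tau> *\<^sub>R a \<in> S"
      using d(2) near[of \<tau> \<sigma>] by (simp add: add.commute add.left_commute)
  qed auto
  have "s * s * fa (x + \<sigma> *\<^sub>R a + \<tau> *\<^sub>R b) b = s * s * fb (x + \<sigma>' *\<^sub>R a + \<tau>' *\<^sub>R b) a"
    using 1(3) 2(3) by (simp add: algebra_simps)
  then have "fa (x + \<sigma> *\<^sub>R a + \<tau> *\<^sub>R b) b = fb (x + \<sigma>' *\<^sub>R a + \<tau>' *\<^sub>R b) a" using s by simp
  moreover have "dist (fa (x + \<sigma> *\<^sub>R a + \<tau> *\<^sub>R b) b) (fa x b) < e"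
    "dist (fb (x + \<sigma>' *\<^sub>R a + \<tau>' *\<^sub>R b) a) (fb x a) < e"
    using d(2) near 1 2 by blast+
  ultimately show False unfolding e_def dist_real_def by argo
qed

lemma smooth_on_continuous: "smooth_on S f \<Longrightarrow> continuous_on S f"
  unfolding smooth_on_def by (metis Ck_on.simps(1))

lemma smooth_on_has_derivative:
  "smooth_on S f \<Longrightarrow> x \<in> S \<Longrightarrow> (f has_derivative frechet_derivative f (at x)) (at x)"
  using smooth_on_differentiable frechet_derivative_works by blast

lemma smooth_on_derivative: "smooth_on S f \<Longrightarrow> smooth_on S (\<lambda>x. frechet_derivative f (at x) v)"
  unfolding smooth_on_def by (metis Ck_on.simps(2))

lemma linear_frechet_derivative_smooth_on:
  "smooth_on S f \<Longrightarrow> x \<in> S \<Longrightarrow> linear (frechet_derivative f (at x))"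
  using smooth_on_differentiable linear_frechet_derivative by blast

lemma linear_euclidean_expand:
  fixes f :: "'a::euclidean_space \<Rightarrow> 'b::real_vector"
  assumes "linear f"
  shows "f v = (\<Sum>i\<in>Basis. (v \<bullet> i) *\<^sub>R f i)"
  by (subst euclidean_representation[symmetric])
     (simp add: linear_sum[OF assms] linear_scale[OF assms] del: euclidean_representation)

text \<open>\<open>smooth_on\<close> controls derivatives in a fixed direction only. Expanding the
  moving direction over \<open>Basis\<close> gives joint continuity in base point and
  direction.\<close>

lemma continuous_on_smooth_derivative:
  fixes f :: "'a::euclidean_space \<Rightarrow> 'b::real_normed_vector"
  assumes f: "smooth_on S f" and z: "continuous_on X z" "z ` X \<subseteq> S" and v: "continuous_on X v"
  shows "continuous_on X (\<lambda>y. frechet_derivative f (at (z y)) (v y))"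
proof -
  have "continuous_on X (\<lambda>y. \<Sum>i\<in>Basis. (v y \<bullet> i) *\<^sub>R frechet_derivative f (at (z y)) i)"
    by (intro continuous_intros v
      continuous_on_compose2[OF smooth_on_continuous[OF smooth_on_derivative[OF f]] z])
  then show ?thesis
    by (rule continuous_on_eq)
       (use z in \<open>auto intro!: linear_euclidean_expand[symmetric] linear_frechet_derivative_smooth_on[OF f]\<close>)
qed

lemma smooth_on_second_derivative_symmetric:
  fixes f :: "'a::real_normed_vector \<Rightarrow> 'b::euclidean_space"
  assumes S: "open S" "x \<in> S" and f: "smooth_on S f"
  shows "frechet_derivative (\<lambda>y. frechet_derivative f (at y) a) (at x) b =
    frechet_derivative (\<lambda>y. frechet_derivative f (at y) b) (at x) a"
proof (rule euclidean_eqI)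
  fix i :: 'b
  let ?D = "\<lambda>a b y. frechet_derivative (\<lambda>y. frechet_derivative f (at y) a) (at y) b"
  have c: "continuous_on S (\<lambda>y. ?D a b y \<bullet> i)" for a b
    by (intro continuous_intros smooth_on_continuous smooth_on_derivative f)
  show "?D a b x \<bullet> i = ?D b a x \<bullet> i"
    by (rule symmetric_second_derivative_real[OF S, where f = "\<lambda>y. f y \<bullet> i"
          and f' = "\<lambda>y a. frechet_derivative f (at y) a \<bullet> i"])
       (intro c has_derivative_inner_left smooth_on_has_derivative[OF f]
         smooth_on_has_derivative[OF smooth_on_derivative[OF f]] | assumption)+
qed

section \<open>The metric and the connection in charts\<close>

lemma charts_at_iff: "c \<in> charts_at A p \<longleftrightarrow> c \<in> A \<and> p \<in> chart_dom c"
  by (simp add: charts_at_def)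

lemma tangent_space_change:
  "v \<in> tangent_space A p \<Longrightarrow> c \<in> charts_at A p \<Longrightarrow> c' \<in> charts_at A p \<Longrightarrow>
    v c' = frechet_derivative (transition c c') (at (chart_map c p)) (v c)"
  unfolding tangent_space_def by blast

lemma tangent_space_zero: "v \<in> tangent_space A p \<Longrightarrow> c \<notin> charts_at A p \<Longrightarrow> v c = 0"
  unfolding tangent_space_def by blast

locale riemannian =
  fixes A :: "('m::t2_space, 'e::euclidean_space) chart set"
    and g :: "'m \<Rightarrow> ('m, 'e) tvec \<Rightarrow> ('m, 'e) tvec \<Rightarrow> real"
  assumes atlas: "smooth_atlas A"
    and metric: "riemannian_metric A g"
begin

abbreviation G :: "('m, 'e) chart \<Rightarrow> 'e \<Rightarrow> 'e \<Rightarrow> 'e \<Rightarrow> real"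
  where "G \<equiv> metric_in_chart A g"

definition DG :: "('m, 'e) chart \<Rightarrow> 'e \<Rightarrow> 'e \<Rightarrow> 'e \<Rightarrow> 'e \<Rightarrow> real"
  where "DG c x w a b = frechet_derivative (\<lambda>y. G c y a b) (at x) w"

lemmas chart_open = chart_simps(1,2)[OF atlas]
lemmas chart_inv_map = chart_simps(4)[OF atlas]
lemmas chart_map_inv = chart_simps(5)[OF atlas]
lemmas chart_inv_dom = chart_simps(6)[OF atlas]
lemmas chart_map_img = chart_simps(7)[OF atlas]
lemmas G_sym = metric_in_chart_inner(2)[OF atlas metric]
lemmas G_pos = metric_in_chart_inner(3)[OF atlas metric]

lemma continuous_chart_inv: "c \<in> A \<Longrightarrow> continuous_on (chart_img c) (chart_inv c)"
  using chart_simps(3)[OF atlas] by (auto simp: homeomorphism_def)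

lemma G_linear:
  assumes "c \<in> A" "x \<in> chart_img c"
  shows "linear (G c x a)" "linear (\<lambda>a. G c x a b)"
  using metric_in_chart_inner(1)[OF atlas metric assms] by (simp_all add: bilinear_def)

lemma G_nonneg: "c \<in> A \<Longrightarrow> x \<in> chart_img c \<Longrightarrow> G c x a a \<ge> 0"
  using G_pos[of c x a] linear_0[OF G_linear(1), of c x a] by (cases "a = 0") auto

lemma G_smooth: "c \<in> A \<Longrightarrow> smooth_on (chart_img c) (\<lambda>x. G c x a b)"
  using metric by (auto simp: riemannian_metric_def)

text \<open>\<open>riemannian_metric\<close> grants smoothness in the base point for fixed arguments
  a and b. This finite expansion, with \<open>DG_expand\<close>, transfers continuity and
  differentiability to moving arguments.\<close>

lemma G_expand:
  assumes "c \<in> A" "x \<in> chart_img c"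
  shows "G c x a b = (\<Sum>i\<in>Basis. \<Sum>j\<in>Basis. (a \<bullet> i) * (b \<bullet> j) * G c x i j)"
proof -
  have "G c x a b = (\<Sum>i\<in>Basis. (a \<bullet> i) * G c x i b)"
    using linear_euclidean_expand[OF G_linear(2)[OF assms], of a b] by simp
  also have "\<dots> = (\<Sum>i\<in>Basis. (a \<bullet> i) * (\<Sum>j\<in>Basis. (b \<bullet> j) * G c x i j))"
    by (intro sum.cong refl arg_cong2[where f = "(*)"])
       (use linear_euclidean_expand[OF G_linear(1)[OF assms], of _ b] in simp)
  finally show ?thesis by (simp add: sum_distrib_left mult.assoc)
qed

lemma G_has_derivative:
  "c \<in> A \<Longrightarrow> x \<in> chart_img c \<Longrightarrow> ((\<lambda>y. G c y a b) has_derivative (\<lambda>w. DG c x w a b)) (at x)"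
  using smooth_on_has_derivative[OF G_smooth] unfolding DG_def by blast

lemma DG_linear: "c \<in> A \<Longrightarrow> x \<in> chart_img c \<Longrightarrow> linear (\<lambda>w. DG c x w a b)"
  using G_has_derivative has_derivative_linear by blast

lemma DG_expand:
  assumes c: "c \<in> A" "x \<in> chart_img c"
  shows "DG c x w a b = (\<Sum>i\<in>Basis. \<Sum>j\<in>Basis. (a \<bullet> i) * (b \<bullet> j) * DG c x w i j)"
proof -
  have "((\<lambda>y. G c y a b) has_derivative
      (\<lambda>w. \<Sum>i\<in>Basis. \<Sum>j\<in>Basis. (a \<bullet> i) * (b \<bullet> j) * DG c x w i j)) (at x)"
    by (rule has_derivative_transform_within_open[OF _ chart_open(2)[OF c(1)] c(2)],
        rule has_derivative_sum, rule has_derivative_sum, rule has_derivative_mult_right,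
        rule G_has_derivative[OF c]) (simp add: G_expand[OF c(1), symmetric])
  then show ?thesis unfolding DG_def by (rule fun_cong[OF frechet_derivative_at, symmetric])
qed

lemma continuous_on_G:
  assumes c: "c \<in> A" and z: "continuous_on X z" "z ` X \<subseteq> chart_img c"
    and ab: "continuous_on X a" "continuous_on X b"
  shows "continuous_on X (\<lambda>y. G c (z y) (a y) (b y))"
proof -
  have "continuous_on X (\<lambda>y. \<Sum>i\<in>Basis. \<Sum>j\<in>Basis. (a y \<bullet> i) * (b y \<bullet> j) * G c (z y) i j)"
    by (intro continuous_intros ab continuous_on_compose2[OF smooth_on_continuous[OF G_smooth[OF c]] z])
  then show ?thesis
    by (rule continuous_on_eq) (use z(2) in \<open>auto intro!: G_expand[symmetric] c\<close>)
qed

lemma continuous_on_DG: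
  assumes c: "c \<in> A" and z: "continuous_on X z" "z ` X \<subseteq> chart_img c"
    and w: "continuous_on X w" and ab: "continuous_on X a" "continuous_on X b"
  shows "continuous_on X (\<lambda>y. DG c (z y) (w y) (a y) (b y))"
proof -
  have "continuous_on X (\<lambda>y. \<Sum>i\<in>Basis. \<Sum>j\<in>Basis. (a y \<bullet> i) * (b y \<bullet> j) * DG c (z y) (w y) i j)"
    unfolding DG_def
    by (intro continuous_intros ab continuous_on_smooth_derivative[OF G_smooth[OF c] z w])
  then show ?thesis
    by (rule continuous_on_eq) (use z(2) in \<open>auto intro!: DG_expand[symmetric] c\<close>)
qed

text \<open>Product rule with all three arguments moving, obtained by differentiating the expansion
  over \<open>Basis\<close> term by term. It serves both the change of charts and the growth of
  lengths under an Euler step.\<close>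

lemma G_has_derivative_compose:
  assumes c: "c \<in> A" "z x \<in> chart_img c" and x: "x \<in> X"
    and z: "(z has_derivative z') (at x within X)"
    and a: "(a has_derivative a') (at x within X)"
    and b: "(b has_derivative b') (at x within X)"
  shows "((\<lambda>y. G c (z y) (a y) (b y)) has_derivative
    (\<lambda>w. DG c (z x) (z' w) (a x) (b x) + G c (z x) (a' w) (b x) + G c (z x) (a x) (b' w))) (at x within X)"
proof -
  have comp: "((\<lambda>y. G c (z y) i j) has_derivative (\<lambda>w. DG c (z x) (z' w) i j)) (at x within X)" for i j
    by (rule has_derivative_compose[where f = z and g = "\<lambda>y. G c y i j", OF z G_has_derivative[OF c]])
  have "((\<lambda>y. \<Sum>i\<in>Basis. \<Sum>j\<in>Basis. (a y \<bullet> i) * (b y \<bullet> j) * G c (z y) i j) has_derivative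
    (\<lambda>w. \<Sum>i\<in>Basis. \<Sum>j\<in>Basis. (a x \<bullet> i) * (b x \<bullet> j) * DG c (z x) (z' w) i j
      + ((a x \<bullet> i) * (b' w \<bullet> j) + (a' w \<bullet> i) * (b x \<bullet> j)) * G c (z x) i j)) (at x within X)"
    by (intro has_derivative_sum has_derivative_mult comp has_derivative_inner_left a b)
  moreover have "(\<Sum>i\<in>Basis. \<Sum>j\<in>Basis. (a x \<bullet> i) * (b x \<bullet> j) * DG c (z x) (z' w) i j
      + ((a x \<bullet> i) * (b' w \<bullet> j) + (a' w \<bullet> i) * (b x \<bullet> j)) * G c (z x) i j)
    = DG c (z x) (z' w) (a x) (b x) + G c (z x) (a' w) (b x) + G c (z x) (a x) (b' w)" for w
    unfolding DG_expand[OF c, of _ "a x" "b x"] G_expand[OF c, of "a' w"] G_expand[OF c, of "a x" "b' w"]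
    by (simp add: distrib_right sum.distrib)
  ultimately have D: "((\<lambda>y. \<Sum>i\<in>Basis. \<Sum>j\<in>Basis. (a y \<bullet> i) * (b y \<bullet> j) * G c (z y) i j) has_derivative
    (\<lambda>w. DG c (z x) (z' w) (a x) (b x) + G c (z x) (a' w) (b x) + G c (z x) (a x) (b' w))) (at x within X)"
    by simp
  \<comment> \<open>The expansion is known only inside the chart image, so the two functions agree
    merely near x.\<close>
  have "(z \<longlongrightarrow> z x) (at x within X)"
    using has_derivative_continuous[OF z] by (simp add: continuous_within)
  then have "\<forall>\<^sub>F y in at x within X. z y \<in> chart_img c"
    using c chart_open(2)[OF c(1)] by (rule_tac topological_tendstoD)
  then have "\<forall>\<^sub>F y in at x within X.
      (\<Sum>i\<in>Basis. \<Sum>j\<in>Basis. (a y \<bullet> i) * (b y \<bullet> j) * G c (z y) i j) = G c (z y) (a y) (b y)"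
    by eventually_elim (simp add: G_expand[OF c(1), symmetric])
  then show ?thesis
    by (rule has_derivative_transform_eventually[OF D])
       (use x c in \<open>simp_all add: G_expand[symmetric]\<close>)
qed

section \<open>Tangent vectors, metric and connection under a change of chart\<close>

lemma tangent_of_component:
  assumes "v \<in> tangent_space A p" "c \<in> charts_at A p"
  shows "tangent_of A c p (v c) = v"
proof
  fix c' show "tangent_of A c p (v c) c' = v c'"
    using tangent_space_change[OF assms, of c'] tangent_space_zero[OF assms(1), of c']
    by (simp add: tangent_of_def)
qed

lemma tangent_of_self: "c \<in> charts_at A p \<Longrightarrow> tangent_of A c p a c = a"
  by (simp add: tangent_of_def transition_self[OF atlas])

lemma metric_component:
  assumes "u \<in> tangent_space A p" "v \<in> tangent_space A p" "c \<in> charts_at A p"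
  shows "g p u v = G c (chart_map c p) (u c) (v c)"
  using assms by (simp add: metric_in_chart_def charts_at_iff chart_inv_map tangent_of_component)

lemma tangent_of_change:
  assumes "c \<in> charts_at A p" "c' \<in> charts_at A p"
  shows "tangent_of A c p a =
    tangent_of A c' p (frechet_derivative (transition c c') (at (chart_map c p)) a)"
  unfolding tangent_of_def using transition_cocycle[OF atlas assms] by (auto simp: fun_eq_iff)

lemma transition_smooth:
  "c \<in> A \<Longrightarrow> c' \<in> A \<Longrightarrow>
    smooth_on (chart_map c ` (chart_dom c \<inter> chart_dom c')) (transition c c')"
  using atlas by (auto simp: smooth_atlas_def)

lemma transition_map: "c \<in> charts_at A p \<Longrightarrow> transition c c' (chart_map c p) = chart_map c' p"
  by (simp add: transition_def charts_at_iff chart_inv_map)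

lemma G_change:
  assumes c: "c \<in> charts_at A p" "c' \<in> charts_at A p"
  defines "B \<equiv> frechet_derivative (transition c c') (at (chart_map c p))"
  shows "G c (chart_map c p) a b = G c' (chart_map c' p) (B a) (B b)"
  using c by (simp add: metric_in_chart_def charts_at_iff chart_inv_map B_def tangent_of_change[OF c])

lemma transition_derivative_inverse:
  assumes c: "c \<in> charts_at A p" "c' \<in> charts_at A p"
  shows "frechet_derivative (transition c' c) (at (chart_map c' p))
    (frechet_derivative (transition c c') (at (chart_map c p)) a) = a"
  using transition_cocycle[OF atlas c(1) c(2) c(1)] transition_self[OF atlas c(1)] by metis

lemma is_christoffel_christoffel:
  assumes "c \<in> A" "x \<in> chart_img c"
  shows "is_christoffel A g c x (christoffel A g c x)"
  using theI'[OF christoffel_ex1[OF atlas metric assms]] by (simp add: christoffel_def)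

text \<open>The law is solved for the map in chart \<open>c\<close>, the solution \<open>H\<close>
  is shown to satisfy \<open>is_christoffel\<close>, and the uniqueness in
  \<open>christoffel_ex1\<close> identifies it. The second derivative of the transition map is the
  classical inhomogeneous term.\<close>

lemma christoffel_change:
  assumes c: "c \<in> charts_at A p" "c' \<in> charts_at A p"
  defines "B \<equiv> \<lambda>y. frechet_derivative (transition c c') (at y)" and "x \<equiv> chart_map c p"
  shows "B x (christoffel A g c x a b) =
    christoffel A g c' (chart_map c' p) (B x a) (B x b) + frechet_derivative (\<lambda>y. B y a) (at x) b"
proof -
  define S where "S = chart_map c ` (chart_dom c \<inter> chart_dom c')"
  define x' where "x' = chart_map c' p"
  have cA: "c \<in> A" "c' \<in> A" and p: "p \<in> chart_dom c" "p \<in> chart_dom c'"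
    using c by (auto simp: charts_at_iff)
  have S: "open S" "x \<in> S" using open_overlap[OF atlas cA] p by (auto simp: S_def x_def)
  have xi: "x \<in> chart_img c" "x' \<in> chart_img c'" using chart_map_img cA p by (auto simp: x_def x'_def)
  have Tx: "transition c c' x = x'" using transition_map c by (auto simp: x_def x'_def)
  have T: "smooth_on S (transition c c')" using transition_smooth[OF cA] by (simp add: S_def)
  define B2 where "B2 a b = frechet_derivative (\<lambda>y. B y a) (at x) b" for a b
  have B2sym: "B2 a b = B2 b a" for a b
    unfolding B2_def B_def by (rule smooth_on_second_derivative_symmetric[OF S T])
  have TD: "(transition c c' has_derivative B x) (at x)"
    unfolding B_def by (rule smooth_on_has_derivative[OF T S(2)])
  have BD: "((\<lambda>y. B y a) has_derivative B2 a) (at x)" for a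
    unfolding B_def B2_def by (rule smooth_on_has_derivative[OF smooth_on_derivative[OF T] S(2)])
  define B' where "B' = frechet_derivative (transition c' c) (at x')"
  have BB': "B x (B' a) = a" "B' (B x a) = a" for a
    using transition_derivative_inverse[OF c] transition_derivative_inverse[OF c(2,1)]
    by (simp_all add: B'_def B_def x_def x'_def)
  have linB: "linear (B x)" using TD has_derivative_linear by blast
  have linB': "linear B'"
    unfolding B'_def x'_def by (rule linear_frechet_derivative[OF transition_differentiable[OF atlas c(2,1)]])
  have linB2: "linear (B2 a)" for a using BD has_derivative_linear by blast
  define H where "H a b = B' (christoffel A g c' x' (B x a) (B x b) + B2 a b)" for a b
  have Gch: "G c y a b = G c' (transition c c' y) (B y a) (B y b)" if "y \<in> S" for y a b
  proof -
    from that obtain q where q: "y = chart_map c q" "q \<in> chart_dom c" "q \<in> chart_dom c'"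
      by (auto simp: S_def)
    then have cq: "c \<in> charts_at A q" "c' \<in> charts_at A q" using cA by (auto simp: charts_at_iff)
    show ?thesis using G_change[OF cq, of a b] transition_map[OF cq(1), of c'] by (simp add: B_def q)
  qed
  \<comment> \<open>Differentiating the change-of-chart formula for \<open>G\<close>: the terms with
    \<open>B2\<close> arise because the vectors \<open>B y a\<close> and \<open>B y b\<close> move
    with y.\<close>
  have DGch: "DG c x w a b = DG c' x' (B x w) (B x a) (B x b) + G c' x' (B2 a w) (B x b)
      + G c' x' (B x a) (B2 b w)" for w a b
  proof -
    have "((\<lambda>y. G c' (transition c c' y) (B y a) (B y b)) has_derivative
        (\<lambda>w. DG c' x' (B x w) (B x a) (B x b) + G c' x' (B2 a w) (B x b)
      + G c' x' (B x a) (B2 b w))) (at x)"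
      using G_has_derivative_compose[OF cA(2) _ _ TD BD BD, of a b] xi(2) by (simp add: Tx)
    then have "((\<lambda>y. G c y a b) has_derivative
        (\<lambda>w. DG c' x' (B x w) (B x a) (B x b) + G c' x' (B2 a w) (B x b)
      + G c' x' (B x a) (B2 b w))) (at x)"
      by (rule has_derivative_transform_within_open[OF _ S]) (simp add: Gch)
    then show ?thesis unfolding DG_def by (rule fun_cong[OF frechet_derivative_at, symmetric])
  qed
  note chr = is_christoffel_christoffel[OF cA(2) xi(2), unfolded is_christoffel_def]
  have bil: "linear (christoffel A g c' x' a)" for a using chr by (simp add: bilinear_def)
  have csym: "christoffel A g c' x' a b = christoffel A g c' x' b a" for a b using chr by blast
  have cD: "DG c' x' w a b = G c' x' (christoffel A g c' x' w a) b + G c' x' a (christoffel A g c' x' w b)"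
    for w a b using chr unfolding DG_def by blast
  have Hsym: "H a b = H b a" for a b unfolding H_def using B2sym csym by metis
  have linH: "linear (H a)" for a
    unfolding H_def
    by (rule linear_compose[OF _ linB', unfolded o_def])
       (intro linear_compose_add linear_compose[OF linB bil, unfolded o_def] linB2)
  have "is_christoffel A g c x H"
    unfolding is_christoffel_def
  proof (intro conjI allI)
    have "(\<lambda>a. H a b) = H b" for b by (intro ext Hsym)
    then show "bilinear H" using linH by (simp add: bilinear_def)
    show "H a b = H b a" for a b by (rule Hsym)
    fix w a b
    have "G c x (H w a) b + G c x a (H w b) =
       G c' x' (christoffel A g c' x' (B x w) (B x a) + B2 w a) (B x b)
       + G c' x' (B x a) (christoffel A g c' x' (B x w) (B x b) + B2 w b)"
      by (simp add: Gch[OF S(2)] Tx H_def BB')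
    also have "\<dots> = DG c x w a b"
      unfolding DGch cD using B2sym[of w]
      by (simp add: linear_add[OF G_linear(1)[OF cA(2) xi(2)]] linear_add[OF G_linear(2)[OF cA(2) xi(2)]])
    finally show "frechet_derivative (\<lambda>y. G c y a b) (at x) w = G c x (H w a) b + G c x a (H w b)"
      by (simp add: DG_def)
  qed
  then have "christoffel A g c x = H"
    using christoffel_ex1[OF atlas metric cA(1) xi(1)] is_christoffel_christoffel[OF cA(1) xi(1)] by blast
  then show ?thesis by (simp add: H_def BB' B2_def x'_def)
qed

end

locale riemannian_field = riemannian A g
  for A :: "('m::t2_space, 'e::euclidean_space) chart set"
    and g :: "'m \<Rightarrow> ('m, 'e) tvec \<Rightarrow> ('m, 'e) tvec \<Rightarrow> real" +
  fixes F :: "'m \<Rightarrow> ('m, 'e) tvec"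
  assumes field: "smooth_vector_field A F"
begin

abbreviation field_in :: "('m, 'e) chart \<Rightarrow> 'e \<Rightarrow> 'e"
  where "field_in c \<equiv> field_in_chart c F"

lemma field_smooth: "c \<in> A \<Longrightarrow> smooth_on (chart_img c) (field_in c)"
  using field by (auto simp: smooth_vector_field_def)

lemma field_tangent: "F p \<in> tangent_space A p"
  using field by (auto simp: smooth_vector_field_def)

lemma field_component: "c \<in> charts_at A p \<Longrightarrow> field_in c (chart_map c p) = F p c"
  by (simp add: field_in_chart_def charts_at_iff chart_inv_map)

text \<open>Differentiating the transformed field produces a second derivative of the transition
  map, and the Christoffel map produces the same one with the opposite sign; symmetry of
  \<open>B2\<close> makes them cancel. Only with this can the norm of the covariant derivative be
  computed in an arbitrary chart.\<close>

lemma levi_civita_tangent: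
  assumes X: "X \<in> tangent_space A p"
  shows "levi_civita A g F p X \<in> tangent_space A p"
  unfolding tangent_space_def
proof (intro CollectI conjI ballI allI impI)
  fix c c' assume c: "c \<in> charts_at A p" "c' \<in> charts_at A p"
  define x where "x = chart_map c p"
  define x' where "x' = chart_map c' p"
  define B where "B y = frechet_derivative (transition c c') (at y)" for y
  define S where "S = chart_map c ` (chart_dom c \<inter> chart_dom c')"
  have cA: "c \<in> A" "c' \<in> A" and p: "p \<in> chart_dom c" "p \<in> chart_dom c'"
    using c by (auto simp: charts_at_iff)
  have S: "open S" "x \<in> S" using open_overlap[OF atlas cA] p by (auto simp: S_def x_def)
  have xi: "x \<in> chart_img c" "x' \<in> chart_img c'" using chart_map_img cA p by (auto simp: x_def x'_def)
  have Tx: "transition c c' x = x'" using transition_map c by (auto simp: x_def x'_def)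
  have T: "smooth_on S (transition c c')" using transition_smooth[OF cA] by (simp add: S_def)
  define B2 where "B2 a b = frechet_derivative (\<lambda>y. B y a) (at x) b" for a b
  have TD: "(transition c c' has_derivative B x) (at x)"
    unfolding B_def by (rule smooth_on_has_derivative[OF T S(2)])
  have BD: "((\<lambda>y. B y a) has_derivative B2 a) (at x)" for a
    unfolding B_def B2_def by (rule smooth_on_has_derivative[OF smooth_on_derivative[OF T] S(2)])
  have linB: "linear (B y)" if "y \<in> S" for y
    unfolding B_def by (rule linear_frechet_derivative_smooth_on[OF T that])
  have linB2: "linear (\<lambda>b. B2 b a)" for a
    unfolding B2_def B_def smooth_on_second_derivative_symmetric[OF S T, of _ a]
    by (rule linear_frechet_derivative_smooth_on[OF smooth_on_derivative[OF T] S(2)])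
  define f where "f = field_in c"
  define f' where "f' = field_in c'"
  define Df where "Df = frechet_derivative f (at x)"
  define Df' where "Df' = frechet_derivative f' (at x')"
  have fD: "(f has_derivative Df) (at x)" "(f' has_derivative Df') (at x')"
    unfolding Df_def Df'_def f_def f'_def
    using smooth_on_has_derivative[OF field_smooth] cA xi by blast+
  have fB: "f' (transition c c' y) = B y (f y)" if "y \<in> S" for y
  proof -
    from that obtain q where q: "y = chart_map c q" "q \<in> chart_dom c" "q \<in> chart_dom c'"
      by (auto simp: S_def)
    then have cq: "c \<in> charts_at A q" "c' \<in> charts_at A q" using cA by (auto simp: charts_at_iff)
    show ?thesis
      using tangent_space_change[OF field_tangent cq] transition_map[OF cq(1), of c']
        field_component[OF cq(1)] field_component[OF cq(2)]
      by (simp add: f_def f'_def q B_def)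
  qed
  \<comment> \<open>Both the linear map \<open>B y\<close> and its argument \<open>f y\<close>
    depend on y; the expansion turns this into a sum of ordinary products.\<close>
  have "((\<lambda>y. \<Sum>i\<in>Basis. (f y \<bullet> i) *\<^sub>R B y i) has_derivative
      (\<lambda>w. \<Sum>i\<in>Basis. (f x \<bullet> i) *\<^sub>R B2 i w + (Df w \<bullet> i) *\<^sub>R B x i)) (at x)"
    by (intro has_derivative_sum has_derivative_scaleR has_derivative_inner_left fD BD)
  then have "((\<lambda>y. f' (transition c c' y)) has_derivative
      (\<lambda>w. \<Sum>i\<in>Basis. (f x \<bullet> i) *\<^sub>R B2 i w + (Df w \<bullet> i) *\<^sub>R B x i)) (at x)"
    by (rule has_derivative_transform_within_open[OF _ S])
       (simp add: fB linear_euclidean_expand[OF linB, symmetric])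
  moreover have "((\<lambda>y. f' (transition c c' y)) has_derivative (\<lambda>w. Df' (B x w))) (at x)"
    using has_derivative_compose[where g = f', OF TD] fD(2) by (simp add: Tx)
  ultimately have "Df' (B x w) = (\<Sum>i\<in>Basis. (f x \<bullet> i) *\<^sub>R B2 i w + (Df w \<bullet> i) *\<^sub>R B x i)" for w
    by (rule fun_cong[OF has_derivative_unique, rotated])
  then have Df': "Df' (B x w) = B2 (f x) w + B x (Df w)" for w
    using linear_euclidean_expand[OF linB2[of w], of "f x"] linear_euclidean_expand[OF linB[OF S(2)], of "Df w"]
    by (simp add: sum.distrib)
  have fx: "f x = F p c" "f' x' = F p c'"
    using field_component c by (auto simp: f_def f'_def x_def x'_def)
  have Xc: "X c' = B x (X c)" and Fc: "F p c' = B x (F p c)"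
    using tangent_space_change[OF X c] tangent_space_change[OF field_tangent c] by (simp_all add: B_def x_def)
  have B2s: "B2 a b = B2 b a" for a b
    unfolding B2_def B_def by (rule smooth_on_second_derivative_symmetric[OF S T])
  have chr: "B x (christoffel A g c x a b) = christoffel A g c' x' (B x a) (B x b) + B2 a b" for a b
    using christoffel_change[OF c, of a b] by (simp add: B_def B2_def x_def x'_def)
  have "levi_civita A g F p X c' = Df' (B x (X c)) + christoffel A g c' x' (B x (X c)) (B x (F p c))"
    using c by (simp add: levi_civita_def Df'_def f'_def x'_def Xc Fc)
  also have "\<dots> = B x (Df (X c)) + B x (christoffel A g c x (X c) (F p c))"
    by (simp add: Df' chr B2s fx)
  also have "\<dots> = B x (levi_civita A g F p X c)"
    using c by (simp add: levi_civita_def Df_def f_def x_def linear_add[OF linB[OF S(2)], unfolded x_def])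
  finally show "levi_civita A g F p X c' =
      frechet_derivative (transition c c') (at (chart_map c p)) (levi_civita A g F p X c)"
    by (simp add: B_def x_def)
qed (simp add: levi_civita_def)

end

section \<open>Lengths of curves and the Riemannian distance\<close>

context riemannian
begin

definition N :: "('m, 'e) chart \<Rightarrow> 'e \<Rightarrow> 'e \<Rightarrow> real"
  where "N c x v = sqrt (G c x v v)"

lemma N_nonneg: "c \<in> A \<Longrightarrow> x \<in> chart_img c \<Longrightarrow> N c x v \<ge> 0"
  unfolding N_def using G_nonneg by simp

lemma N_scale: "c \<in> A \<Longrightarrow> x \<in> chart_img c \<Longrightarrow> N c x (r *\<^sub>R v) = \<bar>r\<bar> * N c x v"
  unfolding N_def
  by (simp add: linear_scale[OF G_linear(1)] linear_scale[OF G_linear(2)] real_sqrt_mult power2_eq_square[symmetric]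
      flip: mult.assoc)

lemma continuous_on_N:
  "c \<in> A \<Longrightarrow> continuous_on X z \<Longrightarrow> z ` X \<subseteq> chart_img c \<Longrightarrow> continuous_on X v \<Longrightarrow>
    continuous_on X (\<lambda>y. N c (z y) (v y))"
  unfolding N_def by (intro continuous_intros continuous_on_G)

text \<open>\<open>N\<close> is continuous and positive on the compact product of K with the unit
  sphere; its minimum and maximum there serve as m and M, and homogeneity extends the bounds to all
  vectors.\<close>

lemma N_equivalent:
  assumes c: "c \<in> A" and K: "compact K" "K \<subseteq> chart_img c"
  obtains m M where "m > 0" "M > 0"
    "\<And>x v. x \<in> K \<Longrightarrow> m * norm v \<le> N c x v" "\<And>x v. x \<in> K \<Longrightarrow> N c x v \<le> M * norm v"
proof (cases "K = {}")
  case True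
  then show ?thesis using that[of 1 1] by auto
next
  case False
  define S where "S = K \<times> sphere (0::'e) 1"
  have S: "compact S" "S \<noteq> {}" using K False by (auto simp: S_def intro: compact_Times)
  have cont: "continuous_on S (\<lambda>z. N c (fst z) (snd z))"
    by (rule continuous_on_N[OF c]) (use K(2) in \<open>auto intro!: continuous_intros simp: S_def\<close>)
  obtain z1 where z1: "z1 \<in> S" "\<And>z. z \<in> S \<Longrightarrow> N c (fst z1) (snd z1) \<le> N c (fst z) (snd z)"
    using continuous_attains_inf[OF S cont] by blast
  obtain z2 where z2: "z2 \<in> S" "\<And>z. z \<in> S \<Longrightarrow> N c (fst z) (snd z) \<le> N c (fst z2) (snd z2)"
    using continuous_attains_sup[OF S cont] by blast
  have pos: "N c (fst z) (snd z) > 0" if "z \<in> S" for z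
    using that K(2) G_pos[OF c, of "fst z" "snd z"] unfolding N_def S_def by fastforce
  have *: "N c x v = norm v * N c x (v /\<^sub>R norm v)" if "x \<in> K" "v \<noteq> 0" for x v
    using that K(2) N_scale[OF c, of x "norm v" "v /\<^sub>R norm v"] by auto
  have mem: "(x, v /\<^sub>R norm v) \<in> S" if "x \<in> K" "v \<noteq> 0" for x v
    using that by (auto simp: S_def)
  have N0: "N c x 0 = 0" if "x \<in> K" for x
    using that K(2) N_scale[OF c, of x 0 0] by auto
  show ?thesis
  proof (rule that[of "N c (fst z1) (snd z1)" "N c (fst z2) (snd z2)"])
    fix x v assume x: "x \<in> K"
    show "N c (fst z1) (snd z1) * norm v \<le> N c x v"
    proof (cases "v = 0")
      case False
      then show ?thesis
        using z1(2)[OF mem[OF x False]] *[OF x False] by (simp add: mult.commute mult_left_mono)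
    qed (simp add: N0 x)
    show "N c x v \<le> N c (fst z2) (snd z2) * norm v"
    proof (cases "v = 0")
      case False
      then show ?thesis
        using z2(2)[OF mem[OF x False]] *[OF x False] by (simp add: mult.commute mult_left_mono)
    qed (simp add: N0 x)
  qed (use pos z1 z2 in auto)
qed

lemma tangent_norm_component:
  "c \<in> charts_at A p \<Longrightarrow> v \<in> tangent_space A p \<Longrightarrow> tangent_norm g p v = N c (chart_map c p) (v c)"
  by (simp add: tangent_norm_def N_def metric_component)

lemma N_change:
  "c \<in> charts_at A p \<Longrightarrow> c' \<in> charts_at A p \<Longrightarrow> N c (chart_map c p) v =
    N c' (chart_map c' p) (frechet_derivative (transition c c') (at (chart_map c p)) v)"
  unfolding N_def using G_change by metis

text \<open>Chain rule for the transition map. Continuity of \<gamma> keeps nearby points in the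
  domain of \<open>c\<close>, where the transition map after \<open>chart_map c\<close> is
  \<open>chart_map c'\<close>.\<close>

lemma chart_velocity_change:
  assumes c: "c \<in> charts_at A (\<gamma> t)" "c' \<in> charts_at A (\<gamma> t)"
    and t: "t \<in> I" and cont: "continuous (at t within I) \<gamma>"
    and v: "((chart_map c \<circ> \<gamma>) has_vector_derivative v) (at t within I)"
  shows "((chart_map c' \<circ> \<gamma>) has_vector_derivative
    frechet_derivative (transition c c') (at (chart_map c (\<gamma> t))) v) (at t within I)"
proof -
  let ?D = "frechet_derivative (transition c c') (at (chart_map c (\<gamma> t)))"
  note diff = transition_differentiable[OF atlas c]
  have D: "(transition c c' has_derivative ?D) (at ((chart_map c \<circ> \<gamma>) t))"
    using diff by (simp add: frechet_derivative_works)
  have "((\<lambda>s. transition c c' ((chart_map c \<circ> \<gamma>) s)) has_derivative (\<lambda>r. ?D (r *\<^sub>R v))) (at t within I)"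
    by (rule has_derivative_compose[where f = "chart_map c \<circ> \<gamma>", OF v[unfolded has_vector_derivative_def] D])
  then have 1: "((\<lambda>s. transition c c' ((chart_map c \<circ> \<gamma>) s)) has_derivative (\<lambda>r. r *\<^sub>R ?D v)) (at t within I)"
    by (simp add: linear_scale[OF linear_frechet_derivative[OF diff]])
  have "\<forall>\<^sub>F s in at t within I. \<gamma> s \<in> chart_dom c"
    by (rule topological_tendstoD[OF cont[unfolded continuous_within] chart_open(1)])
       (use c in \<open>auto simp: charts_at_iff\<close>)
  then have "\<forall>\<^sub>F s in at t within I. transition c c' ((chart_map c \<circ> \<gamma>) s) = (chart_map c' \<circ> \<gamma>) s"
    by eventually_elim (use c in \<open>simp add: transition_def charts_at_iff chart_inv_map\<close>)
  from has_derivative_transform_eventually[OF 1 this _ t] show ?thesis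
    using c by (simp add: has_vector_derivative_def transition_def charts_at_iff chart_inv_map o_def)
qed

lemma velocity_eq_tangent_of:
  assumes c: "c \<in> charts_at A (\<gamma> t)"
    and t: "t \<in> I" "at t within I \<noteq> bot" and cont: "continuous (at t within I) \<gamma>"
    and v: "((chart_map c \<circ> \<gamma>) has_vector_derivative v) (at t within I)"
  shows "velocity A \<gamma> I t = tangent_of A c (\<gamma> t) v"
  unfolding velocity_def tangent_of_def
  using vector_derivative_within[OF t(2) chart_velocity_change[OF c _ t(1) cont v]] by (auto simp: fun_eq_iff)

text \<open>The coordinate velocity \<open>x'\<close> is a parameter, so it can be transformed
  explicitly under chart changes, reparametrizations and Euler steps; at the end points it is
  one-sided. Continuity of \<gamma> follows from that of its coordinates and of
  \<open>chart_inv c\<close>.\<close>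

definition chart_arc ::
    "('m, 'e) chart \<Rightarrow> (real \<Rightarrow> 'm) \<Rightarrow> (real \<Rightarrow> 'e) \<Rightarrow> real \<Rightarrow> real \<Rightarrow> bool"
  where "chart_arc c \<gamma> x' a b \<longleftrightarrow> c \<in> A \<and> a < b \<and> \<gamma> ` {a..b} \<subseteq> chart_dom c \<and>
    continuous_on {a..b} x' \<and>
    (\<forall>t\<in>{a..b}. ((chart_map c \<circ> \<gamma>) has_vector_derivative x' t) (at t within {a..b}))"

definition arc_length ::
    "('m, 'e) chart \<Rightarrow> (real \<Rightarrow> 'm) \<Rightarrow> (real \<Rightarrow> 'e) \<Rightarrow> real \<Rightarrow> real \<Rightarrow> real"
  where "arc_length c \<gamma> x' a b = integral {a..b} (\<lambda>t. N c (chart_map c (\<gamma> t)) (x' t))"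

text \<open>\<open>plen \<gamma> a b l\<close>: the curve \<open>\<gamma>\<close> is piecewise \<open>C\<^sup>1\<close> on \<open>{a..b}\<close> with length \<open>l\<close>. Cutting it
  into arcs inside single charts makes induction available and keeps velocities in coordinates.\<close>

inductive plen :: "(real \<Rightarrow> 'm) \<Rightarrow> real \<Rightarrow> real \<Rightarrow> real \<Rightarrow> bool" for \<gamma>
  where
    arc: "chart_arc c \<gamma> x' a b \<Longrightarrow> plen \<gamma> a b (arc_length c \<gamma> x' a b)"
  | trans: "plen \<gamma> a b l \<Longrightarrow> plen \<gamma> b b' l' \<Longrightarrow> plen \<gamma> a b' (l + l')"

section \<open>Arcs and their lengths: restriction, change of chart, reparametrization,
  reversal\<close>

lemma chart_arc_coord_continuous:
  assumes "chart_arc c \<gamma> x' a b" shows "continuous_on {a..b} (\<lambda>t. chart_map c (\<gamma> t))"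
  using assms has_vector_derivative_continuous unfolding chart_arc_def continuous_on_eq_continuous_within o_def
  by blast

lemma chart_arc_img: "chart_arc c \<gamma> x' a b \<Longrightarrow> (\<lambda>t. chart_map c (\<gamma> t)) ` {a..b} \<subseteq> chart_img c"
  unfolding chart_arc_def using chart_map_img by blast

lemma chart_arc_continuous:
  assumes "chart_arc c \<gamma> x' a b" shows "continuous_on {a..b} \<gamma>"
proof -
  have "continuous_on {a..b} (\<lambda>t. chart_inv c (chart_map c (\<gamma> t)))"
    using assms chart_arc_img[OF assms]
    by (intro continuous_on_compose2[OF continuous_chart_inv chart_arc_coord_continuous])
       (auto simp: chart_arc_def)
  then show ?thesis
    by (rule continuous_on_eq) (use assms chart_inv_map[of c] in \<open>simp add: chart_arc_def image_subset_iff\<close>)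
qed

lemma chart_arc_integrand_continuous:
  assumes "chart_arc c \<gamma> x' a b"
  shows "continuous_on {a..b} (\<lambda>t. N c (chart_map c (\<gamma> t)) (x' t))"
  using assms chart_arc_coord_continuous[OF assms] chart_arc_img[OF assms]
  by (intro continuous_on_N) (auto simp: chart_arc_def)

lemma chart_arc_subset:
  assumes "chart_arc c \<gamma> x' a b" "a \<le> u" "u < v" "v \<le> b"
  shows "chart_arc c \<gamma> x' u v"
proof -
  have sub: "{u..v} \<subseteq> {a..b}" using assms by auto
  then show ?thesis
    using assms(1,3) continuous_on_subset[OF _ sub] has_vector_derivative_within_subset[OF _ sub]
    unfolding chart_arc_def by (meson image_mono order_trans subsetD)
qed

lemma arc_length_combine:
  assumes "chart_arc c \<gamma> x' a b" "a \<le> u" "u \<le> b"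
  shows "arc_length c \<gamma> x' a b = arc_length c \<gamma> x' a u + arc_length c \<gamma> x' u b"
  unfolding arc_length_def
  by (rule Henstock_Kurzweil_Integration.integral_combine[symmetric])
     (use assms integrable_continuous_real[OF chart_arc_integrand_continuous[OF assms(1)]] in auto)

lemma arc_length_nonneg: "chart_arc c \<gamma> x' a b \<Longrightarrow> arc_length c \<gamma> x' a b \<ge> 0"
  unfolding arc_length_def
  by (intro Henstock_Kurzweil_Integration.integral_nonneg integrable_continuous_real
      chart_arc_integrand_continuous)
     (use N_nonneg chart_map_img in \<open>auto simp: chart_arc_def image_subset_iff\<close>)

lemma chart_arc_change:
  assumes arc: "chart_arc c \<gamma> x' a b" and c': "c' \<in> A" "\<gamma> ` {a..b} \<subseteq> chart_dom c'"
  defines "y' \<equiv> \<lambda>t. frechet_derivative (transition c c') (at (chart_map c (\<gamma> t))) (x' t)"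
  shows "chart_arc c' \<gamma> y' a b" and "arc_length c' \<gamma> y' a b = arc_length c \<gamma> x' a b"
proof -
  have c: "c \<in> A" "\<gamma> ` {a..b} \<subseteq> chart_dom c" using arc by (auto simp: chart_arc_def)
  have at: "c \<in> charts_at A (\<gamma> t)" "c' \<in> charts_at A (\<gamma> t)" if "t \<in> {a..b}" for t
    using that c c' by (auto simp: charts_at_iff)
  show "chart_arc c' \<gamma> y' a b"
    unfolding chart_arc_def
  proof (intro conjI ballI)
    show "continuous_on {a..b} y'" unfolding y'_def
      by (rule continuous_on_smooth_derivative[OF transition_smooth[OF c(1) c'(1)]
            chart_arc_coord_continuous[OF arc]])
         (use arc c c' in \<open>auto simp: chart_arc_def\<close>)
    show "((chart_map c' \<circ> \<gamma>) has_vector_derivative y' t) (at t within {a..b})" if "t \<in> {a..b}" for t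
      unfolding y'_def
      by (rule chart_velocity_change[where \<gamma> = \<gamma> and t = t, OF at[OF that] that])
         (use arc chart_arc_continuous[OF arc] that in \<open>auto simp: chart_arc_def continuous_on_eq_continuous_within\<close>)
  qed (use arc c' in \<open>auto simp: chart_arc_def\<close>)
  show "arc_length c' \<gamma> y' a b = arc_length c \<gamma> x' a b"
    unfolding arc_length_def y'_def
    by (rule Henstock_Kurzweil_Integration.integral_cong) (rule N_change[OF at, symmetric])
qed

lemma plen_less: "plen \<gamma> a b l \<Longrightarrow> a < b"
  by (induction rule: plen.induct) (auto simp: chart_arc_def)

lemma plen_nonneg: "plen \<gamma> a b l \<Longrightarrow> l \<ge> 0"
  by (induction rule: plen.induct) (auto intro: arc_length_nonneg)

lemma plen_continuous: "plen \<gamma> a b l \<Longrightarrow> continuous_on {a..b} \<gamma>"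
proof (induction rule: plen.induct)
  case (trans a b l b' l')
  then have "{a..b'} = {a..b} \<union> {b..b'}" using plen_less by force
  then show ?case using trans by (auto intro!: continuous_on_closed_Un)
qed (rule chart_arc_continuous)

lemma plen_split:
  assumes "plen \<gamma> a b l" "a < u" "u < b"
  shows "\<exists>l1 l2. plen \<gamma> a u l1 \<and> plen \<gamma> u b l2 \<and> l = l1 + l2"
  using assms
proof (induction rule: plen.induct)
  case (arc c x' a b)
  then show ?case
    using arc_length_combine[OF arc(1), of u] chart_arc_subset[OF arc(1), of a u]
      chart_arc_subset[OF arc(1), of u b] plen.arc by (meson less_eq_real_def order_refl)
next
  case (trans a b l b' l')
  consider "u < b" | "u = b" | "u > b" by linarith
  then show ?case
  proof cases
    case 1
    then obtain l1 l2 where "plen \<gamma> a u l1" "plen \<gamma> u b l2" "l = l1 + l2" using trans by blast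
    then show ?thesis using plen.trans[OF _ trans(2)] by (metis add.assoc)
  next
    case 2
    then show ?thesis using trans by blast
  next
    case 3
    then obtain l1 l2 where "plen \<gamma> b u l1" "plen \<gamma> u b' l2" "l' = l1 + l2" using trans by blast
    then show ?thesis using plen.trans[OF trans(1)] by (metis add.assoc)
  qed
qed

text \<open>A derivation of \<open>plen\<close> may use arcs in many charts. If the curve stays in
  the domain of \<open>c\<close>, \<open>chart_arc_change\<close> rewrites each of them in
  \<open>c\<close> with the same length, so an argument in a single chart suffices.\<close>

lemma plen_chart_induct [consumes 3, case_names arc trans]:
  assumes "plen \<gamma> a b l" "c \<in> A" "\<gamma> ` {a..b} \<subseteq> chart_dom c"
    and arc: "\<And>u v x'. a \<le> u \<Longrightarrow> v \<le> b \<Longrightarrow> chart_arc c \<gamma> x' u v \<Longrightarrow> P u v (arc_length c \<gamma> x' u v)"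
    and trans: "\<And>u v w l l'. P u v l \<Longrightarrow> P v w l' \<Longrightarrow> P u w (l + l')"
  shows "P a b l"
proof -
  have "P u v l" if "plen \<gamma> u v l" "a \<le> u" "v \<le> b" for u v l
    using that
  proof (induction rule: plen.induct)
    case (arc c0 x' u v)
    have sub: "\<gamma> ` {u..v} \<subseteq> chart_dom c" using assms(3) arc by (meson atLeastatMost_subset_iff image_mono order_trans)
    show ?case
      using assms(4)[OF arc(2,3) chart_arc_change(1)[OF arc(1) assms(2) sub]]
        chart_arc_change(2)[OF arc(1) assms(2) sub] by simp
  next
    case (trans u v l w l')
    then show ?case using assms(5) plen_less by (meson less_imp_le order_trans)
  qed
  then show ?thesis using assms(1) by blast
qed

lemma chart_arc_affine:
  fixes k :: real
  assumes arc: "chart_arc c \<gamma> x' a b" and m: "m > 0"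
  defines "\<gamma>' \<equiv> \<lambda>t. \<gamma> (m * t + k)" and "y' \<equiv> \<lambda>t. m *\<^sub>R x' (m * t + k)"
    and "a' \<equiv> (a - k) / m" and "b' \<equiv> (b - k) / m"
  shows "chart_arc c \<gamma>' y' a' b'" and "arc_length c \<gamma>' y' a' b' = arc_length c \<gamma> x' a b"
proof -
  have img: "m * t + k \<in> {a..b}" if "t \<in> {a'..b'}" for t
    using that m by (auto simp: a'_def b'_def field_simps)
  then have img': "(\<lambda>t. m * t + k) ` {a'..b'} \<subseteq> {a..b}" by auto
  have c: "c \<in> A" using arc by (auto simp: chart_arc_def)
  show "chart_arc c \<gamma>' y' a' b'"
    unfolding chart_arc_def
  proof (intro conjI ballI)
    show "a' < b'" using arc m by (auto simp: a'_def b'_def chart_arc_def divide_strict_right_mono)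
    show "\<gamma>' ` {a'..b'} \<subseteq> chart_dom c" using arc img by (auto simp: \<gamma>'_def chart_arc_def)
    show "continuous_on {a'..b'} y'" unfolding y'_def
      using arc by (intro continuous_on_scaleR continuous_on_const continuous_on_compose2[OF _ _ img', of x'])
        (auto simp: chart_arc_def intro!: continuous_intros)
    fix t assume t: "t \<in> {a'..b'}"
    have "((chart_map c \<circ> \<gamma>) has_vector_derivative x' (m * t + k))
        (at (m * t + k) within (\<lambda>t. m * t + k) ` {a'..b'})"
      using arc img[OF t] img' unfolding chart_arc_def by (blast intro: has_vector_derivative_within_subset)
    moreover have "((\<lambda>t. m * t + k) has_vector_derivative m) (at t within {a'..b'})"
      by (auto intro!: derivative_eq_intros)
    ultimately show "((chart_map c \<circ> \<gamma>') has_vector_derivative y' t) (at t within {a'..b'})"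
      using vector_diff_chain_within by (fastforce simp: o_def \<gamma>'_def y'_def)
  qed (rule c)
  define f where "f t = N c (chart_map c (\<gamma> t)) (x' t)" for t
  have "(f has_integral arc_length c \<gamma> x' a b) (cbox a b)"
    unfolding f_def arc_length_def box_real
    by (intro integrable_integral integrable_continuous_real chart_arc_integrand_continuous[OF arc])
  from has_integral_affinity[OF this, of m k] m
  have "((\<lambda>t. f (m * t + k)) has_integral (arc_length c \<gamma> x' a b / m))
      ((\<lambda>x. (1 / m) *\<^sub>R x + - ((1 / m) *\<^sub>R k)) ` cbox a b)" by simp
  moreover have "(\<lambda>x. (1 / m) *\<^sub>R x + - ((1 / m) *\<^sub>R k)) ` cbox a b = {a'..b'}"
    using m image_affinity_atLeastAtMost[of "1 / m" "- k / m" a b] arc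
    by (auto simp: a'_def b'_def chart_arc_def diff_divide_distrib)
  ultimately have "((\<lambda>t. m * f (m * t + k)) has_integral (m * (arc_length c \<gamma> x' a b / m))) {a'..b'}"
    by (intro has_integral_mult_right) simp
  then have "((\<lambda>t. m * f (m * t + k)) has_integral arc_length c \<gamma> x' a b) {a'..b'}" using m by simp
  then have "integral {a'..b'} (\<lambda>t. m * f (m * t + k)) = arc_length c \<gamma> x' a b" by (rule integral_unique)
  moreover have "integral {a'..b'} (\<lambda>t. m * f (m * t + k)) = arc_length c \<gamma>' y' a' b'"
    unfolding arc_length_def
    by (rule Henstock_Kurzweil_Integration.integral_cong)
       (use img arc m in \<open>simp add: f_def \<gamma>'_def y'_def N_scale c chart_map_img chart_arc_def image_subset_iff\<close>)
  ultimately show "arc_length c \<gamma>' y' a' b' = arc_length c \<gamma> x' a b" by simp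
qed

lemma plen_affine:
  "plen \<gamma> a b l \<Longrightarrow> m > 0 \<Longrightarrow> plen (\<lambda>t. \<gamma> (m * t + k)) ((a - k) / m) ((b - k) / m) l"
proof (induction rule: plen.induct)
  case (arc c x' a b)
  then show ?case using plen.arc[OF chart_arc_affine(1)[OF arc]] chart_arc_affine(2)[OF arc] by simp
qed (auto intro: plen.trans)

lemma chart_arc_reverse:
  assumes arc: "chart_arc c \<gamma> x' a b"
  defines "\<gamma>' \<equiv> \<lambda>t. \<gamma> (- t)" and "y' \<equiv> \<lambda>t. - x' (- t)"
  shows "chart_arc c \<gamma>' y' (- b) (- a)" and "arc_length c \<gamma>' y' (- b) (- a) = arc_length c \<gamma> x' a b"
proof -
  have c: "c \<in> A" using arc by (auto simp: chart_arc_def)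
  have im: "(\<lambda>t. - t) ` {- b..- a} \<subseteq> {a..b}" by auto
  show "chart_arc c \<gamma>' y' (- b) (- a)"
    unfolding chart_arc_def
  proof (intro conjI ballI)
    show "\<gamma>' ` {- b..- a} \<subseteq> chart_dom c" using arc by (auto simp: \<gamma>'_def chart_arc_def)
    show "continuous_on {- b..- a} y'" unfolding y'_def
      using arc by (intro continuous_on_minus continuous_on_compose2[OF _ _ im, of x'])
        (auto simp: chart_arc_def intro!: continuous_intros)
    fix t assume t: "t \<in> {- b..- a}"
    have "((chart_map c \<circ> \<gamma>) has_vector_derivative x' (- t)) (at (- t) within (\<lambda>t. - t) ` {- b..- a})"
      using arc im t unfolding chart_arc_def by (intro has_vector_derivative_within_subset[OF _ im]) auto
    moreover have "((\<lambda>t. - t) has_vector_derivative - 1) (at t within {- b..- a})"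
      by (auto intro!: derivative_eq_intros)
    ultimately show "((chart_map c \<circ> \<gamma>') has_vector_derivative y' t) (at t within {- b..- a})"
      using vector_diff_chain_within by (fastforce simp: o_def \<gamma>'_def y'_def)
  qed (use c arc in \<open>auto simp: chart_arc_def\<close>)
  have "arc_length c \<gamma>' y' (- b) (- a) = integral {- b..- a} (\<lambda>t. N c (chart_map c (\<gamma> (- t))) (x' (- t)))"
    unfolding arc_length_def
  proof (rule Henstock_Kurzweil_Integration.integral_cong)
    fix t assume "t \<in> {- b..- a}"
    then have "chart_map c (\<gamma> (- t)) \<in> chart_img c"
      using arc chart_map_img[OF c] by (auto simp: chart_arc_def image_subset_iff)
    from N_scale[OF c this, of "- 1"]
    show "N c (chart_map c (\<gamma>' t)) (y' t) = N c (chart_map c (\<gamma> (- t))) (x' (- t))"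
      by (simp add: \<gamma>'_def y'_def)
  qed
  also have "\<dots> = arc_length c \<gamma> x' a b"
    unfolding arc_length_def
    by (rule Henstock_Kurzweil_Integration.integral_reflect_real)
  finally show "arc_length c \<gamma>' y' (- b) (- a) = arc_length c \<gamma> x' a b" .
qed

lemma plen_reverse: "plen \<gamma> a b l \<Longrightarrow> plen (\<lambda>t. \<gamma> (- t)) (- b) (- a) l"
proof (induction rule: plen.induct)
  case (arc c x' a b)
  then show ?case using plen.arc[OF chart_arc_reverse(1)[OF arc]] chart_arc_reverse(2)[OF arc] by simp
next
  case (trans a b l b' l')
  then show ?case using plen.trans add.commute by metis
qed

lemma plen_cong: "plen \<gamma> a b l \<Longrightarrow> (\<And>t. t \<in> {a..b} \<Longrightarrow> \<gamma>' t = \<gamma> t) \<Longrightarrow> plen \<gamma>' a b l"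
proof (induction rule: plen.induct)
  case (arc c x' a b)
  have "((chart_map c \<circ> \<gamma>') has_vector_derivative x' t) (at t within {a..b})" if "t \<in> {a..b}" for t
    by (rule has_vector_derivative_transform[OF that, of _ "chart_map c \<circ> \<gamma>"])
       (use arc that in \<open>auto simp: chart_arc_def\<close>)
  then have "chart_arc c \<gamma>' x' a b"
    using arc by (auto simp: chart_arc_def)
  moreover have "arc_length c \<gamma>' x' a b = arc_length c \<gamma> x' a b"
    unfolding arc_length_def using arc by (intro Henstock_Kurzweil_Integration.integral_cong) simp
  ultimately show ?case using plen.arc by metis
next
  case (trans a b l b' l')
  have "a < b" "b < b'" using trans plen_less by auto
  then show ?case using trans by (intro plen.trans[of _ a b]) auto
qed

text \<open>Forgetting the curve turns concatenation and reversal into transitivity and symmetry of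
  a relation weighted by length.\<close>

definition joined :: "'m \<Rightarrow> 'm \<Rightarrow> real \<Rightarrow> bool"
  where "joined p q l \<longleftrightarrow> (\<exists>\<gamma>. plen \<gamma> 0 1 l \<and> \<gamma> 0 = p \<and> \<gamma> 1 = q)"

lemma plen_joined:
  assumes "plen \<gamma> a b l" shows "joined (\<gamma> a) (\<gamma> b) l"
proof -
  have ab: "b - a > 0" using plen_less[OF assms] by simp
  from plen_affine[OF assms this, of a] ab show ?thesis
    unfolding joined_def by (intro exI[of _ "\<lambda>t. \<gamma> ((b - a) * t + a)"]) auto
qed

lemma joined_trans:
  assumes "joined p q l" "joined q r l'" shows "joined p r (l + l')"
proof -
  obtain \<gamma> \<gamma>' where g: "plen \<gamma> 0 1 l" "\<gamma> 0 = p" "\<gamma> 1 = q" and g': "plen \<gamma>' 0 1 l'" "\<gamma>' 0 = q" "\<gamma>' 1 = r"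
    using assms by (auto simp: joined_def)
  \<comment> \<open>The shift by 1 is written as \<open>1 * t + - 1\<close> to match
    \<open>plen_affine\<close> with m = 1 and k = - 1.\<close>
  define \<beta> where "\<beta> t = (if t \<le> 1 then \<gamma> t else \<gamma>' (1 * t + - 1))" for t
  have "plen \<beta> 0 1 l" by (rule plen_cong[OF g(1)]) (simp add: \<beta>_def)
  moreover have "plen \<beta> ((0 - - 1) / 1) ((1 - - 1) / 1) l'"
    by (rule plen_cong[OF plen_affine[OF g'(1), of 1 "- 1"]]) (auto simp: \<beta>_def g g')
  ultimately have "plen \<beta> 0 2 (l + l')" by (intro plen.trans[of _ 0 1]) simp_all
  from plen_joined[OF this] show ?thesis by (simp add: \<beta>_def g g')
qed

lemma joined_sym:
  assumes "joined p q l" shows "joined q p l"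
proof -
  obtain \<gamma> where g: "plen \<gamma> 0 1 l" "\<gamma> 0 = p" "\<gamma> 1 = q" using assms by (auto simp: joined_def)
  from plen_joined[OF plen_reverse[OF g(1)]] g show ?thesis by simp
qed

lemma joined_nonneg: "joined p q l \<Longrightarrow> l \<ge> 0"
  unfolding joined_def using plen_nonneg by blast

lemma chart_exists: obtains c where "c \<in> A" "p \<in> chart_dom c"
  using atlas unfolding smooth_atlas_def by blast

section \<open>Agreement of \<open>plen\<close> with the piecewise paths, lengths and distance of
  the definitions\<close>

lemma chart_arc_speed:
  assumes arc: "chart_arc c \<gamma> x' a b" and t: "t \<in> {a<..<b}"
  shows "tangent_norm g (\<gamma> t) (velocity A \<gamma> UNIV t) = N c (chart_map c (\<gamma> t)) (x' t)"
proof -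
  have at: "at t within {a..b} = at t" using t by (simp add: at_within_Icc_at)
  have c: "c \<in> charts_at A (\<gamma> t)" using arc t by (auto simp: chart_arc_def charts_at_iff)
  have "continuous (at t) \<gamma>"
    using chart_arc_continuous[OF arc] t at
    unfolding continuous_on_eq_continuous_within by (metis greaterThanLessThan_subseteq_atLeastAtMost_iff order_refl subsetD)
  moreover have "((chart_map c \<circ> \<gamma>) has_vector_derivative x' t) (at t)"
    using arc t unfolding chart_arc_def at[symmetric] by auto
  ultimately have "velocity A \<gamma> UNIV t = tangent_of A c (\<gamma> t) (x' t)"
    by (intro velocity_eq_tangent_of[where \<gamma> = \<gamma> and t = t, OF c]) auto
  then show ?thesis
    using tangent_norm_component[OF c tangent_of_in_tangent_space[OF atlas c]] tangent_of_self[OF c] by simp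
qed

text \<open>Taking the velocity within \<open>UNIV\<close> makes the integrand one function for all
  pieces, so the integrals combine. It can differ from the coordinate formula only at the ends of an
  arc, a finite set.\<close>

lemma plen_has_integral:
  "plen \<gamma> a b l \<Longrightarrow> ((\<lambda>t. tangent_norm g (\<gamma> t) (velocity A \<gamma> UNIV t)) has_integral l) {a..b}"
proof (induction rule: plen.induct)
  case (arc c x' a b)
  have "((\<lambda>t. N c (chart_map c (\<gamma> t)) (x' t)) has_integral arc_length c \<gamma> x' a b) {a..b}"
    unfolding arc_length_def
    by (intro integrable_integral integrable_continuous_real chart_arc_integrand_continuous[OF arc])
  then show ?case
    by (rule has_integral_spike_finite[of "{a, b}", rotated 2]) (use chart_arc_speed[OF arc] in auto)
next
  case (trans a b l b' l')
  then have "a \<le> b" "b \<le> b'" using plen_less by force+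
  then show ?case using trans by (blast intro: has_integral_combine)
qed

text \<open>By continuity the curve stays in one chart near each time, where it is a chart arc;
  bisection joins these arcs.\<close>

lemma C1_curve_on_plen:
  assumes \<gamma>: "C1_curve_on A \<gamma> a b" and ab: "a < b"
  shows "\<exists>l. plen \<gamma> a b l"
proof -
  have cont: "continuous_on {a..b} \<gamma>" using \<gamma> by (simp add: C1_curve_on_def)
  \<comment> \<open>\<open>plen\<close> exists only on nondegenerate intervals, hence the premise
    \<open>u < v\<close>; an empty half in the joining step is then harmless.\<close>
  define P where "P u v \<longleftrightarrow> (a \<le> u \<longrightarrow> v \<le> b \<longrightarrow> u < v \<longrightarrow> (\<exists>l. plen \<gamma> u v l))" for u v
  have "P a b"
    using less_imp_le[OF ab]
  proof (induct rule: Bolzano)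
    case (trans u v w)
    then show ?case unfolding P_def by (cases "u = v"; cases "v = w") (auto intro: plen.trans)
  next
    case (local t)
    obtain c where c: "c \<in> A" "\<gamma> t \<in> chart_dom c" by (rule chart_exists)
    have "continuous (at t within {a..b}) \<gamma>"
      using cont local by (auto simp: continuous_on_eq_continuous_within)
    then have "\<forall>\<^sub>F s in at t within {a..b}. \<gamma> s \<in> chart_dom c"
      unfolding continuous_within by (rule topological_tendstoD[OF _ chart_open(1)[OF c(1)] c(2)])
    then obtain d where d: "d > 0" "\<And>s. s \<in> {a..b} \<Longrightarrow> s \<noteq> t \<Longrightarrow> dist s t < d \<Longrightarrow> \<gamma> s \<in> chart_dom c"
      unfolding eventually_at by blast
    have "\<exists>l. plen \<gamma> u v l" if uv: "a \<le> u" "u \<le> t" "t \<le> v" "v \<le> b" "u < v" "v - u < d" for u v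
    proof -
      have sub: "{u..v} \<subseteq> {a..b}" using uv by auto
      have dom: "s \<in> {a..b} \<inter> \<gamma> -` chart_dom c" if "s \<in> {u..v}" for s
        using d(2)[of s] that c uv by (cases "s = t") (auto simp: dist_real_def)
      have der: "((chart_map c \<circ> \<gamma>) has_vector_derivative velocity A \<gamma> {a..b} s c) (at s within {a..b})"
        if "s \<in> {u..v}" for s
        using \<gamma> dom[OF that] c(1)
        by (auto simp: C1_curve_on_def velocity_def charts_at_iff vector_derivative_works)
      have "continuous_on {u..v} (\<lambda>s. velocity A \<gamma> {a..b} s c)"
        by (rule continuous_on_subset[of "{a..b} \<inter> \<gamma> -` chart_dom c"])
           (use \<gamma> dom c(1) in \<open>auto simp: C1_curve_on_def\<close>)
      then have "chart_arc c \<gamma> (\<lambda>s. velocity A \<gamma> {a..b} s c) u v"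
        using uv c(1) dom has_vector_derivative_within_subset[OF der sub] by (auto simp: chart_arc_def)
      then show ?thesis using plen.arc by blast
    qed
    then show ?case using d(1) by (intro exI[of _ d]) (simp add: P_def)
  qed
  then show ?thesis using ab by (simp add: P_def)
qed

text \<open>\<open>C1_curve_on\<close> asks for regularity in every chart that the curve meets, an
  arc provides it in one; the transition maps carry it over.\<close>

lemma chart_arc_C1_curve_on:
  assumes arc: "chart_arc c \<gamma> x' a b" shows "C1_curve_on A \<gamma> a b"
  unfolding C1_curve_on_def
proof (intro conjI ballI)
  show cont: "continuous_on {a..b} \<gamma>" by (rule chart_arc_continuous[OF arc])
  fix c' assume c': "c' \<in> A"
  let ?y = "\<lambda>t. frechet_derivative (transition c c') (at (chart_map c (\<gamma> t))) (x' t)"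
  let ?X = "{a..b} \<inter> \<gamma> -` chart_dom c'"
  have c: "c \<in> A" using arc by (auto simp: chart_arc_def)
  have at: "c \<in> charts_at A (\<gamma> t)" if "t \<in> {a..b}" for t using arc that by (auto simp: chart_arc_def charts_at_iff)
  have at': "c' \<in> charts_at A (\<gamma> t)" if "t \<in> ?X" for t using c' that by (auto simp: charts_at_iff)
  have contt: "continuous (at t within {a..b}) \<gamma>" if "t \<in> {a..b}" for t
    using cont that by (auto simp: continuous_on_eq_continuous_within)
  have xd: "((chart_map c \<circ> \<gamma>) has_vector_derivative x' t) (at t within {a..b})" if "t \<in> {a..b}" for t
    using arc that by (auto simp: chart_arc_def)
  have yd: "((chart_map c' \<circ> \<gamma>) has_vector_derivative ?y t) (at t within {a..b})" if "t \<in> ?X" for t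
    using chart_velocity_change[OF at at'[OF that] _ contt xd] that by blast
  then show "(chart_map c' \<circ> \<gamma>) differentiable (at t within {a..b})" if "t \<in> ?X" for t
    using that by (metis differentiableI_vector)
  have "continuous_on ?X ?y"
    by (rule continuous_on_smooth_derivative[OF transition_smooth[OF c c']])
       (use arc chart_arc_coord_continuous[OF arc] in \<open>auto simp: chart_arc_def intro: continuous_on_subset\<close>)
  then show "continuous_on ?X (\<lambda>t. velocity A \<gamma> {a..b} t c')"
  proof (rule continuous_on_eq)
    fix t assume t: "t \<in> ?X"
    have "at t within {a..b} \<noteq> bot" using t arc by (simp add: chart_arc_def trivial_limit_within)
    from vector_derivative_within[OF this yd[OF t]] show "?y t = velocity A \<gamma> {a..b} t c'"
      using at'[OF t] by (simp add: velocity_def)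
  qed
qed

lemma plen_partition:
  "plen \<gamma> a b l \<Longrightarrow> \<exists>n (\<tau> :: nat \<Rightarrow> real). \<tau> 0 = a \<and> \<tau> n = b \<and>
     (\<forall>i<n. \<tau> i < \<tau> (Suc i) \<and> C1_curve_on A \<gamma> (\<tau> i) (\<tau> (Suc i)))"
proof (induction rule: plen.induct)
  case (arc c x' a b)
  then show ?case
    using chart_arc_C1_curve_on[OF arc]
    by (intro exI[of _ 1] exI[of _ "\<lambda>i. if i = 0 then a else b"]) (auto simp: chart_arc_def)
next
  case (trans a b l b' l')
  then obtain n n' and \<tau> \<tau>' :: "nat \<Rightarrow> real" where
    1: "\<tau> 0 = a" "\<tau> n = b" "\<forall>i<n. \<tau> i < \<tau> (Suc i) \<and> C1_curve_on A \<gamma> (\<tau> i) (\<tau> (Suc i))" and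
    2: "\<tau>' 0 = b" "\<tau>' n' = b'" "\<forall>i<n'. \<tau>' i < \<tau>' (Suc i) \<and> C1_curve_on A \<gamma> (\<tau>' i) (\<tau>' (Suc i))"
    by blast
  \<comment> \<open>At index n both partitions have the value b, so the second one is read from its
    index 0 and no break point is repeated.\<close>
  define \<sigma> where "\<sigma> i = (if i \<le> n then \<tau> i else \<tau>' (i - n))" for i
  have "\<sigma> i < \<sigma> (Suc i) \<and> C1_curve_on A \<gamma> (\<sigma> i) (\<sigma> (Suc i))" if "i < n + n'" for i
  proof (cases "i < n")
    case True
    then show ?thesis using 1 by (auto simp: \<sigma>_def)
  next
    case False
    then have "\<sigma> i = \<tau>' (i - n)" "\<sigma> (Suc i) = \<tau>' (Suc (i - n))" using 1 2 by (auto simp: \<sigma>_def Suc_diff_le)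
    then show ?thesis using 2(3) False that by auto
  qed
  then show ?case using 1 2 by (intro exI[of _ "n + n'"] exI[of _ \<sigma>]) (auto simp: \<sigma>_def)
qed

lemma partition_plen:
  assumes "\<And>i. i < n \<Longrightarrow> \<tau> i < \<tau> (Suc i) \<and> C1_curve_on A \<gamma> (\<tau> i) (\<tau> (Suc i))" "n > 0"
  shows "\<exists>l. plen \<gamma> (\<tau> 0) (\<tau> n) l"
  using assms
proof (induction n)
  case (Suc n)
  have last: "\<exists>l. plen \<gamma> (\<tau> n) (\<tau> (Suc n)) l" using Suc.prems(1)[of n] C1_curve_on_plen by blast
  show ?case
  proof (cases "n = 0")
    case False
    then show ?thesis using Suc last plen.trans by (metis less_SucI neq0_conv)
  qed (use last in simp)
qed simp

text \<open>A C1 piece is cut further until each part lies in one chart; conversely each chart arc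
  is a C1 piece. Thus the infimum defining the distance may be taken over
  \<open>plen\<close>.\<close>

lemma piecewise_C1_path_iff_plen: "piecewise_C1_path A \<gamma> \<longleftrightarrow> (\<exists>l. plen \<gamma> 0 1 l)"
proof
  assume "piecewise_C1_path A \<gamma>"
  then obtain n and \<tau> :: "nat \<Rightarrow> real" where n: "\<tau> 0 = 0" "\<tau> n = 1"
    "\<And>i. i < n \<Longrightarrow> \<tau> i < \<tau> (Suc i) \<and> C1_curve_on A \<gamma> (\<tau> i) (\<tau> (Suc i))"
    unfolding piecewise_C1_path_def by blast
  then have "n > 0" using gr0I by fastforce
  from partition_plen[where \<tau> = \<tau> and \<gamma> = \<gamma>, OF n(3) this] n show "\<exists>l. plen \<gamma> 0 1 l" by simp
next
  assume "\<exists>l. plen \<gamma> 0 1 l"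
  then show "piecewise_C1_path A \<gamma>"
    using plen_partition plen_continuous unfolding piecewise_C1_path_def path_def by blast
qed

lemma riemannian_length_plen:
  assumes "plen \<gamma> 0 1 l" shows "riemannian_length A g \<gamma> = l"
proof -
  have "velocity A \<gamma> {0..1} t = velocity A \<gamma> UNIV t" if "t \<in> {0<..<1}" for t
    using that by (simp add: velocity_def at_within_Icc_at fun_eq_iff)
  then have "((\<lambda>t. tangent_norm g (\<gamma> t) (velocity A \<gamma> {0..1} t)) has_integral l) {0..1}"
    by (intro has_integral_spike_finite[OF _ _ plen_has_integral[OF assms], of "{0, 1}"]) auto
  then show ?thesis unfolding riemannian_length_def by (rule integral_unique)
qed

lemma riemannian_dist_joined: "riemannian_dist A g p q = Inf {l. joined p q l}"
proof -
  have "{riemannian_length A g \<gamma> |\<gamma>. piecewise_C1_path A \<gamma> \<and> pathstart \<gamma> = p \<and> pathfinish \<gamma> = q}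
      = {l. joined p q l}"
    unfolding joined_def piecewise_C1_path_iff_plen pathstart_def pathfinish_def
    using riemannian_length_plen by blast
  then show ?thesis by (simp add: riemannian_dist_def)
qed

section \<open>Comparison of lengths with coordinate distances, and curves leaving a coordinate
  ball\<close>

lemma joined_line:
  assumes c: "c \<in> A" and seg: "closed_segment x y \<subseteq> chart_img c"
    and M: "\<And>z v. z \<in> closed_segment x y \<Longrightarrow> N c z v \<le> M * norm v"
  shows "\<exists>l. joined (chart_inv c x) (chart_inv c y) l \<and> l \<le> M * norm (y - x)"
proof -
  define z where "z t = x + t *\<^sub>R (y - x)" for t
  have z: "z t \<in> closed_segment x y" if "t \<in> {0..1}" for t
    using that unfolding closed_segment_def z_def by (auto intro!: exI[of _ t] simp: algebra_simps)
  define \<gamma> where "\<gamma> t = chart_inv c (z t)" for t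
  have co: "chart_map c (\<gamma> t) = z t" if "t \<in> {0..1}" for t
    using z[OF that] seg chart_map_inv[OF c] by (auto simp: \<gamma>_def)
  have arc: "chart_arc c \<gamma> (\<lambda>t. y - x) 0 1"
    unfolding chart_arc_def
  proof (intro conjI ballI)
    show "\<gamma> ` {0..1} \<subseteq> chart_dom c" using z seg chart_inv_dom[OF c] unfolding \<gamma>_def by blast
    fix t :: real assume t: "t \<in> {0..1}"
    have "(z has_vector_derivative (y - x)) (at t within {0..1})"
      unfolding z_def by (auto intro!: derivative_eq_intros)
    then show "((chart_map c \<circ> \<gamma>) has_vector_derivative y - x) (at t within {0..1})"
      by (rule has_vector_derivative_transform[OF t, rotated]) (use co in auto)
  qed (use c in auto)
  have "arc_length c \<gamma> (\<lambda>t. y - x) 0 1 \<le> integral {0..1} (\<lambda>t::real. M * norm (y - x))"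
    unfolding arc_length_def
    by (rule integral_le) (use chart_arc_integrand_continuous[OF arc] M z co in \<open>auto intro: integrable_continuous_real\<close>)
  then show ?thesis
    using plen_joined[OF plen.arc[OF arc]] by (auto simp: \<gamma>_def z_def)
qed

text \<open>On each arc the coordinate displacement is the integral of the coordinate velocity,
  whose norm is at most the speed divided by m; the triangle inequality adds the arcs.\<close>

lemma plen_chart_lower:
  assumes p: "plen \<gamma> a b l" and c: "c \<in> A"
    and K: "\<And>t. t \<in> {a..b} \<Longrightarrow> \<gamma> t \<in> chart_dom c" "\<And>t. t \<in> {a..b} \<Longrightarrow> chart_map c (\<gamma> t) \<in> K"
    and m: "m > 0" "\<And>x v. x \<in> K \<Longrightarrow> m * norm v \<le> N c x v"
  shows "m * norm (chart_map c (\<gamma> b) - chart_map c (\<gamma> a)) \<le> l"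
  using p c
proof (rule plen_chart_induct[where P = "\<lambda>a b l. m * norm (chart_map c (\<gamma> b) - chart_map c (\<gamma> a)) \<le> l"])
  show "\<gamma> ` {a..b} \<subseteq> chart_dom c" using K by auto
next
  fix u v x' assume uv: "a \<le> u" "v \<le> b" and arc: "chart_arc c \<gamma> x' u v"
  have "u < v" using arc by (simp add: chart_arc_def)
  then have "(x' has_integral (chart_map c \<circ> \<gamma>) v - (chart_map c \<circ> \<gamma>) u) {u..v}"
    using arc unfolding chart_arc_def
    by (intro fundamental_theorem_of_calculus[where f = "chart_map c \<circ> \<gamma>"]) auto
  then have eq: "chart_map c (\<gamma> v) - chart_map c (\<gamma> u) = integral {u..v} x'" and int: "x' integrable_on {u..v}"
    by (auto simp: integral_unique integrable_on_def)
  have "norm (integral {u..v} x') \<le> integral {u..v} (\<lambda>t. N c (chart_map c (\<gamma> t)) (x' t) / m)"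
  proof (rule integral_norm_bound_integral[OF int])
    show "(\<lambda>t. N c (chart_map c (\<gamma> t)) (x' t) / m) integrable_on {u..v}"
      using chart_arc_integrand_continuous[OF arc] m(1)
      by (intro integrable_continuous_real continuous_intros) auto
    show "norm (x' t) \<le> N c (chart_map c (\<gamma> t)) (x' t) / m" if "t \<in> {u..v}" for t
      using m(2)[OF K(2), of t "x' t"] that uv m(1) by (simp add: field_simps)
  qed
  then show "m * norm (chart_map c (\<gamma> v) - chart_map c (\<gamma> u)) \<le> arc_length c \<gamma> x' u v"
    using m(1) by (simp add: eq arc_length_def field_simps)
next
  fix u v w l l'
  assume "m * norm (chart_map c (\<gamma> v) - chart_map c (\<gamma> u)) \<le> l"
    "m * norm (chart_map c (\<gamma> w) - chart_map c (\<gamma> v)) \<le> l'"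
  moreover have "m * norm (chart_map c (\<gamma> w) - chart_map c (\<gamma> u)) \<le>
      m * (norm (chart_map c (\<gamma> w) - chart_map c (\<gamma> v)) + norm (chart_map c (\<gamma> v) - chart_map c (\<gamma> u)))"
    using m(1) norm_triangle_ineq[of "chart_map c (\<gamma> w) - chart_map c (\<gamma> v)" "chart_map c (\<gamma> v) - chart_map c (\<gamma> u)"] by (intro mult_left_mono) auto
  ultimately show "m * norm (chart_map c (\<gamma> w) - chart_map c (\<gamma> u)) \<le> l + l'"
    by (simp add: distrib_left)
qed

lemma open_chart_inv_image:
  assumes "c \<in> A" "open U" "U \<subseteq> chart_img c" shows "open (chart_inv c ` U)"
proof -
  have "openin (top_of_set (chart_dom c)) (chart_inv c ` U)"
    by (rule homeomorphism_imp_open_map[OF homeomorphism_symD[OF chart_simps(3)[OF atlas assms(1)]]])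
       (use assms in \<open>auto intro: open_subset\<close>)
  then show ?thesis using chart_open(1)[OF assms(1)] by (rule openin_open_trans)
qed

lemma closed_chart_inv_image:
  assumes "c \<in> A" "compact K" "K \<subseteq> chart_img c" shows "closed (chart_inv c ` K)"
  by (rule compact_imp_closed[OF compact_continuous_image])
     (use assms continuous_on_subset[OF continuous_chart_inv[OF assms(1)]] in auto)

text \<open>The times outside the open ball form a compact set, and s is its least element. Up to s
  the curve lies in the image of the closed ball, which is closed because the manifold is Hausdorff;
  hence at s it is exactly on the sphere. On a line with two origins a curve could leave the chart
  through the second origin with its coordinates still inside the ball.\<close>

lemma first_exit:
  assumes c: "c \<in> A" and R: "cball x0 R \<subseteq> chart_img c"
    and cont: "continuous_on {a..b::real} \<gamma>" and a: "\<gamma> a \<in> chart_inv c ` ball x0 R"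
    and exit: "t \<in> {a..b}" "\<gamma> t \<notin> chart_inv c ` ball x0 R"
  obtains s where "s \<in> {a<..b}" "\<And>t. t \<in> {a..s} \<Longrightarrow> \<gamma> t \<in> chart_inv c ` cball x0 R"
    "norm (chart_map c (\<gamma> s) - x0) = R"
proof -
  define B where "B = chart_inv c ` ball x0 R"
  define K where "K = chart_inv c ` cball x0 R"
  have B: "open B" and K: "closed K" and BK: "B \<subseteq> K"
    using c R unfolding B_def K_def
    by (auto intro!: open_chart_inv_image closed_chart_inv_image)
  define S where "S = {a..b} \<inter> \<gamma> -` (- B)"
  have "closed S" unfolding S_def
    using B by (intro continuous_closed_preimage[OF cont]) auto
  moreover have "S \<subseteq> {a..b}" by (auto simp: S_def)
  ultimately have "compact S" using compact_Icc[of a b] compact_Int_closed by (metis inf.absorb2)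
  moreover have "S \<noteq> {}" using exit by (auto simp: S_def B_def)
  ultimately obtain s where s: "s \<in> S" "\<And>t. t \<in> S \<Longrightarrow> s \<le> t" using compact_attains_inf by metis
  have sa: "a < s" "s \<le> b" using s a unfolding S_def B_def by (auto simp: less_le)
  have before: "\<gamma> t \<in> B" if "t \<in> {a..<s}" for t
    using s(2)[of t] that sa by (force simp: S_def)
  have "closed ({a..s} \<inter> \<gamma> -` K)"
    using sa K by (intro continuous_closed_preimage continuous_on_subset[OF cont]) auto
  then have "closure {a..<s} \<subseteq> {a..s} \<inter> \<gamma> -` K"
    using before BK by (intro closure_minimal) force+
  then have K': "\<gamma> t \<in> K" if "t \<in> {a..s}" for t using sa that by auto
  obtain y where y: "\<gamma> s = chart_inv c y" "y \<in> cball x0 R" using K'[of s] sa by (auto simp: K_def)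
  have "y \<notin> ball x0 R" using s(1) y(1) by (auto simp: S_def B_def)
  moreover have "chart_map c (\<gamma> s) = y" using y R chart_map_inv[OF c] by auto
  ultimately have "norm (chart_map c (\<gamma> s) - x0) = R"
    using y(2) by (auto simp: dist_norm norm_minus_commute)
  then show ?thesis using that[of s] sa K' by (auto simp: K_def)
qed

text \<open>A coordinate ball on which the metric is comparable to the Euclidean norm with fixed
  constants. The closed ball lies in the chart image, so compactness arguments apply to it.\<close>

definition coord_ball :: "('m, 'e) chart \<Rightarrow> 'e \<Rightarrow> real \<Rightarrow> real \<Rightarrow> real \<Rightarrow> bool"
  where "coord_ball c x0 R m M \<longleftrightarrow> c \<in> A \<and> R > 0 \<and> cball x0 R \<subseteq> chart_img c \<and> m > 0 \<and> M > 0 \<and>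
    (\<forall>x\<in>cball x0 R. \<forall>v. m * norm v \<le> N c x v \<and> N c x v \<le> M * norm v)"

lemma coord_ball_subset:
  "coord_ball c x0 R m M \<Longrightarrow> 0 < r \<Longrightarrow> r \<le> R \<Longrightarrow> coord_ball c x0 r m M"
  unfolding coord_ball_def by (meson cball_subset_cball_iff dist_self order_trans subsetD subset_cball)

lemma coord_ball_ex:
  assumes "c \<in> charts_at A p"
  obtains R m M where "coord_ball c (chart_map c p) R m M"
proof -
  have c: "c \<in> A" "chart_map c p \<in> chart_img c" using assms chart_map_img by (auto simp: charts_at_iff)
  obtain R where R: "R > 0" "cball (chart_map c p) R \<subseteq> chart_img c"
    using chart_open(2)[OF c(1)] c(2) open_contains_cball by blast
  obtain m M where "m > 0" "M > 0" "\<And>x v. x \<in> cball (chart_map c p) R \<Longrightarrow> m * norm v \<le> N c x v"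
    "\<And>x v. x \<in> cball (chart_map c p) R \<Longrightarrow> N c x v \<le> M * norm v"
    using N_equivalent[OF c(1) compact_cball R(2)] by metis
  then have "coord_ball c (chart_map c p) R m M" using R c by (simp add: coord_ball_def)
  then show ?thesis by (rule that)
qed

text \<open>Leaving the ball costs a coordinate displacement of at least
  \<open>R - norm (x - x0)\<close>, hence a length of at least m times that.\<close>

lemma exit_length:
  assumes B: "coord_ball c x0 R m M" and p: "plen \<gamma> a b l"
    and a: "\<gamma> a = chart_inv c x" "norm (x - x0) < R"
    and l: "l < m * (R - norm (x - x0))"
    and t: "t \<in> {a..b}"
  shows "\<gamma> t \<in> chart_inv c ` ball x0 R"
proof (rule ccontr)
  assume exit: "\<gamma> t \<notin> chart_inv c ` ball x0 R"
  have c: "c \<in> A" "cball x0 R \<subseteq> chart_img c" "m > 0" "\<And>x v. x \<in> cball x0 R \<Longrightarrow> m * norm v \<le> N c x v"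
    using B by (auto simp: coord_ball_def)
  have xB: "x \<in> ball x0 R" using a by (simp add: dist_norm norm_minus_commute)
  have x: "chart_map c (\<gamma> a) = x" using xB a c(2) chart_map_inv[OF c(1), of x] by (simp add: subset_iff)
  have "\<gamma> a \<in> chart_inv c ` ball x0 R" using xB a by blast
  from first_exit[OF c(1,2) plen_continuous[OF p] this t exit]
  obtain s where s: "s \<in> {a<..b}" "\<And>t. t \<in> {a..s} \<Longrightarrow> \<gamma> t \<in> chart_inv c ` cball x0 R"
    "norm (chart_map c (\<gamma> s) - x0) = R" by blast
  obtain l' where l': "plen \<gamma> a s l'" "l' \<le> l"
  proof (cases "s = b")
    case False
    then show ?thesis using plen_split[OF p, of s] s(1) that plen_nonneg by force
  qed (use p that in auto)
  have "m * norm (chart_map c (\<gamma> s) - chart_map c (\<gamma> a)) \<le> l'"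
  proof (rule plen_chart_lower[OF l'(1) c(1) _ _ c(3,4)])
    fix t assume "t \<in> {a..s}"
    then obtain y where y: "\<gamma> t = chart_inv c y" "y \<in> cball x0 R" using s(2) by blast
    then show "\<gamma> t \<in> chart_dom c" "chart_map c (\<gamma> t) \<in> cball x0 R"
      using c chart_inv_dom[OF c(1)] chart_map_inv[OF c(1)] by auto
  qed
  moreover have "R - norm (x - x0) \<le> norm (chart_map c (\<gamma> s) - chart_map c (\<gamma> a))"
    using norm_triangle_ineq[of "chart_map c (\<gamma> s) - x" "x - x0"] s(3) x by simp
  ultimately have "m * (R - norm (x - x0)) \<le> l"
    using c(3) l'(2) by (meson mult_left_mono less_imp_le order_trans)
  then show False using l by simp
qed

end

section \<open>The Riemannian distance is a metric inducing the manifold topology\<close>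

locale connected_riemannian = riemannian A g
  for A :: "('m::t2_space, 'e::euclidean_space) chart set"
    and g :: "'m \<Rightarrow> ('m, 'e) tvec \<Rightarrow> ('m, 'e) tvec \<Rightarrow> real" +
  assumes connected: "connected (UNIV :: 'm set)"
begin

abbreviation d :: "'m \<Rightarrow> 'm \<Rightarrow> real" where "d \<equiv> riemannian_dist A g"

lemma joined_nearby:
  assumes B: "coord_ball c x0 R m M" and xy: "x \<in> cball x0 R" "y \<in> cball x0 R"
  shows "\<exists>l. joined (chart_inv c x) (chart_inv c y) l \<and> l \<le> M * norm (y - x)"
proof (rule joined_line)
  have seg: "closed_segment x y \<subseteq> cball x0 R" using xy by (intro closed_segment_subset) auto
  then show "N c z v \<le> M * norm v" if "z \<in> closed_segment x y" for z v
    using B that unfolding coord_ball_def by blast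
  show "closed_segment x y \<subseteq> chart_img c" using B seg unfolding coord_ball_def by blast
qed (use B in \<open>simp add: coord_ball_def\<close>)

text \<open>Being joined is an equivalence relation, and coordinate balls give each point a
  neighbourhood inside its class; connectedness leaves one class. The infimum defining d is
  therefore over a nonempty set.\<close>

lemma joined_ex: "\<exists>l. joined p q l"
proof (rule connected_equivalence_relation[OF connected])
  fix p :: 'm
  obtain c where c: "c \<in> A" "p \<in> chart_dom c" by (rule chart_exists)
  then obtain R m M where B: "coord_ball c (chart_map c p) R m M"
    using coord_ball_ex[of c p] by (auto simp: charts_at_iff)
  have R: "ball (chart_map c p) R \<subseteq> chart_img c" "R > 0" using B ball_subset_cball by (force simp: coord_ball_def)+
  have "open (chart_inv c ` ball (chart_map c p) R)"
    by (rule open_chart_inv_image[OF c(1) _ R(1)]) simp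
  moreover have "p \<in> chart_inv c ` ball (chart_map c p) R"
    using R(2) chart_inv_map[OF c] by (intro image_eqI[of _ _ "chart_map c p"]) auto
  moreover have "\<exists>l. joined p q l" if q: "q \<in> chart_inv c ` ball (chart_map c p) R" for q
  proof -
    obtain y where y: "q = chart_inv c y" "y \<in> cball (chart_map c p) R"
      using q ball_subset_cball by blast
    then show ?thesis using joined_nearby[OF B _ y(2), of "chart_map c p"] R(2) chart_inv_map[OF c] by auto
  qed
  ultimately show "\<exists>T. openin (top_of_set UNIV) T \<and> p \<in> T \<and> (\<forall>q\<in>T. \<exists>l. joined p q l)"
    by auto
qed (use joined_sym joined_trans in blast)+

lemma d_le: "joined p q l \<Longrightarrow> d p q \<le> l"
  unfolding riemannian_dist_joined
  by (rule cInf_lower) (auto intro: joined_nonneg bdd_belowI[of _ 0])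

lemma d_approx: "d p q < e \<Longrightarrow> \<exists>l. joined p q l \<and> l < e"
  using cInf_lessD[of "{l. joined p q l}" e] joined_ex[of p q] by (auto simp: riemannian_dist_joined)

lemma d_nonneg: "d p q \<ge> 0"
  unfolding riemannian_dist_joined by (rule cInf_greatest) (use joined_ex joined_nonneg in auto)

lemma d_sym: "d p q = d q p"
  unfolding riemannian_dist_joined by (rule arg_cong[of _ _ Inf]) (auto intro: joined_sym)

lemma d_triangle: "d p r \<le> d p q + d q r"
proof (rule field_le_epsilon)
  fix e :: real assume "e > 0"
  then obtain l l' where "joined p q l" "l < d p q + e / 2" "joined q r l'" "l' < d q r + e / 2"
    using d_approx[of p q "d p q + e / 2"] d_approx[of q r "d q r + e / 2"] by auto
  then show "d p r \<le> d p q + d q r + e" using d_le[OF joined_trans[of p q l r l']] by simp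
qed

lemma d_chart_le:
  assumes "coord_ball c x0 R m M" "x \<in> cball x0 R" "y \<in> cball x0 R"
  shows "d (chart_inv c x) (chart_inv c y) \<le> M * norm (y - x)"
  using joined_nearby[OF assms] d_le by force

lemma d_self: "d p p = 0"
proof -
  obtain c where c: "c \<in> A" "p \<in> chart_dom c" by (rule chart_exists)
  then obtain R m M where B: "coord_ball c (chart_map c p) R m M"
    using coord_ball_ex[of c p] by (auto simp: charts_at_iff)
  then have "R > 0" by (simp add: coord_ball_def)
  then have "d p p \<le> 0"
    using d_chart_le[OF B, of "chart_map c p" "chart_map c p"] chart_inv_map[OF c] by simp
  then show ?thesis using d_nonneg[of p p] by simp
qed

lemma d_less_imp_in_ball:
  assumes B: "coord_ball c x0 R m M" and x: "norm (x - x0) < R"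
    and less: "d (chart_inv c x) q < m * (R - norm (x - x0))"
  shows "q \<in> chart_inv c ` ball x0 R"
proof -
  obtain l where "joined (chart_inv c x) q l" and l: "l < m * (R - norm (x - x0))"
    using d_approx[OF less] by blast
  then obtain \<gamma> where \<gamma>: "plen \<gamma> 0 1 l" "\<gamma> 0 = chart_inv c x" "\<gamma> 1 = q" by (auto simp: joined_def)
  from exit_length[OF B \<gamma>(1,2) x l, of 1] \<gamma>(3) show ?thesis by simp
qed

text \<open>One half of the agreement of d with the topology; \<open>in_nhd_imp_d_small\<close> is
  the other. Curves too short to leave a small coordinate ball end inside it.\<close>

lemma d_small_imp_in_open:
  assumes "open V" "p \<in> V"
  shows "\<exists>e>0. \<forall>q. d p q < e \<longrightarrow> q \<in> V"
proof -
  obtain c where c: "c \<in> A" "p \<in> chart_dom c" by (rule chart_exists)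
  define x where "x = chart_map c p"
  have x: "x \<in> chart_img c" "chart_inv c x = p" using c chart_map_img chart_inv_map by (auto simp: x_def)
  obtain R m M where B: "coord_ball c x R m M" using coord_ball_ex[of c p] c by (auto simp: charts_at_iff x_def)
  have "(chart_inv c \<longlongrightarrow> p) (at x within chart_img c)"
    using continuous_chart_inv[OF c(1)] x by (auto simp: continuous_on_def)
  then have "\<forall>\<^sub>F y in at x. chart_inv c y \<in> V"
    using x(1) chart_open(2)[OF c(1)] assms by (metis at_within_open topological_tendstoD)
  then obtain r where r: "r > 0" "\<And>y. y \<noteq> x \<Longrightarrow> dist y x < r \<Longrightarrow> chart_inv c y \<in> V"
    unfolding eventually_at by blast
  have r': "chart_inv c y \<in> V" if "y \<in> ball x r" for y
    using r(2)[of y] that x(2) assms by (cases "y = x") (auto simp: dist_commute)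
  define \<rho> where "\<rho> = min r R"
  have \<rho>: "\<rho> > 0" using r B by (simp add: \<rho>_def coord_ball_def)
  have B': "coord_ball c x \<rho> m M" using coord_ball_subset[OF B \<rho>] by (simp add: \<rho>_def)
  have "q \<in> V" if "d p q < m * \<rho>" for q
  proof -
    have "q \<in> chart_inv c ` ball x \<rho>" using d_less_imp_in_ball[OF B', of x q] that \<rho> x(2) by simp
    then show ?thesis using r' by (auto simp: \<rho>_def)
  qed
  moreover have "m * \<rho> > 0" using B \<rho> by (simp add: coord_ball_def)
  ultimately show ?thesis by blast
qed

lemma d_eq_0: "d p q = 0 \<Longrightarrow> p = q"
  using d_small_imp_in_open[of "- {q}" p] by force

lemma in_nhd_imp_d_small:
  assumes e: "e > 0" shows "\<exists>V. open V \<and> p \<in> V \<and> (\<forall>q\<in>V. d p q < e)"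
proof -
  obtain c where c: "c \<in> A" "p \<in> chart_dom c" by (rule chart_exists)
  define x where "x = chart_map c p"
  have x: "chart_inv c x = p" using c chart_inv_map by (auto simp: x_def)
  obtain R m M where B: "coord_ball c x R m M" using coord_ball_ex[of c p] c by (auto simp: charts_at_iff x_def)
  have M: "M > 0" "R > 0" "cball x R \<subseteq> chart_img c" using B by (auto simp: coord_ball_def)
  define r where "r = min R (e / M)"
  have r: "r > 0" using M e by (simp add: r_def)
  have "open (chart_inv c ` ball x r)"
    using M(3) by (intro open_chart_inv_image[OF c(1)]) (auto simp: r_def)
  moreover have "p \<in> chart_inv c ` ball x r" using x r by force
  moreover have "d p q < e" if q: "q \<in> chart_inv c ` ball x r" for q
  proof -
    obtain y where y: "q = chart_inv c y" "y \<in> ball x r" using q by blast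
    then have "d p q \<le> M * norm (y - x)"
      using d_chart_le[OF B, of x y] x M(2) by (auto simp: r_def)
    also have "\<dots> < M * (e / M)"
      using y(2) M(1) by (intro mult_strict_left_mono) (auto simp: r_def dist_norm norm_minus_commute)
    finally show ?thesis using M(1) by simp
  qed
  ultimately show ?thesis by blast
qed

end

section \<open>Euler steps and integral curves in a chart\<close>

locale bounded_riemannian_field = connected_riemannian A g + riemannian_field A g F
  for A :: "('m::t2_space, 'e::euclidean_space) chart set"
    and g :: "'m \<Rightarrow> ('m, 'e) tvec \<Rightarrow> ('m, 'e) tvec \<Rightarrow> real"
    and F :: "'m \<Rightarrow> ('m, 'e) tvec" +
  fixes L :: real
  assumes L_pos: "L > 0"
    and nabla_bound: "\<And>p. tangent_onorm A g p (levi_civita A g F p) \<le> L"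
begin

section \<open>Infinitesimal growth of lengths and expansion by one Euler step\<close>

definition Df :: "('m, 'e) chart \<Rightarrow> 'e \<Rightarrow> 'e \<Rightarrow> 'e"
  where "Df c x v = frechet_derivative (field_in c) (at x) v"

definition nabla :: "('m, 'e) chart \<Rightarrow> 'e \<Rightarrow> 'e \<Rightarrow> 'e"
  where "nabla c x v = Df c x v + christoffel A g c x v (field_in c x)"

lemma Df_linear: "c \<in> A \<Longrightarrow> x \<in> chart_img c \<Longrightarrow> linear (Df c x)"
  using linear_frechet_derivative_smooth_on[OF field_smooth] unfolding Df_def by blast

lemma field_has_derivative:
  "c \<in> A \<Longrightarrow> x \<in> chart_img c \<Longrightarrow> (field_in c has_derivative Df c x) (at x)"
  using smooth_on_has_derivative[OF field_smooth] unfolding Df_def by blast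

lemma christoffel_facts:
  assumes "c \<in> A" "x \<in> chart_img c"
  shows "linear (\<lambda>a. christoffel A g c x a b)" "christoffel A g c x a b = christoffel A g c x b a"
    "DG c x w a b = G c x (christoffel A g c x w a) b + G c x a (christoffel A g c x w b)"
  using is_christoffel_christoffel[OF assms] unfolding is_christoffel_def bilinear_def DG_def by blast+

lemma nabla_linear: "c \<in> A \<Longrightarrow> x \<in> chart_img c \<Longrightarrow> linear (nabla c x)"
  unfolding nabla_def by (intro linear_compose_add Df_linear christoffel_facts)

text \<open>Translates the bound on \<open>tangent_onorm\<close> into the chart. Both norms can be
  read in coordinates because \<open>levi_civita_tangent\<close> makes the covariant derivative a
  tangent vector.\<close>

lemma N_nabla_le:
  assumes c: "c \<in> A" "x \<in> chart_img c"
  shows "N c x (nabla c x v) \<le> L * N c x v"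
proof -
  define p where "p = chart_inv c x"
  have cp: "c \<in> charts_at A p" and x: "chart_map c p = x"
    using c chart_inv_dom chart_map_inv by (auto simp: charts_at_iff p_def)
  have comp: "levi_civita A g F p Y c = nabla c x (Y c)" for Y
    using cp field_component[OF cp] by (simp add: levi_civita_def nabla_def Df_def x)
  have norms: "tangent_norm g p Y = N c x (Y c)"
    "tangent_norm g p (levi_civita A g F p Y) = N c x (nabla c x (Y c))" if "Y \<in> tangent_space A p" for Y
    using tangent_norm_component[OF cp that] tangent_norm_component[OF cp levi_civita_tangent[OF that]]
    by (simp_all add: x comp)
  obtain m M where m: "m > 0" "M > 0" "\<And>v. m * norm v \<le> N c x v" "\<And>v. N c x v \<le> M * norm v"
    by (rule N_equivalent[OF c(1), of "{x}"]) (use c(2) in auto)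
  obtain B where B: "B > 0" "\<And>v. norm (nabla c x v) \<le> B * norm v"
    using linear_bounded_pos[OF nabla_linear[OF c]] by blast
  \<comment> \<open>A real supremum bounds its members only if the set is bounded above. In finite
    dimension this holds at each point: the linear map \<open>nabla c x\<close> has a Euclidean
    bound B, and m and M convert between the norms.\<close>
  have ratio: "N c x (nabla c x w) / N c x w \<le> M * B / m" for w
  proof (cases "w = 0")
    case True
    then show ?thesis using m B N_scale[OF c, of 0 0] by simp
  next
    case False
    have pos: "N c x w > 0" using m(1) m(3)[of w] False by (meson less_le_trans mult_pos_pos zero_less_norm_iff)
    have "N c x (nabla c x w) \<le> M * (B * norm w)"
      using m(4)[of "nabla c x w"] B(2)[of w] m(2) by (meson mult_left_mono less_imp_le order_trans)
    also have "\<dots> \<le> M * (B * (N c x w / m))"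
      using m(3)[of w] m B by (intro mult_left_mono) (auto simp: field_simps)
    finally show ?thesis using pos by (simp add: field_simps)
  qed
  have bdd: "bdd_above ((\<lambda>Y. tangent_norm g p (levi_civita A g F p Y) / tangent_norm g p Y) ` tangent_space A p)"
    by (rule bdd_aboveI[of _ "M * B / m"]) (use norms ratio in auto)
  define X where "X = tangent_of A c p v"
  have X: "X \<in> tangent_space A p" "X c = v"
    using tangent_of_in_tangent_space[OF atlas cp] tangent_of_self[OF cp] by (auto simp: X_def)
  have "N c x (nabla c x v) / N c x v \<le> L"
    using cSUP_upper[OF X(1) bdd] nabla_bound[of p] norms[OF X(1)] X(2) by (simp add: tangent_onorm_def)
  then show ?thesis
  proof (cases "v = 0")
    case True
    then show ?thesis using linear_0[OF nabla_linear[OF c]] N_scale[OF c, of 0 0] by simp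
  next
    case False
    have "N c x v > 0" using m(1) m(3)[of v] False by (meson less_le_trans mult_pos_pos zero_less_norm_iff)
    then show ?thesis using \<open>N c x (nabla c x v) / N c x v \<le> L\<close> by (simp add: field_simps)
  qed
qed

text \<open>The left-hand side is the Lie derivative of the metric along \<open>F\<close>, which equals
  \<open>2 g(\<nabla>\<^sub>v F, v)\<close>. Expanding \<open>g(\<nabla>\<^sub>v F - L v, \<nabla>\<^sub>v F - L v) \<ge> 0\<close> replaces the Cauchy-Schwarz
  inequality.\<close>

lemma lie_derivative_le:
  assumes c: "c \<in> A" "x \<in> chart_img c"
  shows "DG c x (field_in c x) v v + 2 * G c x (Df c x v) v \<le> 2 * L * G c x v v"
proof -
  define w where "w = nabla c x v"
  note G_lin = linear_add[OF G_linear(2)[OF c]] linear_diff[OF G_linear(2)[OF c]]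
    linear_diff[OF G_linear(1)[OF c]] linear_scale[OF G_linear(2)[OF c]] linear_scale[OF G_linear(1)[OF c]]
  \<comment> \<open>Metric compatibility turns the first term into 2 G(\<Gamma>(F, v), v); symmetry
    of \<Gamma> exchanges F and v, which completes \<open>Df c x v\<close> to
    \<open>nabla c x v\<close>.\<close>
  have eq: "DG c x (field_in c x) v v + 2 * G c x (Df c x v) v = 2 * G c x w v"
    using christoffel_facts(2)[OF c, of "field_in c x" v]
    by (simp add: christoffel_facts(3)[OF c] w_def nabla_def G_lin G_sym[OF c, of v])
  have "(N c x w)\<^sup>2 \<le> (L * N c x v)\<^sup>2"
    using N_nabla_le[OF c] N_nonneg[OF c] by (intro power_mono) (auto simp: w_def)
  then have "G c x w w \<le> L\<^sup>2 * G c x v v"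
    using G_nonneg[OF c] by (simp add: N_def power_mult_distrib)
  moreover have "0 \<le> G c x (w - L *\<^sub>R v) (w - L *\<^sub>R v)" by (rule G_nonneg[OF c])
  then have "0 \<le> G c x w w - 2 * L * G c x w v + L\<^sup>2 * G c x v v"
    by (simp add: G_lin G_sym[OF c, of v w] power2_eq_square algebra_simps)
  ultimately have "2 * L * G c x w v \<le> 2 * L * (L * G c x v v)" by (simp add: power2_eq_square)
  then have "G c x w v \<le> L * G c x v v" using L_pos by simp
  then show ?thesis using eq by simp
qed

lemma euler_step_has_derivative:
  assumes "c \<in> A" "x \<in> chart_img c"
  shows "((\<lambda>x. x + s *\<^sub>R field_in c x) has_derivative (\<lambda>v. v + s *\<^sub>R Df c x v)) (at x)"
  by (intro has_derivative_add has_derivative_ident has_derivative_scaleR_right field_has_derivative assms)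

text \<open>The squared length \<Phi> of the image of v has s-derivative \<Psi>, which at s = 0 is
  the quantity in \<open>lie_derivative_le\<close>. Compactness keeps \<Psi> close to that value for
  small s, uniformly in x and unit v; the mean value theorem integrates the bound and homogeneity
  removes the normalization. Starting in the ball of radius R / 2 leaves room for the step.\<close>

lemma euler_step_norm:
  assumes B: "coord_ball c x0 R m M" and e: "e > 0"
  obtains s0 where "s0 > 0"
    "\<And>s x. s \<in> {0..s0} \<Longrightarrow> x \<in> cball x0 (R / 2) \<Longrightarrow> x + s *\<^sub>R field_in c x \<in> cball x0 R"
    "\<And>s x v. s \<in> {0..s0} \<Longrightarrow> x \<in> cball x0 (R / 2) \<Longrightarrow>
      N c (x + s *\<^sub>R field_in c x) (v + s *\<^sub>R Df c x v) \<le> (1 + (L + e) * s) * N c x v"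
proof -
  have c: "c \<in> A" and R: "R > 0" "cball x0 R \<subseteq> chart_img c" and m: "m > 0"
    "\<And>x v. x \<in> cball x0 R \<Longrightarrow> m * norm v \<le> N c x v"
    using B by (auto simp: coord_ball_def)
  define K where "K = cball x0 (R / 2)"
  have K: "compact K" "K \<subseteq> cball x0 R" "K \<subseteq> chart_img c" using R by (auto simp: K_def)
  have fc: "continuous_on (chart_img c) (field_in c)" by (rule smooth_on_continuous[OF field_smooth[OF c]])
  obtain b where b: "b > 0" "\<And>x. x \<in> K \<Longrightarrow> norm (field_in c x) \<le> b"
    using compact_imp_bounded[OF compact_continuous_image[OF continuous_on_subset[OF fc K(3)] K(1)]]
    by (auto simp: bounded_pos)
  define s1 where "s1 = R / (2 * b)"
  have s1: "s1 > 0" using R b by (simp add: s1_def)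
  have E: "x + s *\<^sub>R field_in c x \<in> cball x0 R" if "s \<in> {0..s1}" "x \<in> K" for s x
  proof -
    have "norm (s *\<^sub>R field_in c x) \<le> s1 * b"
      using that b by (auto intro!: mult_mono)
    also have "\<dots> = R / 2" using b by (simp add: s1_def)
    finally have "norm (x + s *\<^sub>R field_in c x - x0) \<le> norm (x - x0) + R / 2"
      using norm_triangle_ineq[of "x - x0" "s *\<^sub>R field_in c x"] by (simp add: algebra_simps)
    moreover have "norm (x - x0) \<le> R / 2" using that by (simp add: K_def dist_norm norm_minus_commute)
    ultimately show ?thesis by (simp add: dist_norm norm_minus_commute)
  qed
  define \<Phi> where "\<Phi> x v s = G c (x + s *\<^sub>R field_in c x) (v + s *\<^sub>R Df c x v) (v + s *\<^sub>R Df c x v)" for x v s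
  define \<Psi> where "\<Psi> x v s = DG c (x + s *\<^sub>R field_in c x) (field_in c x) (v + s *\<^sub>R Df c x v) (v + s *\<^sub>R Df c x v)
    + G c (x + s *\<^sub>R field_in c x) (Df c x v) (v + s *\<^sub>R Df c x v)
    + G c (x + s *\<^sub>R field_in c x) (v + s *\<^sub>R Df c x v) (Df c x v)" for x v s
  have D: "(\<Phi> x v has_derivative (\<lambda>r. r * \<Psi> x v s)) (at s within {0..s1})"
    if "s \<in> {0..s1}" "x \<in> K" for x v s
  proof -
    have i: "x + s *\<^sub>R field_in c x \<in> chart_img c" using E[OF that] R by blast
    have "(\<Phi> x v has_derivative (\<lambda>r. DG c (x + s *\<^sub>R field_in c x) (r *\<^sub>R field_in c x)
          (v + s *\<^sub>R Df c x v) (v + s *\<^sub>R Df c x v)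
        + G c (x + s *\<^sub>R field_in c x) (r *\<^sub>R Df c x v) (v + s *\<^sub>R Df c x v)
        + G c (x + s *\<^sub>R field_in c x) (v + s *\<^sub>R Df c x v) (r *\<^sub>R Df c x v))) (at s within {0..s1})"
      unfolding \<Phi>_def
      by (rule G_has_derivative_compose[where z = "\<lambda>s. x + s *\<^sub>R field_in c x", OF c i that(1)])
         (auto intro!: derivative_eq_intros)
    then show ?thesis
      by (simp add: \<Psi>_def linear_scale[OF DG_linear[OF c i]] linear_scale[OF G_linear(1)[OF c i]]
          linear_scale[OF G_linear(2)[OF c i]] algebra_simps)
  qed
  define X where "X = K \<times> sphere (0::'e) 1 \<times> {0..s1}"
  have "compact X" unfolding X_def by (intro compact_Times K(1) compact_sphere compact_Icc)
  moreover have "continuous_on X (\<lambda>(x, v, s). \<Psi> x v s)"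
  proof -
    have z: "continuous_on X (\<lambda>y. fst y + snd (snd y) *\<^sub>R field_in c (fst y))"
      and f: "continuous_on X (\<lambda>y. field_in c (fst y))"
      by (intro continuous_intros continuous_on_compose2[OF fc]; use K(3) in \<open>force simp: X_def\<close>)+
    have w: "continuous_on X (\<lambda>y. Df c (fst y) (fst (snd y)))"
      unfolding Df_def
      by (rule continuous_on_smooth_derivative[OF field_smooth[OF c]])
         (use K(3) in \<open>auto simp: X_def intro!: continuous_intros\<close>)
    have a: "continuous_on X (\<lambda>y. fst (snd y) + snd (snd y) *\<^sub>R Df c (fst y) (fst (snd y)))"
      by (intro continuous_intros w)
    have zi: "(\<lambda>y. fst y + snd (snd y) *\<^sub>R field_in c (fst y)) ` X \<subseteq> chart_img c"
      using E R by (fastforce simp: X_def)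
    show ?thesis unfolding \<Psi>_def case_prod_unfold
      by (intro continuous_on_add continuous_on_DG[OF c z zi f a a] continuous_on_G[OF c z zi w a]
          continuous_on_G[OF c z zi a w])
  qed
  ultimately have "uniformly_continuous_on X (\<lambda>(x, v, s). \<Psi> x v s)"
    by (intro compact_uniformly_continuous)
  \<comment> \<open>For a unit vector, \<open>m\<^sup>2\<close> is at most \<open>G c x v v\<close>,
    so this tolerance is absorbed by the e in 2 (L + e) G(v, v).\<close>
  then obtain \<delta> where \<delta>: "\<delta> > 0" "\<And>z z'. z \<in> X \<Longrightarrow> z' \<in> X \<Longrightarrow> dist z' z < \<delta> \<Longrightarrow>
      dist ((\<lambda>(x, v, s). \<Psi> x v s) z') ((\<lambda>(x, v, s). \<Psi> x v s) z) < 2 * e * m\<^sup>2"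
    using e m(1) by (elim uniformly_continuous_onE[of _ _ "2 * e * m\<^sup>2"]) auto
  define s0 where "s0 = min s1 (\<delta> / 2)"
  have s0: "s0 > 0" "s0 \<le> s1" "s0 < \<delta>" using s1 \<delta>(1) by (auto simp: s0_def)
  have \<Psi>_le: "\<Psi> x v s \<le> 2 * (L + e) * G c x v v"
    if "s \<in> {0..s0}" "x \<in> K" "norm v = 1" for s x v
  proof -
    have xi: "x \<in> chart_img c" "x \<in> cball x0 R" using that K by auto
    have "dist (\<Psi> x v s) (\<Psi> x v 0) < 2 * e * m\<^sup>2"
      using \<delta>(2)[of "(x, v, 0)" "(x, v, s)"] that s0 by (auto simp: X_def dist_Pair_Pair dist_real_def)
    then have "\<Psi> x v s \<le> \<Psi> x v 0 + 2 * e * m\<^sup>2" by (simp add: dist_real_def)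
    also have "\<Psi> x v 0 \<le> 2 * L * G c x v v"
      using lie_derivative_le[OF c xi(1), of v] G_sym[OF c xi(1), of v "Df c x v"]
      by (simp add: \<Psi>_def)
    also have "m\<^sup>2 \<le> (N c x v)\<^sup>2"
      using m(2)[OF xi(2), of v] m(1) that(3) by (intro power_mono) auto
    then have "2 * e * m\<^sup>2 \<le> 2 * e * G c x v v"
      using e G_nonneg[OF c xi(1)] by (simp add: N_def)
    finally show ?thesis by (simp add: algebra_simps)
  qed
  have unit: "N c (x + s *\<^sub>R field_in c x) (v + s *\<^sub>R Df c x v) \<le> (1 + (L + e) * s) * N c x v"
    if s: "s \<in> {0..s0}" and x: "x \<in> K" and v: "norm v = 1" for s x v
  proof -
    have xi: "x \<in> chart_img c" using x K by auto
    have "\<exists>\<sigma>\<in>{0..s}. \<Phi> x v s - \<Phi> x v 0 = (s - 0) * \<Psi> x v \<sigma>"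
      using s s0 x by (intro mvt_very_simple has_derivative_subset[OF D]) auto
    then obtain \<sigma> where \<sigma>: "\<sigma> \<in> {0..s}" "\<Phi> x v s = \<Phi> x v 0 + s * \<Psi> x v \<sigma>" by auto
    have "s * \<Psi> x v \<sigma> \<le> s * (2 * (L + e) * G c x v v)"
      using \<Psi>_le[OF _ x v, of \<sigma>] \<sigma>(1) s by (intro mult_left_mono) auto
    moreover have "\<Phi> x v 0 = G c x v v" by (simp add: \<Phi>_def)
    ultimately have "\<Phi> x v s \<le> (1 + 2 * ((L + e) * s)) * G c x v v"
      using \<sigma>(2) by (simp add: algebra_simps)
    \<comment> \<open>Completing the square gives a factor whose root is linear in s.\<close>
    also have "\<dots> \<le> (1 + (L + e) * s)\<^sup>2 * G c x v v"
    proof (rule mult_right_mono[OF _ G_nonneg[OF c xi]])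
      show "1 + 2 * r \<le> (1 + r)\<^sup>2" for r :: real by (simp add: power2_sum)
    qed
    finally have "sqrt (\<Phi> x v s) \<le> sqrt ((1 + (L + e) * s)\<^sup>2 * G c x v v)" by simp
    also have "\<dots> = (1 + (L + e) * s) * N c x v"
      using s e L_pos by (simp add: real_sqrt_mult N_def)
    finally show ?thesis by (simp add: \<Phi>_def N_def)
  qed
  have "N c (x + s *\<^sub>R field_in c x) (v + s *\<^sub>R Df c x v) \<le> (1 + (L + e) * s) * N c x v"
    if s: "s \<in> {0..s0}" and x: "x \<in> K" for s x v
  proof (cases "v = 0")
    case True
    have i: "x + s *\<^sub>R field_in c x \<in> chart_img c" "x \<in> chart_img c" using E[of s x] s x R K s0 by auto
    show ?thesis
      using True linear_0[OF Df_linear[OF c i(2)]] N_scale[OF c i(1), of 0 0] N_scale[OF c i(2), of 0 0] by simp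
  next
    case False
    have i: "x + s *\<^sub>R field_in c x \<in> chart_img c" "x \<in> chart_img c" using E[of s x] s x R K s0 by auto
    define w where "w = v /\<^sub>R norm v"
    have w: "norm w = 1" "v = norm v *\<^sub>R w" using False by (auto simp: w_def)
    have "N c (x + s *\<^sub>R field_in c x) (v + s *\<^sub>R Df c x v)
        = N c (x + s *\<^sub>R field_in c x) (norm v *\<^sub>R (w + s *\<^sub>R Df c x w))"
      by (subst (1 2) w(2)) (simp add: linear_scale[OF Df_linear[OF c i(2)]] scaleR_add_right mult.commute)
    also have "\<dots> = norm v * N c (x + s *\<^sub>R field_in c x) (w + s *\<^sub>R Df c x w)"
      using N_scale[OF c i(1)] by simp
    also have "\<dots> \<le> norm v * ((1 + (L + e) * s) * N c x w)"
      by (intro mult_left_mono unit s x w) auto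
    also have "\<dots> = (1 + (L + e) * s) * N c x (norm v *\<^sub>R w)"
      using N_scale[OF c i(2)] by simp
    finally show ?thesis using w(2) by simp
  qed
  then show ?thesis
    using that[of s0] s0 E by (auto simp: K_def)
qed

text \<open>A nearly shortest curve from x to y is mapped by the Euler step to a curve at most
  \<kappa> times as long. The step is controlled only on the ball of radius R / 2, and the
  inequality \<open>2 * M * r < m * (R / 2 - r)\<close> keeps such a curve there: the distance is at
  most 2 M r, below the length needed to leave.\<close>

lemma euler_step_dist:
  assumes B: "coord_ball c x0 R m M" and s: "s \<ge> 0"
    and E: "\<And>x. x \<in> cball x0 (R / 2) \<Longrightarrow> x + s *\<^sub>R field_in c x \<in> cball x0 R"
    and \<kappa>: "\<kappa> > 0" "\<And>x v. x \<in> cball x0 (R / 2) \<Longrightarrow>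
      N c (x + s *\<^sub>R field_in c x) (v + s *\<^sub>R Df c x v) \<le> \<kappa> * N c x v"
    and r: "0 < r" "r \<le> R / 2" "2 * M * r < m * (R / 2 - r)"
    and xy: "x \<in> ball x0 r" "y \<in> ball x0 r"
  shows "d (chart_inv c (x + s *\<^sub>R field_in c x)) (chart_inv c (y + s *\<^sub>R field_in c y))
    \<le> \<kappa> * d (chart_inv c x) (chart_inv c y)"
proof -
  have c: "c \<in> A" and R: "R > 0" "cball x0 R \<subseteq> chart_img c" and m: "m > 0" "M > 0"
    using B by (auto simp: coord_ball_def)
  have B': "coord_ball c x0 (R / 2) m M" using coord_ball_subset[OF B, of "R / 2"] R by simp
  define e where "e y = y + s *\<^sub>R field_in c y" for y
  have ei: "e y \<in> chart_img c" if "y \<in> cball x0 (R / 2)" for y using E[OF that] R by (auto simp: e_def)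
  have *: "d (chart_inv c (e x)) (chart_inv c (e y)) \<le> \<kappa> * l"
    if l: "joined (chart_inv c x) (chart_inv c y) l" "l < m * (R / 2 - r)" for l
  proof -
    obtain \<gamma> where \<gamma>: "plen \<gamma> 0 1 l" "\<gamma> 0 = chart_inv c x" "\<gamma> 1 = chart_inv c y"
      using l(1) by (auto simp: joined_def)
    have xr: "norm (x - x0) < r" using xy by (simp add: dist_norm norm_minus_commute)
    have "m * (R / 2 - r) \<le> m * (R / 2 - norm (x - x0))" using m xr by simp
    then have stay: "\<gamma> t \<in> chart_inv c ` ball x0 (R / 2)" if "t \<in> {0..1}" for t
      using exit_length[OF B' \<gamma>(1,2) _ _ that] l(2) xr r by linarith
    have dom: "\<gamma> t \<in> chart_dom c" and co: "chart_map c (\<gamma> t) \<in> cball x0 (R / 2)" if t: "t \<in> {0..1}" for t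
    proof -
      obtain z where z: "\<gamma> t = chart_inv c z" "z \<in> ball x0 (R / 2)" using stay[OF t] by blast
      moreover have "z \<in> chart_img c" using z(2) R by force
      ultimately show "\<gamma> t \<in> chart_dom c" "chart_map c (\<gamma> t) \<in> cball x0 (R / 2)"
        using chart_inv_dom[OF c] chart_map_inv[OF c] by auto
    qed
    define \<beta> where "\<beta> t = chart_inv c (e (chart_map c (\<gamma> t)))" for t
    have \<beta>: "chart_map c (\<beta> t) = e (chart_map c (\<gamma> t))" "\<beta> t \<in> chart_dom c" if "t \<in> {0..1}" for t
      using chart_map_inv[OF c ei[OF co[OF that]]] chart_inv_dom[OF c ei[OF co[OF that]]] by (auto simp: \<beta>_def)
    have "\<exists>l'. plen \<beta> 0 1 l' \<and> l' \<le> \<kappa> * l"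
      using \<gamma>(1) c
    proof (rule plen_chart_induct[where P = "\<lambda>a b l. \<exists>l'. plen \<beta> a b l' \<and> l' \<le> \<kappa> * l"])
      show "\<gamma> ` {0..1} \<subseteq> chart_dom c" using dom by auto
    next
      fix u v x' assume uv: "0 \<le> u" "v \<le> 1" and arc: "chart_arc c \<gamma> x' u v"
      have sub: "t \<in> {0..1}" if "t \<in> {u..v}" for t using that uv by auto
      define y' where "y' t = x' t + s *\<^sub>R Df c (chart_map c (\<gamma> t)) (x' t)" for t
      have xi: "chart_map c (\<gamma> t) \<in> chart_img c" if "t \<in> {u..v}" for t
        using chart_map_img[OF c dom[OF sub[OF that]]] .
      have arc': "chart_arc c \<beta> y' u v"
        unfolding chart_arc_def
      proof (intro conjI ballI)
        show "\<beta> ` {u..v} \<subseteq> chart_dom c" using \<beta>(2) sub by auto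
        have "continuous_on {u..v} (\<lambda>t. Df c (chart_map c (\<gamma> t)) (x' t))"
          unfolding Df_def
          by (rule continuous_on_smooth_derivative[OF field_smooth[OF c] chart_arc_coord_continuous[OF arc]])
             (use xi arc in \<open>auto simp: chart_arc_def\<close>)
        then show "continuous_on {u..v} y'"
          unfolding y'_def using arc by (intro continuous_intros) (auto simp: chart_arc_def)
        fix t assume t: "t \<in> {u..v}"
        have x': "((chart_map c \<circ> \<gamma>) has_derivative (\<lambda>r. r *\<^sub>R x' t)) (at t within {u..v})"
          using arc t by (auto simp: chart_arc_def has_vector_derivative_def)
        have "((\<lambda>t. e ((chart_map c \<circ> \<gamma>) t)) has_derivative
            (\<lambda>r. r *\<^sub>R x' t + s *\<^sub>R Df c (chart_map c (\<gamma> t)) (r *\<^sub>R x' t))) (at t within {u..v})"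
          unfolding e_def
          by (rule has_derivative_compose[where g = "\<lambda>y. y + s *\<^sub>R field_in c y", OF x'])
             (use euler_step_has_derivative[OF c xi[OF t]] in simp)
        then have "((\<lambda>t. e ((chart_map c \<circ> \<gamma>) t)) has_vector_derivative y' t) (at t within {u..v})"
          by (simp add: has_vector_derivative_def y'_def linear_scale[OF Df_linear[OF c xi[OF t]]]
              algebra_simps)
        then show "((chart_map c \<circ> \<beta>) has_vector_derivative y' t) (at t within {u..v})"
          by (rule has_vector_derivative_transform[OF t, rotated]) (use \<beta>(1) sub in auto)
      qed (use c arc in \<open>auto simp: chart_arc_def\<close>)
      have "arc_length c \<beta> y' u v \<le> integral {u..v} (\<lambda>t. \<kappa> * N c (chart_map c (\<gamma> t)) (x' t))"
        unfolding arc_length_def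
      proof (rule integral_le)
        show "(\<lambda>t. N c (chart_map c (\<beta> t)) (y' t)) integrable_on {u..v}"
          "(\<lambda>t. \<kappa> * N c (chart_map c (\<gamma> t)) (x' t)) integrable_on {u..v}"
          by (intro integrable_continuous_real continuous_intros chart_arc_integrand_continuous arc arc')+
        show "N c (chart_map c (\<beta> t)) (y' t) \<le> \<kappa> * N c (chart_map c (\<gamma> t)) (x' t)" if "t \<in> {u..v}" for t
          using \<kappa>(2)[OF co[OF sub[OF that]], of "x' t"] \<beta>(1)[OF sub[OF that]] by (simp add: y'_def e_def)
      qed
      then have "arc_length c \<beta> y' u v \<le> \<kappa> * arc_length c \<gamma> x' u v"
        by (simp add: arc_length_def)
      then show "\<exists>l'. plen \<beta> u v l' \<and> l' \<le> \<kappa> * arc_length c \<gamma> x' u v"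
        using plen.arc[OF arc'] by blast
    next
      fix u v w l l'
      assume "\<exists>l'. plen \<beta> u v l' \<and> l' \<le> \<kappa> * l" "\<exists>l''. plen \<beta> v w l'' \<and> l'' \<le> \<kappa> * l'"
      then show "\<exists>l''. plen \<beta> u w l'' \<and> l'' \<le> \<kappa> * (l + l')"
        using plen.trans by (fastforce simp: distrib_left)
    qed
    then obtain l' where l': "plen \<beta> 0 1 l'" "l' \<le> \<kappa> * l" by blast
    have "x \<in> chart_img c" "y \<in> chart_img c" using xy r R by (force intro: less_imp_le)+
    then have "\<beta> 0 = chart_inv c (e x)" "\<beta> 1 = chart_inv c (e y)"
      using chart_map_inv[OF c] by (auto simp: \<beta>_def \<gamma>)
    then show ?thesis using d_le[OF plen_joined[OF l'(1)]] l'(2) by simp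
  qed
  have "d (chart_inv c x) (chart_inv c y) \<le> M * norm (y - x)"
    using xy r R by (intro d_chart_le[OF B]) auto
  also have "\<dots> \<le> M * (r + r)"
    using xy m norm_triangle_ineq4[of "y - x0" "x - x0"]
    by (intro mult_left_mono) (auto simp: dist_norm norm_minus_commute)
  also have "\<dots> < m * (R / 2 - r)" using r(3) by (simp add: algebra_simps)
  finally have less: "d (chart_inv c x) (chart_inv c y) < m * (R / 2 - r)" .
  \<comment> \<open>Passage to the infimum: for each z above the distance there is a curve shorter
    than z that is also too short to leave the half ball.\<close>
  have "d (chart_inv c (e x)) (chart_inv c (e y)) / \<kappa> \<le> d (chart_inv c x) (chart_inv c y)"
  proof (rule dense_ge)
    fix z assume z: "d (chart_inv c x) (chart_inv c y) < z"
    obtain l where "joined (chart_inv c x) (chart_inv c y) l" "l < min z (m * (R / 2 - r))"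
      using d_approx[of "chart_inv c x" "chart_inv c y" "min z (m * (R / 2 - r))"] z less by auto
    then have "d (chart_inv c (e x)) (chart_inv c (e y)) \<le> \<kappa> * l" "l < z" using * by auto
    then have "d (chart_inv c (e x)) (chart_inv c (e y)) \<le> \<kappa> * z"
      using \<kappa>(1) by (meson less_imp_le mult_left_mono order_trans)
    then show "d (chart_inv c (e x)) (chart_inv c (e y)) / \<kappa> \<le> z"
      using \<kappa>(1) by (simp add: field_simps)
  qed
  then show ?thesis using \<kappa>(1) by (simp add: e_def field_simps)
qed

section \<open>Integral curves in a chart and their comparison with Euler steps\<close>

lemma integral_curve_shift:
  assumes "integral_curve A F \<alpha>" shows "integral_curve A F (\<lambda>t. \<alpha> (t0 + t))"
  unfolding integral_curve_def
proof (intro conjI allI ballI)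
  show "continuous_on UNIV (\<lambda>t. \<alpha> (t0 + t))"
    using assms by (auto simp: integral_curve_def intro!: continuous_on_compose2[of UNIV \<alpha>] continuous_intros)
  fix t c assume "c \<in> charts_at A (\<alpha> (t0 + t))"
  then have "((chart_map c \<circ> \<alpha>) has_vector_derivative F (\<alpha> (t0 + t)) c) (at (t0 + t))"
    using assms by (simp add: integral_curve_def)
  moreover have "((\<lambda>t. t0 + t) has_vector_derivative 1) (at t)" by (auto intro!: derivative_eq_intros)
  ultimately have "((chart_map c \<circ> \<alpha>) \<circ> (\<lambda>t. t0 + t) has_vector_derivative 1 *\<^sub>R F (\<alpha> (t0 + t)) c) (at t)"
    by (intro vector_diff_chain_at)
  then show "((chart_map c \<circ> (\<lambda>t. \<alpha> (t0 + t))) has_vector_derivative F (\<alpha> (t0 + t)) c) (at t)"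
    by (simp add: o_def)
qed

lemma integral_curve_chart:
  "integral_curve A F \<alpha> \<Longrightarrow> c \<in> A \<Longrightarrow> \<alpha> t \<in> chart_dom c \<Longrightarrow>
    ((chart_map c \<circ> \<alpha>) has_vector_derivative field_in c (chart_map c (\<alpha> t))) (at t)"
  using field_component[of c "\<alpha> t"] by (simp add: integral_curve_def charts_at_iff)

lemma coord_ball_point:
  assumes "coord_ball c x0 R m M" "p \<in> chart_inv c ` cball x0 R"
  shows "p \<in> chart_dom c" "chart_map c p \<in> cball x0 R" "chart_inv c (chart_map c p) = p"
proof -
  obtain z where z: "p = chart_inv c z" "z \<in> cball x0 R" using assms(2) by blast
  then have "c \<in> A" "z \<in> chart_img c" using assms(1) by (auto simp: coord_ball_def)
  then show "p \<in> chart_dom c" "chart_map c p \<in> cball x0 R" "chart_inv c (chart_map c p) = p"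
    using z chart_inv_dom chart_map_inv by auto
qed

lemma integral_curve_linearization:
  assumes B: "coord_ball c x0 R m M" and \<alpha>: "integral_curve A F \<alpha>" and s: "s \<ge> 0"
    and stay: "\<And>\<tau>. \<tau> \<in> {t..t + s} \<Longrightarrow> \<alpha> \<tau> \<in> chart_inv c ` cball x0 R"
    and e: "\<And>\<tau>. \<tau> \<in> {t..t + s} \<Longrightarrow>
      norm (field_in c (chart_map c (\<alpha> \<tau>)) - field_in c (chart_map c (\<alpha> t))) \<le> e"
  shows "norm (chart_map c (\<alpha> (t + s)) - chart_map c (\<alpha> t) - s *\<^sub>R field_in c (chart_map c (\<alpha> t))) \<le> s * e"
proof -
  have c: "c \<in> A" using B by (simp add: coord_ball_def)
  have D: "((chart_map c \<circ> \<alpha>) has_vector_derivative field_in c (chart_map c (\<alpha> \<tau>))) (at \<tau> within {t..t + s})"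
    if "\<tau> \<in> {t..t + s}" for \<tau>
    by (rule has_vector_derivative_at_within, rule integral_curve_chart[OF \<alpha> c])
       (rule coord_ball_point(1)[OF B stay[OF that]])
  have "norm ((chart_map c \<circ> \<alpha>) (t + s) - (chart_map c \<circ> \<alpha>) t - (t + s - t) *\<^sub>R field_in c (chart_map c (\<alpha> t)))
      \<le> norm (t + s - t) * e"
    by (rule vector_differentiable_bound_linearization[OF D _ e])
       (use s in \<open>auto simp: closed_segment_eq_real_ivl\<close>)
  then show ?thesis using s by simp
qed

lemma field_bounded:
  assumes B: "coord_ball c x0 R m M"
  obtains b where "b > 0" "\<And>x. x \<in> cball x0 R \<Longrightarrow> norm (field_in c x) \<le> b"
proof -
  have c: "c \<in> A" "cball x0 R \<subseteq> chart_img c" using B by (auto simp: coord_ball_def)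
  have "continuous_on (cball x0 R) (field_in c)"
    using smooth_on_continuous[OF field_smooth[OF c(1)]] c(2) continuous_on_subset by blast
  then have "bounded (field_in c ` cball x0 R)"
    by (intro compact_imp_bounded compact_continuous_image) auto
  then show ?thesis using that by (auto simp: bounded_pos)
qed

text \<open>The field varies by at most 2 b along the curve, which bounds the linearization error by
  2 b s; the linear term adds b s. The crude constant 3 is enough.\<close>

lemma integral_curve_drift:
  assumes B: "coord_ball c x0 R m M" and \<alpha>: "integral_curve A F \<alpha>" and s: "s \<ge> 0"
    and stay: "\<And>\<tau>. \<tau> \<in> {t..t + s} \<Longrightarrow> \<alpha> \<tau> \<in> chart_inv c ` cball x0 R"
    and b: "\<And>x. x \<in> cball x0 R \<Longrightarrow> norm (field_in c x) \<le> b"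
  shows "norm (chart_map c (\<alpha> (t + s)) - chart_map c (\<alpha> t)) \<le> 3 * b * s"
proof -
  let ?f = "\<lambda>\<tau>. field_in c (chart_map c (\<alpha> \<tau>))"
  have fb: "norm (?f \<tau>) \<le> b" if "\<tau> \<in> {t..t + s}" for \<tau>
    using b coord_ball_point(2)[OF B stay[OF that]] by blast
  have "norm (?f \<tau> - ?f t) \<le> b + b" if "\<tau> \<in> {t..t + s}" for \<tau>
    using norm_triangle_ineq4[of "?f \<tau>" "?f t"] fb[OF that] fb[of t] s by auto
  from integral_curve_linearization[OF B \<alpha> s stay this]
  have "norm (chart_map c (\<alpha> (t + s)) - chart_map c (\<alpha> t) - s *\<^sub>R ?f t) \<le> s * (b + b)" .
  moreover have "norm (s *\<^sub>R ?f t) \<le> s * b" using fb[of t] s by (auto intro: mult_left_mono)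
  moreover have "norm (chart_map c (\<alpha> (t + s)) - chart_map c (\<alpha> t)) \<le>
      norm (chart_map c (\<alpha> (t + s)) - chart_map c (\<alpha> t) - s *\<^sub>R ?f t) + norm (s *\<^sub>R ?f t)"
    by (metis diff_add_cancel norm_triangle_ineq)
  ultimately show ?thesis by (simp add: algebra_simps)
qed

lemma euler_step_error:
  assumes B: "coord_ball c x0 R m M" and e: "e > 0"
  obtains \<delta> where "\<delta> > 0"
    "\<And>\<alpha> t s. integral_curve A F \<alpha> \<Longrightarrow> s \<in> {0..\<delta>} \<Longrightarrow>
      (\<And>\<tau>. \<tau> \<in> {t..t + s} \<Longrightarrow> \<alpha> \<tau> \<in> chart_inv c ` cball x0 R) \<Longrightarrow>
      norm (chart_map c (\<alpha> (t + s)) - (chart_map c (\<alpha> t) + s *\<^sub>R field_in c (chart_map c (\<alpha> t)))) \<le> e * s"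
proof -
  have c: "c \<in> A" "cball x0 R \<subseteq> chart_img c" using B by (auto simp: coord_ball_def)
  obtain b where b: "b > 0" "\<And>x. x \<in> cball x0 R \<Longrightarrow> norm (field_in c x) \<le> b"
    using field_bounded[OF B] by blast
  have "continuous_on (cball x0 R) (field_in c)"
    using smooth_on_continuous[OF field_smooth[OF c(1)]] c(2) continuous_on_subset by blast
  then have "uniformly_continuous_on (cball x0 R) (field_in c)"
    by (rule compact_uniformly_continuous) simp
  then obtain \<eta> where \<eta>: "\<eta> > 0"
    "\<And>x x'. x \<in> cball x0 R \<Longrightarrow> x' \<in> cball x0 R \<Longrightarrow> dist x' x < \<eta> \<Longrightarrow> dist (field_in c x') (field_in c x) < e"
    by (rule uniformly_continuous_onE[OF _ e]) blast
  \<comment> \<open>With steps up to \<open>\<eta> / (4 * b)\<close> the drift 3 b s is at most 3/4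
    of \<eta>, so the field varies by less than e.\<close>
  show ?thesis
  proof (rule that[of "\<eta> / (4 * b)"])
    show "\<eta> / (4 * b) > 0" using \<eta> b by simp
    fix \<alpha> t s assume \<alpha>: "integral_curve A F \<alpha>" and s: "s \<in> {0..\<eta> / (4 * b)}"
      and stay: "\<And>\<tau>. \<tau> \<in> {t..t + s} \<Longrightarrow> \<alpha> \<tau> \<in> chart_inv c ` cball x0 R"
    have "norm (field_in c (chart_map c (\<alpha> \<tau>)) - field_in c (chart_map c (\<alpha> t))) \<le> e"
      if \<tau>: "\<tau> \<in> {t..t + s}" for \<tau>
    proof -
      have "norm (chart_map c (\<alpha> (t + (\<tau> - t))) - chart_map c (\<alpha> t)) \<le> 3 * b * (\<tau> - t)"
        using \<tau> by (intro integral_curve_drift[OF B \<alpha> _ stay b(2)]) auto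
      also have "\<dots> \<le> 3 * b * (\<eta> / (4 * b))" using \<tau> s b by (intro mult_left_mono) auto
      also have "\<dots> < \<eta>" using b \<eta> by simp
      finally have "dist (chart_map c (\<alpha> \<tau>)) (chart_map c (\<alpha> t)) < \<eta>" by (simp add: dist_norm)
      then show ?thesis
        using \<eta>(2)[OF coord_ball_point(2)[OF B stay] coord_ball_point(2)[OF B stay], of t \<tau>] \<tau> s
        by (simp add: dist_norm)
    qed
    from integral_curve_linearization[where s = s and t = t, OF B \<alpha> _ stay this] s
    show "norm (chart_map c (\<alpha> (t + s)) - (chart_map c (\<alpha> t) + s *\<^sub>R field_in c (chart_map c (\<alpha> t)))) \<le> e * s"
      by (simp add: diff_diff_eq mult.commute)
  qed
qed

lemma integral_curve_stays:
  assumes B: "coord_ball c x0 R m M"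
  obtains T where "T > 0"
    "\<And>\<alpha> t. integral_curve A F \<alpha> \<Longrightarrow> \<alpha> 0 \<in> chart_inv c ` ball x0 (R / 2) \<Longrightarrow> t \<in> {0..T} \<Longrightarrow>
      \<alpha> t \<in> chart_inv c ` ball x0 R"
proof -
  have c: "c \<in> A" and R: "R > 0" "cball x0 R \<subseteq> chart_img c" using B by (auto simp: coord_ball_def)
  obtain b where b: "b > 0" "\<And>x. x \<in> cball x0 R \<Longrightarrow> norm (field_in c x) \<le> b"
    using field_bounded[OF B] by blast
  \<comment> \<open>The drift until T is at most 3 R / 8, less than the R / 2 needed to get from the
    half ball to the sphere. T does not depend on the curve.\<close>
  define T where "T = R / (8 * b)"
  have "\<alpha> t \<in> chart_inv c ` ball x0 R"
    if \<alpha>: "integral_curve A F \<alpha>" and 0: "\<alpha> 0 \<in> chart_inv c ` ball x0 (R / 2)" and t: "t \<in> {0..T}" for \<alpha> t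
  proof (rule ccontr)
    assume exit: "\<alpha> t \<notin> chart_inv c ` ball x0 R"
    have cont: "continuous_on {0..T} \<alpha>"
      using \<alpha> continuous_on_subset unfolding integral_curve_def by blast
    have "\<alpha> 0 \<in> chart_inv c ` ball x0 R" using 0 R by force
    then obtain s where s: "s \<in> {0<..T}" "\<And>t. t \<in> {0..s} \<Longrightarrow> \<alpha> t \<in> chart_inv c ` cball x0 R"
      "norm (chart_map c (\<alpha> s) - x0) = R"
      using first_exit[OF c R(2) cont _ t exit] by metis
    obtain z where z: "\<alpha> 0 = chart_inv c z" "z \<in> ball x0 (R / 2)" using 0 by blast
    then have "z \<in> cball x0 R" using R by auto
    then have "chart_map c (\<alpha> 0) = z" using z chart_map_inv[OF c subsetD[OF R(2)]] by simp
    then have "norm (chart_map c (\<alpha> 0) - x0) < R / 2" using z by (simp add: dist_norm norm_minus_commute)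
    moreover have "norm (chart_map c (\<alpha> (0 + s)) - chart_map c (\<alpha> 0)) \<le> 3 * b * s"
      using s by (intro integral_curve_drift[OF B \<alpha> _ _ b(2)]) auto
    moreover have "3 * b * s \<le> 3 * b * T" using s b by (intro mult_left_mono) auto
    moreover have "3 * b * T \<le> R / 2" using b R by (simp add: T_def field_simps)
    moreover have "norm (chart_map c (\<alpha> s) - x0) \<le>
        norm (chart_map c (\<alpha> s) - chart_map c (\<alpha> 0)) + norm (chart_map c (\<alpha> 0) - x0)"
      using norm_triangle_ineq[of "chart_map c (\<alpha> s) - chart_map c (\<alpha> 0)" "chart_map c (\<alpha> 0) - x0"] by simp
    ultimately show False using s(3) by simp
  qed
  then show ?thesis using that[of T] R b by (simp add: T_def)
qed

text \<open>One Euler step of size \<open>s\<close> expands distances by at most \<open>1 + (L + e) s\<close> and differs from the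
  flow by \<open>o(s)\<close>, so composing many small steps gives the exponential bound.\<close>

lemma local_expansion:
  "\<exists>V T. open V \<and> q \<in> V \<and> T > 0 \<and>
    (\<forall>\<alpha> \<beta> t. integral_curve A F \<alpha> \<longrightarrow> integral_curve A F \<beta> \<longrightarrow> \<alpha> 0 \<in> V \<longrightarrow> \<beta> 0 \<in> V \<longrightarrow> t \<in> {0..T} \<longrightarrow>
      d (\<alpha> t) (\<beta> t) \<le> exp (L * t) * d (\<alpha> 0) (\<beta> 0))"
proof -
  obtain c where c: "c \<in> A" "q \<in> chart_dom c" by (rule chart_exists)
  define x0 where "x0 = chart_map c q"
  obtain R m M where B: "coord_ball c x0 R m M" using coord_ball_ex[of c q] c by (auto simp: charts_at_iff x0_def)
  have R: "R > 0" "cball x0 R \<subseteq> chart_img c" and mM: "m > 0" "M > 0" using B by (auto simp: coord_ball_def)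
  \<comment> \<open>Chosen so that (2 M + m) r = m R / 4, which yields both r \<le> R / 2 and the
    inequality required by \<open>euler_step_dist\<close>.\<close>
  define r where "r = m * R / (4 * (2 * M + m))"
  have rm: "(2 * M + m) * r = m * R / 4" using mM by (simp add: r_def field_simps)
  have r: "r > 0" using R mM by (simp add: r_def)
  have "m * r \<le> (2 * M + m) * r" using mM r by simp
  then have "m * r \<le> m * (R / 4)" using rm by simp
  then have r2: "r \<le> R / 2" using mM R by simp
  have "m * R > 0" using R mM by simp
  then have "(2 * M + m) * r < m * R / 2" using rm by linarith
  then have r3: "2 * M * r < m * (R / 2 - r)" by (simp add: algebra_simps)
  have Br: "coord_ball c x0 r m M" using coord_ball_subset[OF B r] r2 R by simp
  obtain T where T: "T > 0"
    "\<And>\<alpha> t. integral_curve A F \<alpha> \<Longrightarrow> \<alpha> 0 \<in> chart_inv c ` ball x0 (r / 2) \<Longrightarrow> t \<in> {0..T} \<Longrightarrow>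
      \<alpha> t \<in> chart_inv c ` ball x0 r"
    using integral_curve_stays[OF Br] by blast
  \<comment> \<open>Curves starting in this smaller ball stay in the r-ball until T, so Euler steps
    may be taken from any of their points.\<close>
  define V where "V = chart_inv c ` ball x0 (r / 2)"
  have "open V" unfolding V_def
    by (rule open_chart_inv_image[OF c(1)]) (use R r r2 in \<open>auto intro: subset_trans[OF _ R(2)]\<close>)
  moreover have "q \<in> V" using r chart_inv_map[OF c] unfolding V_def x0_def
    by (intro image_eqI[of _ _ "chart_map c q"]) auto
  moreover have "d (\<alpha> t) (\<beta> t) \<le> exp (L * t) * d (\<alpha> 0) (\<beta> 0)"
    if \<alpha>: "integral_curve A F \<alpha>" "\<alpha> 0 \<in> V" and \<beta>: "integral_curve A F \<beta>" "\<beta> 0 \<in> V" and t: "t \<in> {0..T}"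
    for \<alpha> \<beta> t
  proof -
    define D where "D t = d (\<alpha> t) (\<beta> t)" for t
    have in_r: "\<gamma> \<tau> \<in> chart_inv c ` cball x0 R" "chart_inv c (chart_map c (\<gamma> \<tau>)) = \<gamma> \<tau>"
      "chart_map c (\<gamma> \<tau>) \<in> ball x0 r"
      if \<gamma>: "\<gamma> = \<alpha> \<or> \<gamma> = \<beta>" and \<tau>: "\<tau> \<in> {0..T}" for \<gamma> \<tau>
    proof -
      have "\<gamma> \<tau> \<in> chart_inv c ` ball x0 r" using T(2)[of \<gamma> \<tau>] \<gamma> \<tau> \<alpha> \<beta> by (auto simp: V_def)
      then obtain z where z: "\<gamma> \<tau> = chart_inv c z" "z \<in> ball x0 r" by blast
      then have zR: "z \<in> cball x0 R" using r2 R by auto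
      then show "\<gamma> \<tau> \<in> chart_inv c ` cball x0 R" using z by blast
      have "chart_map c (\<gamma> \<tau>) = z" using z zR R(2) chart_map_inv[OF c(1)] by auto
      then show "chart_inv c (chart_map c (\<gamma> \<tau>)) = \<gamma> \<tau>" "chart_map c (\<gamma> \<tau>) \<in> ball x0 r" using z by auto
    qed
    have bound: "D t \<le> exp ((L + e) * t) * (D 0 + e * t)" if e: "e > 0" for e
    proof -
      obtain s0 where s0: "s0 > 0"
        "\<And>s x. s \<in> {0..s0} \<Longrightarrow> x \<in> cball x0 (R / 2) \<Longrightarrow> x + s *\<^sub>R field_in c x \<in> cball x0 R"
        "\<And>s x v. s \<in> {0..s0} \<Longrightarrow> x \<in> cball x0 (R / 2) \<Longrightarrow>
          N c (x + s *\<^sub>R field_in c x) (v + s *\<^sub>R Df c x v) \<le> (1 + (L + e) * s) * N c x v"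
        using euler_step_norm[OF B e] by blast
      have "e / (2 * M) > 0" using e mM by simp
      then obtain \<delta> where \<delta>: "\<delta> > 0"
        "\<And>\<alpha> t s. integral_curve A F \<alpha> \<Longrightarrow> s \<in> {0..\<delta>} \<Longrightarrow>
          (\<And>\<tau>. \<tau> \<in> {t..t + s} \<Longrightarrow> \<alpha> \<tau> \<in> chart_inv c ` cball x0 R) \<Longrightarrow>
          norm (chart_map c (\<alpha> (t + s)) - (chart_map c (\<alpha> t) + s *\<^sub>R field_in c (chart_map c (\<alpha> t)))) \<le> e / (2 * M) * s"
        using euler_step_error[OF B] by metis
      \<comment> \<open>This bound survives joining intervals: an additive error from the later
        interval only grows when multiplied by the exponential factor of the earlier one.\<close>
      define P where "P u v \<longleftrightarrow> (0 \<le> u \<longrightarrow> u \<le> v \<longrightarrow> v \<le> T \<longrightarrow> D v \<le> exp ((L + e) * (v - u)) * (D u + e * (v - u)))"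
        for u v
      have "0 \<le> t" using t by simp
      then have "P 0 t"
      proof (induct rule: Bolzano)
        case (trans u v w)
        show ?case unfolding P_def
        proof (intro impI)
          assume u: "0 \<le> u" "u \<le> w" "w \<le> T"
          have "D w \<le> exp ((L + e) * (w - v)) * (D v + e * (w - v))" using trans u by (simp add: P_def)
          also have "\<dots> \<le> exp ((L + e) * (w - v)) *
              (exp ((L + e) * (v - u)) * (D u + e * (v - u)) + exp ((L + e) * (v - u)) * (e * (w - v)))"
          proof (intro mult_left_mono add_mono)
            show "D v \<le> exp ((L + e) * (v - u)) * (D u + e * (v - u))" using trans u by (simp add: P_def)
            have "1 * (e * (w - v)) \<le> exp ((L + e) * (v - u)) * (e * (w - v))"
              using trans e L_pos by (intro mult_right_mono) auto
            then show "e * (w - v) \<le> exp ((L + e) * (v - u)) * (e * (w - v))" by simp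
          qed simp
          also have "\<dots> = (exp ((L + e) * (w - v)) * exp ((L + e) * (v - u))) * (D u + e * (w - u))"
            by (simp add: algebra_simps)
          also have "exp ((L + e) * (w - v)) * exp ((L + e) * (v - u)) = exp ((L + e) * (w - u))"
            by (simp add: exp_add[symmetric] algebra_simps)
          finally show "D w \<le> exp ((L + e) * (w - u)) * (D u + e * (w - u))" .
        qed
      next
        case (local x)
        show ?case
        proof (intro exI[of _ "min s0 \<delta>"] conjI allI impI)
          fix u v assume uv: "u \<le> x \<and> x \<le> v \<and> v - u < min s0 \<delta>"
          show "P u v" unfolding P_def
          proof (intro impI)
            assume u: "0 \<le> u" "u \<le> v" "v \<le> T"
            define s where "s = v - u"
            have s: "s \<in> {0..s0}" "s \<in> {0..\<delta>}" "s \<ge> 0" "v = u + s" using uv u by (auto simp: s_def)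
            define \<epsilon> where "\<epsilon> \<gamma> = chart_map c (\<gamma> u) + s *\<^sub>R field_in c (chart_map c (\<gamma> u))" for \<gamma>
            \<comment> \<open>The coordinate error e s / (2 M) becomes a distance of at most e s /
              2; the two curves together contribute e s.\<close>
            have err: "d (\<gamma> v) (chart_inv c (\<epsilon> \<gamma>)) \<le> e / 2 * s" if \<gamma>: "\<gamma> = \<alpha> \<or> \<gamma> = \<beta>" for \<gamma>
            proof -
              have ic: "integral_curve A F \<gamma>" using \<gamma> \<alpha> \<beta> by blast
              have 1: "chart_map c (\<gamma> v) \<in> cball x0 R" "chart_map c (\<gamma> u) \<in> cball x0 (R / 2)"
                using in_r(3)[OF \<gamma>, of v] in_r(3)[OF \<gamma>, of u] u r2 R(1) by auto
              have "d (chart_inv c (chart_map c (\<gamma> v))) (chart_inv c (\<epsilon> \<gamma>)) \<le> M * norm (\<epsilon> \<gamma> - chart_map c (\<gamma> v))"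
                using s0(2)[OF s(1) 1(2)] 1(1) by (intro d_chart_le[OF B]) (auto simp: \<epsilon>_def)
              also have "\<dots> \<le> M * (e / (2 * M) * s)"
                using \<delta>(2)[OF ic s(2), of u] in_r(1)[OF \<gamma>] u s(4) mM
                by (intro mult_left_mono) (auto simp: \<epsilon>_def norm_minus_commute)
              finally show ?thesis using in_r(2)[OF \<gamma>, of v] u mM by simp
            qed
            have \<kappa>: "1 + (L + e) * s > 0" using L_pos e s by (simp add: add_pos_nonneg)
            have "d (chart_inv c (\<epsilon> \<alpha>)) (chart_inv c (\<epsilon> \<beta>)) \<le> (1 + (L + e) * s) *
                d (chart_inv c (chart_map c (\<alpha> u))) (chart_inv c (chart_map c (\<beta> u)))"
              unfolding \<epsilon>_def
              using in_r(3)[of \<alpha> u] in_r(3)[of \<beta> u] u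
              by (intro euler_step_dist[OF B s(3) s0(2)[OF s(1)] \<kappa> s0(3)[OF s(1)] r r2 r3]) auto
            also have "\<dots> = (1 + (L + e) * s) * D u"
              using in_r(2)[of \<alpha> u] in_r(2)[of \<beta> u] u by (simp add: D_def)
            finally have "D v \<le> (1 + (L + e) * s) * D u + e * s"
              using err[of \<alpha>] err[of \<beta>] d_triangle[of "\<alpha> v" "\<beta> v" "chart_inv c (\<epsilon> \<alpha>)"]
                d_triangle[of "chart_inv c (\<epsilon> \<alpha>)" "\<beta> v" "chart_inv c (\<epsilon> \<beta>)"]
                d_sym[of "\<beta> v" "chart_inv c (\<epsilon> \<beta>)"]
              by (simp add: D_def)
            also have "\<dots> \<le> exp ((L + e) * s) * D u + exp ((L + e) * s) * (e * s)"
            proof (rule add_mono)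
              show "(1 + (L + e) * s) * D u \<le> exp ((L + e) * s) * D u"
                by (intro mult_right_mono exp_ge_add_one_self) (simp add: D_def d_nonneg)
              have "1 * (e * s) \<le> exp ((L + e) * s) * (e * s)"
                using s e L_pos by (intro mult_right_mono) auto
              then show "e * s \<le> exp ((L + e) * s) * (e * s)" by simp
            qed
            finally show "D v \<le> exp ((L + e) * (v - u)) * (D u + e * (v - u))"
              by (simp add: s_def distrib_left)
          qed
        qed (use s0 \<delta> in simp)
      qed
      then show ?thesis using t by (simp add: P_def)
    qed
    \<comment> \<open>V and T were fixed before e, and only the admissible step size depends on e,
      so e may tend to 0 for fixed t.\<close>
    have "((\<lambda>e. exp ((L + e) * t) * (D 0 + e * t)) \<longlongrightarrow> exp ((L + 0) * t) * (D 0 + 0 * t)) (at_right 0)"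
      by (intro tendsto_intros)
    moreover have "\<forall>\<^sub>F e in at_right 0. D t \<le> exp ((L + e) * t) * (D 0 + e * t)"
      using bound by (auto simp: eventually_at_right_field intro: exI[of _ 1])
    ultimately have "D t \<le> exp ((L + 0) * t) * (D 0 + 0 * t)"
      by (rule tendsto_lowerbound) simp
    then show ?thesis by (simp add: D_def)
  qed
  ultimately show ?thesis using T(1) by blast
qed

section \<open>The flow\<close>

text \<open>Where the curves meet, \<open>local_expansion\<close> bounds their distance shortly
  afterwards by a multiple of 0. Agreement is then propagated by bisection, as implications over
  adjacent intervals compose.\<close>

lemma integral_curve_unique:
  assumes \<alpha>: "integral_curve A F \<alpha>" and \<beta>: "integral_curve A F \<beta>" and eq: "\<alpha> 0 = \<beta> 0" and t: "t \<ge> 0"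
  shows "\<alpha> t = \<beta> t"
proof -
  define P where "P u v \<longleftrightarrow> (\<alpha> u = \<beta> u \<longrightarrow> \<alpha> v = \<beta> v)" for u v
  have "P 0 t"
    using t
  proof (induct rule: Bolzano)
    case (local x)
    obtain V T where V: "open V" "\<alpha> x \<in> V" "T > 0" and exp:
      "\<And>\<alpha> \<beta> t. integral_curve A F \<alpha> \<Longrightarrow> integral_curve A F \<beta> \<Longrightarrow> \<alpha> 0 \<in> V \<Longrightarrow> \<beta> 0 \<in> V \<Longrightarrow> t \<in> {0..T} \<Longrightarrow>
        d (\<alpha> t) (\<beta> t) \<le> exp (L * t) * d (\<alpha> 0) (\<beta> 0)"
      using local_expansion[of "\<alpha> x"] by blast
    have "isCont \<alpha> x" using \<alpha> by (auto simp: integral_curve_def continuous_on_eq_continuous_at)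
    then have "\<forall>\<^sub>F u in at x. \<alpha> u \<in> V" using V by (auto simp: isCont_def intro: topological_tendstoD)
    then obtain r where r: "r > 0" "\<And>u. u \<noteq> x \<Longrightarrow> dist u x < r \<Longrightarrow> \<alpha> u \<in> V"
      unfolding eventually_at by blast
    have "P u v" if uv: "u \<le> x" "x \<le> v" "v - u < min r T" for u v
      unfolding P_def
    proof
      assume eq: "\<alpha> u = \<beta> u"
      have "\<alpha> u \<in> V" using r(2)[of u] V uv by (cases "u = x") (auto simp: dist_real_def)
      then have "d (\<alpha> (u + (v - u))) (\<beta> (u + (v - u))) \<le> exp (L * (v - u)) * d (\<alpha> (u + 0)) (\<beta> (u + 0))"
        using uv eq by (intro exp[of "\<lambda>t. \<alpha> (u + t)" "\<lambda>t. \<beta> (u + t)"] integral_curve_shift \<alpha> \<beta>) auto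
      then have "d (\<alpha> v) (\<beta> v) \<le> 0" using eq d_self by simp
      then show "\<alpha> v = \<beta> v" using d_eq_0 d_nonneg[of "\<alpha> v" "\<beta> v"] by simp
    qed
    then show ?case using r(1) V(3) by (intro exI[of _ "min r T"]) auto
  qed (simp add: P_def)
  then show ?thesis using eq by (simp add: P_def)
qed

lemma flow_add:
  assumes "is_flow A F \<phi>" "s \<ge> 0" shows "\<phi> (t + s) p = \<phi> s (\<phi> t p)"
  using integral_curve_unique[OF integral_curve_shift, of "\<lambda>t. \<phi> t p" "\<lambda>s. \<phi> s (\<phi> t p)" t s] assms
  by (simp add: is_flow_def)

text \<open>Bisection of the time interval along the orbit of p. The neighbourhood may shrink when
  intervals are joined, which is harmless since only its existence is claimed; its independence of
  the pair y, z is what matters later.\<close>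

lemma flow_locally_lipschitz:
  assumes \<phi>: "is_flow A F \<phi>" and h: "h \<ge> 0"
  shows "\<exists>W. open W \<and> p \<in> W \<and> (\<forall>y\<in>W. \<forall>z\<in>W. d (\<phi> h y) (\<phi> h z) \<le> exp (L * h) * d y z)"
proof -
  have ic: "integral_curve A F (\<lambda>t. \<phi> t y)" and \<phi>0: "\<phi> 0 y = y" for y using \<phi> by (auto simp: is_flow_def)
  define P where "P u v \<longleftrightarrow> (\<exists>W. open W \<and> \<phi> u p \<in> W \<and>
    (\<forall>y\<in>W. \<forall>z\<in>W. d (\<phi> (v - u) y) (\<phi> (v - u) z) \<le> exp (L * (v - u)) * d y z))" for u v
  have "P 0 h"
    using h
  proof (induct rule: Bolzano)
    case (trans u v w)
    obtain W1 where W1: "open W1" "\<phi> u p \<in> W1"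
      "\<And>y z. y \<in> W1 \<Longrightarrow> z \<in> W1 \<Longrightarrow> d (\<phi> (v - u) y) (\<phi> (v - u) z) \<le> exp (L * (v - u)) * d y z"
      using trans(1) by (auto simp: P_def)
    obtain W2 where W2: "open W2" "\<phi> v p \<in> W2"
      "\<And>y z. y \<in> W2 \<Longrightarrow> z \<in> W2 \<Longrightarrow> d (\<phi> (w - v) y) (\<phi> (w - v) z) \<le> exp (L * (w - v)) * d y z"
      using trans(2) by (auto simp: P_def)
    \<comment> \<open>The first time step must map into \<open>W2\<close>. Its own Lipschitz
      estimate provides this: points closer to \<open>\<phi> u p\<close> than e divided by the
      Lipschitz factor land within e of \<open>\<phi> v p\<close>.\<close>
    obtain e where e: "e > 0" "\<And>q. d (\<phi> v p) q < e \<Longrightarrow> q \<in> W2"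
      using d_small_imp_in_open[OF W2(1,2)] by blast
    obtain W3 where W3: "open W3" "\<phi> u p \<in> W3" "\<And>y. y \<in> W3 \<Longrightarrow> d (\<phi> u p) y < e / exp (L * (v - u))"
      using in_nhd_imp_d_small[of "e / exp (L * (v - u))"] e(1) by (metis divide_pos_pos exp_gt_zero)
    have vp: "\<phi> v p = \<phi> (v - u) (\<phi> u p)" using flow_add[OF \<phi>, of "v - u" u p] trans(3) by simp
    have into: "\<phi> (v - u) y \<in> W2" if "y \<in> W1" "y \<in> W3" for y
    proof -
      have "d (\<phi> v p) (\<phi> (v - u) y) \<le> exp (L * (v - u)) * d (\<phi> u p) y"
        unfolding vp by (rule W1(3)[OF W1(2) that(1)])
      also have "\<dots> < exp (L * (v - u)) * (e / exp (L * (v - u)))"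
        using W3(3)[OF that(2)] by (intro mult_strict_left_mono) auto
      finally show ?thesis using e(2) by simp
    qed
    show ?case unfolding P_def
    proof (intro exI[of _ "W1 \<inter> W3"] conjI ballI)
      fix y z assume yz: "y \<in> W1 \<inter> W3" "z \<in> W1 \<inter> W3"
      have split: "\<phi> (w - u) y = \<phi> (w - v) (\<phi> (v - u) y)" for y
        using flow_add[OF \<phi>, of "w - v" "v - u" y] trans(4) by simp
      have "d (\<phi> (w - u) y) (\<phi> (w - u) z) \<le> exp (L * (w - v)) * d (\<phi> (v - u) y) (\<phi> (v - u) z)"
        unfolding split using yz by (intro W2(3) into) auto
      also have "\<dots> \<le> exp (L * (w - v)) * (exp (L * (v - u)) * d y z)"
        using yz by (intro mult_left_mono W1(3)) auto
      also have "\<dots> = (exp (L * (w - v)) * exp (L * (v - u))) * d y z" by simp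
      also have "exp (L * (w - v)) * exp (L * (v - u)) = exp (L * (w - u))"
        by (simp add: exp_add[symmetric] algebra_simps)
      finally show "d (\<phi> (w - u) y) (\<phi> (w - u) z) \<le> exp (L * (w - u)) * d y z" .
    qed (use W1 W3 in auto)
  next
    case (local x)
    obtain V T where V: "open V" "\<phi> x p \<in> V" "T > 0" and exp:
      "\<And>\<alpha> \<beta> t. integral_curve A F \<alpha> \<Longrightarrow> integral_curve A F \<beta> \<Longrightarrow> \<alpha> 0 \<in> V \<Longrightarrow> \<beta> 0 \<in> V \<Longrightarrow> t \<in> {0..T} \<Longrightarrow>
        d (\<alpha> t) (\<beta> t) \<le> exp (L * t) * d (\<alpha> 0) (\<beta> 0)"
      using local_expansion[of "\<phi> x p"] by blast
    have "isCont (\<lambda>t. \<phi> t p) x" using ic[of p] by (auto simp: integral_curve_def continuous_on_eq_continuous_at)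
    then have "\<forall>\<^sub>F u in at x. \<phi> u p \<in> V" using V by (auto simp: isCont_def intro: topological_tendstoD)
    then obtain r where r: "r > 0" "\<And>u. u \<noteq> x \<Longrightarrow> dist u x < r \<Longrightarrow> \<phi> u p \<in> V"
      unfolding eventually_at by blast
    have "P u v" if uv: "u \<le> x" "x \<le> v" "v - u < min r T" for u v
      unfolding P_def
    proof (intro exI[of _ V] conjI ballI)
      show "\<phi> u p \<in> V" using r(2)[of u] V uv by (cases "u = x") (auto simp: dist_real_def)
      fix y z assume "y \<in> V" "z \<in> V"
      then show "d (\<phi> (v - u) y) (\<phi> (v - u) z) \<le> exp (L * (v - u)) * d y z"
        using exp[OF ic[of y] ic[of z], of "v - u"] uv \<phi>0 by simp
    qed (rule V(1))
    then show ?case using r(1) V(3) by (intro exI[of _ "min r T"]) auto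
  qed
  then show ?thesis by (simp add: P_def \<phi>0)
qed

text \<open>A nearly shortest curve may leave the neighbourhood where the flow is known to be
  Lipschitz, so it is cut into short arcs. The triangle inequality adds the image distances, while
  length is additive on the original curve; the image curve itself is never measured.\<close>

lemma flow_lipschitz_plen:
  assumes \<phi>: "is_flow A F \<phi>" and h: "h \<ge> 0"
  shows "plen \<gamma> a b l \<Longrightarrow> d (\<phi> h (\<gamma> a)) (\<phi> h (\<gamma> b)) \<le> exp (L * h) * l"
proof (induction rule: plen.induct)
  case (arc c x' a b)
  define P where "P u v \<longleftrightarrow> (a \<le> u \<longrightarrow> u \<le> v \<longrightarrow> v \<le> b \<longrightarrow>
    d (\<phi> h (\<gamma> u)) (\<phi> h (\<gamma> v)) \<le> exp (L * h) * arc_length c \<gamma> x' u v)" for u v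
  have "a \<le> b" using arc by (simp add: chart_arc_def)
  then have "P a b"
  proof (induct rule: Bolzano)
    case (trans u v w)
    show ?case unfolding P_def
    proof (intro impI)
      assume u: "a \<le> u" "u \<le> w" "w \<le> b"
      have "arc_length c \<gamma> x' u w = arc_length c \<gamma> x' u v + arc_length c \<gamma> x' v w"
      proof (cases "u = w")
        case True
        then show ?thesis using trans(3,4) by (simp add: arc_length_def)
      next
        case False
        then show ?thesis using arc_length_combine[OF chart_arc_subset[OF arc, of u w]] u trans(3,4) by simp
      qed
      then show "d (\<phi> h (\<gamma> u)) (\<phi> h (\<gamma> w)) \<le> exp (L * h) * arc_length c \<gamma> x' u w"
        using trans u d_triangle[of "\<phi> h (\<gamma> u)" "\<phi> h (\<gamma> w)" "\<phi> h (\<gamma> v)"]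
        by (simp add: P_def distrib_left)
    qed
  next
    case (local x)
    obtain W where W: "open W" "\<gamma> x \<in> W"
      "\<And>y z. y \<in> W \<Longrightarrow> z \<in> W \<Longrightarrow> d (\<phi> h y) (\<phi> h z) \<le> exp (L * h) * d y z"
      using flow_locally_lipschitz[OF \<phi> h] by metis
    have "continuous (at x within {a..b}) \<gamma>"
      using chart_arc_continuous[OF arc] local by (simp add: continuous_on_eq_continuous_within)
    then have "\<forall>\<^sub>F u in at x within {a..b}. \<gamma> u \<in> W"
      unfolding continuous_within using W by (auto intro: topological_tendstoD)
    then obtain r where r: "r > 0" "\<And>u. u \<in> {a..b} \<Longrightarrow> u \<noteq> x \<Longrightarrow> dist u x < r \<Longrightarrow> \<gamma> u \<in> W"
      unfolding eventually_at by blast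
    have "P u v" if uv: "u \<le> x" "x \<le> v" "v - u < r" for u v
      unfolding P_def
    proof (intro impI)
      assume u: "a \<le> u" "u \<le> v" "v \<le> b"
      show "d (\<phi> h (\<gamma> u)) (\<phi> h (\<gamma> v)) \<le> exp (L * h) * arc_length c \<gamma> x' u v"
      proof (cases "u = v")
        case True
        then show ?thesis by (simp add: d_self arc_length_def)
      next
        case False
        have "\<gamma> u \<in> W" "\<gamma> v \<in> W"
          using r(2)[of u] r(2)[of v] W(2) uv u by (cases "u = x"; cases "v = x"; auto simp: dist_real_def)+
        then have "d (\<phi> h (\<gamma> u)) (\<phi> h (\<gamma> v)) \<le> exp (L * h) * d (\<gamma> u) (\<gamma> v)" by (rule W(3))
        moreover have "d (\<gamma> u) (\<gamma> v) \<le> arc_length c \<gamma> x' u v"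
          using False u by (intro d_le plen_joined plen.arc chart_arc_subset[OF arc]) auto
        ultimately show ?thesis by (meson exp_ge_zero mult_left_mono order_trans)
      qed
    qed
    then show ?case using r(1) by blast
  qed
  then show ?case using \<open>a \<le> b\<close> by (simp add: P_def)
next
  case (trans a b l b' l')
  then show ?case
    using d_triangle[of "\<phi> h (\<gamma> a)" "\<phi> h (\<gamma> b')" "\<phi> h (\<gamma> b)"] by (simp add: distrib_left)
qed

lemma flow_lipschitz:
  assumes \<phi>: "is_flow A F \<phi>" and h: "h \<ge> 0"
  shows "d (\<phi> h p) (\<phi> h q) \<le> exp (L * h) * d p q"
proof -
  have "d (\<phi> h p) (\<phi> h q) / exp (L * h) \<le> d p q"
  proof (rule dense_ge)
    fix z assume "d p q < z"
    then obtain l where l: "joined p q l" "l < z" using d_approx by blast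
    then have "d (\<phi> h p) (\<phi> h q) \<le> exp (L * h) * l"
      using flow_lipschitz_plen[OF \<phi> h] by (auto simp: joined_def)
    also have "\<dots> \<le> exp (L * h) * z" using l(2) by simp
    finally show "d (\<phi> h p) (\<phi> h q) / exp (L * h) \<le> z" by (simp add: field_simps)
  qed
  then show ?thesis by (simp add: field_simps)
qed

end

section \<open>Accumulation of the local errors\<close>

lemma error_recursion:
  fixes h L C :: real
  assumes h: "h > 0" and L: "L > 0" and C: "C \<ge> 0"
    and e0: "e 0 = 0" and step: "\<And>k. e (Suc k) \<le> exp (L * h) * e k + C * h ^ (p + 1)"
  shows "e k \<le> C / L * (exp (real k * h * L) - 1) * h ^ p"
proof (induction k)
  case (Suc k)
  \<comment> \<open>This replaces each local error C h^(p+1) by (C / L) h^p (exp (L h) - 1), which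
    is exactly what makes the sum telescope.\<close>
  have "L * h \<le> exp (L * h) - 1" using exp_ge_add_one_self[of "L * h"] by linarith
  then have "C / L * h ^ p * (L * h) \<le> C / L * h ^ p * (exp (L * h) - 1)"
    using h L C by (intro mult_left_mono) auto
  then have 1: "C * h ^ (p + 1) \<le> C / L * h ^ p * (exp (L * h) - 1)" using L by (simp add: field_simps)
  have "e (Suc k) \<le> exp (L * h) * (C / L * (exp (real k * h * L) - 1) * h ^ p) + C * h ^ (p + 1)"
    using step[of k] mult_left_mono[OF Suc, of "exp (L * h)"] by simp
  also have "\<dots> \<le> exp (L * h) * (C / L * (exp (real k * h * L) - 1) * h ^ p) + C / L * h ^ p * (exp (L * h) - 1)"
    using 1 by simp
  also have "\<dots> = C / L * (exp (L * h) * exp (real k * h * L) - 1) * h ^ p"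
    by (simp add: algebra_simps diff_divide_distrib)
  also have "exp (L * h) * exp (real k * h * L) = exp (real (Suc k) * h * L)"
    by (simp add: exp_add[symmetric] algebra_simps)
  finally show ?case .
qed (use e0 in simp)

theorem theorem2:
  fixes A :: "('m::{t2_space, second_countable_topology}, 'e::euclidean_space) chart set"
    and g :: "'m \<Rightarrow> ('m, 'e) tvec \<Rightarrow> ('m, 'e) tvec \<Rightarrow> real"
    and F :: "'m \<Rightarrow> ('m, 'e) tvec"
    and \<phi> :: "real \<Rightarrow> 'm \<Rightarrow> 'm"
    and \<psi> :: "real \<Rightarrow> 'm \<Rightarrow> 'm"
    and u :: "real \<Rightarrow> 'm"
    and U :: "nat \<Rightarrow> 'm"
    and u0 :: 'm
    and h C L :: real
    and p :: nat
  assumes manifold: "smooth_atlas A" "connected (UNIV :: 'm set)"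
    and metric: "riemannian_metric A g"
    and field: "smooth_vector_field A F" "complete_vector_field A F"
    and flow: "is_flow A F \<phi>"
    and exact: "\<And>t. u t = \<phi> t u0"
    and step: "h > 0"
    and numerical: "U 0 = u0" "\<And>k. U (Suc k) = \<psi> h (U k)"
    and local_error: "\<And>x. riemannian_dist A g (\<psi> h x) (\<phi> h x) \<le> C * h ^ (p + 1)"
    and L_pos: "L > 0"
    and nabla_bound: "\<And>x. tangent_onorm A g x (levi_civita A g F x) \<le> L"
  shows "\<forall>k>0. riemannian_dist A g (u (real k * h)) (U k) \<le> C / L * (exp (real k * h * L) - 1) * h ^ p"
proof (intro allI impI)
  fix k :: nat
  interpret bounded_riemannian_field A g F L
    using manifold metric field L_pos nabla_bound by unfold_locales
  \<comment> \<open>The sign of C is forced by the local error bound, as distances are nonnegative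
    and h is positive.\<close>
  have "0 \<le> C * h ^ (p + 1)" using d_nonneg local_error order_trans by blast
  moreover have "h ^ (p + 1) > 0" using step by simp
  ultimately have C: "C \<ge> 0" by (meson mult_neg_pos not_less)
  show "riemannian_dist A g (u (real k * h)) (U k) \<le> C / L * (exp (real k * h * L) - 1) * h ^ p"
  proof (rule error_recursion[where e = "\<lambda>k. d (u (real k * h)) (U k)", OF step L_pos C])
    show "d (u (real 0 * h)) (U 0) = 0" using flow numerical(1) d_self by (simp add: exact is_flow_def)
    fix k
    have "u (real (Suc k) * h) = \<phi> h (u (real k * h))"
      using flow_add[OF flow, of h "real k * h" u0] step by (simp add: exact algebra_simps)
    \<comment> \<open>The intermediate point is the exact flow applied to the numerical value
      \<open>U k\<close>: one side is the old error expanded by the flow, the other a single local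
      error.\<close>
    then have "d (u (real (Suc k) * h)) (U (Suc k)) \<le>
        d (\<phi> h (u (real k * h))) (\<phi> h (U k)) + d (\<psi> h (U k)) (\<phi> h (U k))"
      using d_triangle[of "\<phi> h (u (real k * h))" "\<psi> h (U k)" "\<phi> h (U k)"]
        d_sym[of "\<phi> h (U k)" "\<psi> h (U k)"] by (simp add: numerical(2))
    also have "\<dots> \<le> exp (L * h) * d (u (real k * h)) (U k) + C * h ^ (p + 1)"
      using flow_lipschitz[OF flow] step by (intro add_mono local_error) simp
    finally show "d (u (real (Suc k) * h)) (U (Suc k)) \<le>
        exp (L * h) * d (u (real k * h)) (U k) + C * h ^ (p + 1)" .
  qed
qed

end
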